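(* Let $c > 1$ be a constant and let $p \ge 1$ be an integer. Let $\mathcal{A}$ be a $p$-pass (randomised) streaming algorithm that, for all sufficiently large $n$ and $m$, approximates the optimum value of $\textsc{set-cover}_{n,m}$ instances to within a factor smaller than $n^{1/(p+1)}/(c(p+1)^2)$ with probability at least $2/3$. Then $\mathcal{A}$ must use $\Omega(n^c/p^3)$ bits of space. Moreover, this space lower bound already holds for instances with $m = \Theta(n^{cp})$.
   Context: An instance of \textsc{set-cover} consists of a finite universe $\mathcal{X}$ and a collection $\mathcal{F}$ of subsets of $\mathcal{X}$ whose union is $\mathcal{X}$; a set cover is a subcollection of $\mathcal{F}$ whose union is $\mathcal{X}$, and the optimum value is the minimum size of a set cover. $\textsc{set-cover}_{n,m}$ denotes instances with $|\mathcal{X}| = n$ and $|\mathcal{F}| = m$. In the streaming model, the sets of $\mathcal{F}$ arrive one by one in an arbitrary order; a $p$-pass streaming algorithm may read this stream $p$ times in order and its space is the maximum number of bits of memory it uses. Approximating the optimum value to within a factor $\alpha$ means outputting a number between the optimum value and $\alpha$ times the optimum value. *)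

theory Defs
  imports "HOL-Probability.Probability_Mass_Function" "HOL-Library.Landau_Symbols"
begin

definition set_cover_instance :: "'a set \<Rightarrow> 'a set set \<Rightarrow> bool" where
  "set_cover_instance X F \<longleftrightarrow> finite X \<and> (\<forall>S\<in>F. S \<subseteq> X) \<and> \<Union>F = X"

definition set_cover :: "'a set \<Rightarrow> 'a set set \<Rightarrow> 'a set set \<Rightarrow> bool" where
  "set_cover X F G \<longleftrightarrow> G \<subseteq> F \<and> \<Union>G = X"

definition opt :: "'a set \<Rightarrow> 'a set set \<Rightarrow> nat" where
  "opt X F = (LEAST k. \<exists>G. set_cover X F G \<and> card G = k)"

text \<open>
  All arrival orders of all instances with a universe of size \<open>n\<close>, labelled by
  \<open>0, \<dots>, n - 1\<close>, and exactly \<open>m\<close> (pairwise distinct) sets.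
\<close>

definition set_cover_streams :: "nat \<Rightarrow> nat \<Rightarrow> nat set list set" where
  "set_cover_streams n m =
     {xs. distinct xs \<and> length xs = m \<and> set_cover_instance {..<n} (set xs)}"

text \<open>
  Memory contents are bit strings, and no computability or running time restriction is
  imposed.  The update function is told the number of the current pass; neither this nor
  the algorithm's description (which may depend on \<open>n\<close> and \<open>m\<close>) counts
  towards the space.
\<close>

record streaming_alg =
  init_mem :: "bool list"
  update :: "nat \<Rightarrow> nat set \<Rightarrow> bool list \<Rightarrow> bool list"
  answer :: "bool list \<Rightarrow> real"

text \<open>
  What is read in \<open>p\<close> passes over \<open>xs\<close>, each item tagged with its pass:
  \<open>List.product\<close> lists all items of pass 0 in stream order, then those of
  pass 1, and so on.
\<close>

definition passes :: "nat \<Rightarrow> 'a list \<Rightarrow> (nat \<times> 'a) list" where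
  "passes p xs = List.product [0..<p] xs"

definition memory :: "streaming_alg \<Rightarrow> (nat \<times> nat set) list \<Rightarrow> bool list" where
  "memory a ys = fold (\<lambda>(i, S). update a i S) ys (init_mem a)"

definition result :: "nat \<Rightarrow> streaming_alg \<Rightarrow> nat set list \<Rightarrow> real" where
  "result p a xs = answer a (memory a (passes p xs))"

definition bits_used :: "nat \<Rightarrow> streaming_alg \<Rightarrow> nat set list \<Rightarrow> nat" where
  "bits_used p a xs = Max ((\<lambda>j. length (memory a (take j (passes p xs)))) ` {..p * length xs})"

text \<open>
  A randomised algorithm is a probability distribution over deterministic ones, i.e. it has
  free access to a shared random string.  Fresh coins in every step are a special case,
  since a set occurs only once per pass and \<open>update\<close> depends on the pass.
  Space is the worst case over streams and coin tosses.
\<close>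

definition space_usage :: "nat \<Rightarrow> streaming_alg pmf \<Rightarrow> nat \<Rightarrow> nat \<Rightarrow> enat" where
  "space_usage p A n m =
     (SUP (xs, a) \<in> set_cover_streams n m \<times> set_pmf A. enat (bits_used p a xs))"

definition approximates_set_cover ::
  "nat \<Rightarrow> streaming_alg pmf \<Rightarrow> nat \<Rightarrow> nat \<Rightarrow> real \<Rightarrow> bool" where
  "approximates_set_cover p A n m \<beta> \<longleftrightarrow>
     (\<forall>xs \<in> set_cover_streams n m.
        measure_pmf.prob A
          {a. real (opt {..<n} (set xs)) \<le> result p a xs \<and>
              result p a xs \<le> \<beta> * real (opt {..<n} (set xs))} \<ge> 2 / 3)"

end

(*
  Number theory, needed because the fields below must have almost exactly n^(1/(p+1)) elements:
  there is a prime in (x, (1 + eps) x] for large x.  By Selberg's formula, a gap (x, lam x] forces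
  the intervals (x/k, lam x/k] to carry twice the average mass of primes for almost all primes k.
  Full intervals and the primes k would therefore both have density one half on a logarithmic
  scale, which leads to long runs of full intervals and contradicts Mertens' theorem.

  Communication complexity: pointer jumping on a t-ary tree of depth p, the levels speaking in the
  order from the leaves to the root.  A message of b bits about t independent subtrees is worth
  only O(sqrt (b/t)) for predicting a random one of them, so the first pass can be replaced by a
  fixed message and a fixed root pointer.  After p such steps one unknown bit is left.

  Reduction: the vertices of the tree are varieties in F_q^(p+1), cut out successively by
  equations y_j = f(x) with f of degree at most d < c (p + 1).  A vertex with pointer to a child
  contributes the difference of the two varieties, a leaf with bit 1 its curve.  If the leaf at
  the end of the path has bit 1, the p + 1 sets on the path cover everything; otherwise its curve
  of q points meets every set in at most d points.
*)

theory Submission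
  imports Defs "HOL-Number_Theory.Prime_Powers" "HOL-Computational_Algebra.Squarefree"
    "HOL-Analysis.Harmonic_Numbers" "HOL-Real_Asymp.Real_Asymp" "HOL-Probability.Hoeffding"
begin

section \<open>Chebyshev and Mertens estimates\<close>

text \<open>Following the path costs \<open>p + 1\<close> passes, because each pass meets a pointer
  only after all levels below it have gone by; depth \<open>p\<close> leaves the algorithm one pass
  short. The rest is a matter of constants. Put \<open>y = n powr (1 / (p + 1))\<close> and
  \<open>K = c * (p + 1)\<close>. Optima at most \<open>p + 1\<close> and at least
  \<open>q / d\<close> are told apart by a factor below \<open>y / (K * (p + 1))\<close> once
  \<open>q / d \<ge> y / K\<close>, while \<open>q ^ (d + 1)\<close> polynomials supply about
  \<open>n powr c\<close> children once \<open>d + 1 \<ge> K\<close> and \<open>q\<close> is close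
  to \<open>y\<close>. When \<open>K\<close> is an integer this forces \<open>d = K - 1\<close>, so
  \<open>q\<close> may lose no more than the factor \<open>1 - 1 / K\<close>, and Bertrand's
  postulate would not do. On the other side \<open>q ^ (p + 1)\<close> has to stay below
  \<open>n\<close> by a fixed proportion, since the spare elements make the sets distinct. The power
  \<open>p ^ 3\<close> has two sources: a pass consists of up to \<open>p\<close> relevant messages,
  so one elimination step costs about \<open>sqrt (p * b / t)\<close>, and the \<open>p\<close>
  losses must add up to the gap \<open>2 / 3 - 1 / 2\<close>, whence \<open>t\<close> is at most of
  order \<open>p ^ 3 * b\<close>.\<close>

lemma sum_divisors_swap:
  fixes f :: "nat \<Rightarrow> nat \<Rightarrow> 'a :: comm_monoid_add"
  shows "(\<Sum>n=1..N. \<Sum>d | d dvd n. f d (n div d)) = (\<Sum>d=1..N. \<Sum>m=1..N div d. f d m)"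
proof -
  have "(\<Sum>n=1..N. \<Sum>d | d dvd n. f d (n div d)) =
        (\<Sum>(n,d)\<in>(SIGMA n:{1..N}. {d. d dvd n}). f d (n div d))"
    by (intro sum.Sigma) auto
  also have "\<dots> = (\<Sum>(d,m)\<in>(SIGMA d:{1..N}. {1..N div d}). f d m)"
  proof (rule sum.reindex_bij_witness[where i = "\<lambda>(d,m). (d*m,d)" and j = "\<lambda>(n,d). (d, n div d)"], goal_cases)
    case (1 a) thus ?case by auto
  next
    case (2 a)
    then obtain n d where a: "a = (n,d)" "1 \<le> n" "n \<le> N" "d dvd n" by auto
    hence "d \<le> N" "d \<ge> 1" using dvd_imp_le[of d n] by (auto intro: Nat.gr0I)
    thus ?case using a by (auto simp: div_le_mono dvd_div_eq_0_iff Suc_le_eq div_greater_zero_iff dvd_imp_le)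
  next
    case (3 b) thus ?case by auto
  next
    case (4 b)
    then obtain d m where b: "b = (d,m)" "1 \<le> d" "d \<le> N" "1 \<le> m" "m \<le> N div d" by auto
    have "d * m \<le> d * (N div d)" using b by auto
    also have "\<dots> \<le> N" by simp
    finally show ?case using b by (auto simp: Suc_le_eq)
  qed auto
  also have "\<dots> = (\<Sum>d=1..N. \<Sum>m=1..N div d. f d m)"
    by (intro sum.Sigma[symmetric]) auto
  finally show ?thesis .
qed

abbreviation \<Lambda> :: "nat \<Rightarrow> real" where "\<Lambda> \<equiv> mangoldt"

definition psi :: "nat \<Rightarrow> real" where "psi N = (\<Sum>n=1..N. \<Lambda> n)"

lemma psi_nonneg: "psi N \<ge> 0"
  unfolding psi_def by (intro sum_nonneg) (auto simp: mangoldt_nonneg)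

lemma psi_0 [simp]: "psi 0 = 0" by (simp add: psi_def)

lemma psi_Suc: "psi (Suc N) = psi N + \<Lambda> (Suc N)" by (simp add: psi_def)

lemma ln_fact_sum: "ln (fact N :: real) = (\<Sum>n=1..N. ln (real n))"
  by (induction N) (simp_all add: ln_mult add.commute)

text \<open>Chebyshev's identity. \<open>ln n\<close> is the divisor sum of
  \<open>\<Lambda>\<close>; grouping by the cofactor instead of by the divisor produces values of
  \<open>psi\<close>.\<close>

lemma ln_fact_psi: "ln (fact N :: real) = (\<Sum>m=1..N. psi (N div m))"
proof -
  have "ln (fact N :: real) = (\<Sum>n=1..N. \<Sum>d | d dvd n. \<Lambda> d)"
    unfolding ln_fact_sum by (intro sum.cong refl, subst mangoldt_sum) auto
  also have "\<dots> = (\<Sum>n=1..N. \<Sum>d | d dvd n. \<Lambda> (n div d))"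
  proof (rule sum.cong[OF refl])
    fix n assume n: "n \<in> {1..N}"
    show "(\<Sum>d | d dvd n. \<Lambda> d) = (\<Sum>d | d dvd n. \<Lambda> (n div d))"
      by (rule sum.reindex_bij_witness[where i = "\<lambda>d. n div d" and j = "\<lambda>d. n div d"])
         (use n in auto)
  qed
  also have "\<dots> = (\<Sum>m=1..N. psi (N div m))"
    using sum_divisors_swap[of "\<lambda>d m. \<Lambda> m" N] by (simp add: psi_def)
  finally show ?thesis .
qed

lemma ln_fact_mangoldt: "ln (fact N :: real) = (\<Sum>d=1..N. \<Lambda> d * real (N div d))"
proof -
  have "ln (fact N :: real) = (\<Sum>n=1..N. \<Sum>d | d dvd n. \<Lambda> d)"
    unfolding ln_fact_sum by (intro sum.cong refl, subst mangoldt_sum) auto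
  also have "\<dots> = (\<Sum>d=1..N. \<Lambda> d * real (N div d))"
    using sum_divisors_swap[of "\<lambda>d m. \<Lambda> d" N] by (simp add: mult.commute)
  finally show ?thesis .
qed

lemma mangoldt_le_ln: "n \<ge> 1 \<Longrightarrow> \<Lambda> n \<le> ln (real n)"
proof -
  assume n: "n \<ge> 1"
  have "\<Lambda> n \<le> (\<Sum>d | d dvd n. \<Lambda> d)"
    by (rule member_le_sum) (use n in \<open>auto simp: mangoldt_nonneg\<close>)
  also have "\<dots> = ln (real n)" using mangoldt_sum[of n, where 'a = real] n by simp
  finally show ?thesis .
qed

text \<open>The logarithm of the central binomial coefficient gives each \<open>d\<close> the weight
  \<open>2 * N div d - 2 * (N div d)\<close>, which is never negative and equals 1 for
  \<open>N < d \<le> 2 * N\<close>.\<close>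

lemma psi_double: "psi (2 * N) \<le> psi N + 2 * real N * ln 2"
proof -
  have "psi (2*N) - psi N = (\<Sum>d\<in>{N+1..2*N}. \<Lambda> d)"
    unfolding psi_def
    using sum.ub_add_nat[of 1 N \<Lambda> N] by (simp add: mult_2)
  also have "\<dots> \<le> (\<Sum>d\<in>{N+1..2*N}. \<Lambda> d * (real (2*N div d) - 2 * real (N div d)))"
  proof (intro sum_mono)
    fix d assume d: "d \<in> {N+1..2*N}"
    hence "N div d = 0" "2 * N div d = 1"
      by (auto intro!: div_nat_eqI)
    thus "\<Lambda> d \<le> \<Lambda> d * (real (2*N div d) - 2 * real (N div d))" by simp
  qed
  also have "\<dots> \<le> (\<Sum>d\<in>{1..2*N}. \<Lambda> d * (real (2*N div d) - 2 * real (N div d)))"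
  proof (intro sum_mono2)
    fix d assume d: "d \<in> {1..2*N} - {N+1..2*N}"
    have "2 * (N div d) \<le> 2 * N div d"
      proof (cases "d = 0")
      case False
      have "2 * (N div d) * d \<le> 2 * N" by (simp add: mult.assoc)
      thus ?thesis using False by (simp add: less_eq_div_iff_mult_less_eq)
    qed simp
    hence "2 * real (N div d) \<le> real (2 * N div d)" by (metis of_nat_le_iff of_nat_mult of_nat_numeral)
    thus "0 \<le> \<Lambda> d * (real (2*N div d) - 2 * real (N div d))"
      by (simp add: mangoldt_nonneg)
  qed auto
  also have "\<dots> = ln (fact (2*N)) - 2 * ln (fact N)"
  proof -
    have "(\<Sum>d=1..2*N. \<Lambda> d * real (N div d)) = (\<Sum>d=1..N. \<Lambda> d * real (N div d))"
      by (intro sum.mono_neutral_right) auto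
    thus ?thesis unfolding ln_fact_mangoldt[of N]
      unfolding ln_fact_mangoldt[of "2*N"]
      by (simp only: right_diff_distrib sum_subtractf mult.left_commute[of _ 2] flip: sum_distrib_left)
  qed
  also have "\<dots> = ln (real ((2*N) choose N))"
    by (subst binomial_fact) (auto simp: ln_div ln_mult)
  also have "\<dots> \<le> ln (2 ^ (2*N))"
    using binomial_le_pow2[of "2*N" N]
    by (subst ln_le_cancel_iff) (auto simp: of_nat_le_iff[symmetric] simp del: of_nat_le_iff)
  also have "\<dots> = 2 * real N * ln 2" by (simp add: ln_realpow)
  finally show ?thesis by simp
qed

text \<open>Halving alone would give the constant \<open>2 * ln 2\<close>; 4 leaves room for the
  crude bound \<open>ln (2 * M + 1) \<le> 2 * M\<close> on the last term of an odd
  \<open>N\<close>.\<close>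

lemma psi_le: "psi N \<le> 4 * real N"
proof (induction N rule: less_induct)
  case (less N)
  have l2: "ln (2::real) \<le> 0.7"
    using ln2_le_25_over_36 by simp
  show ?case
  proof (cases "N \<le> 1")
    case True
    hence "N = 0 \<or> N = 1" by auto
    thus ?thesis by (auto simp: psi_def)
  next
    case False
    define M where "M = N div 2"
    have M: "M < N" "M \<ge> 1" using False by (auto simp: M_def)
    have "psi (2*M) \<le> 4 * real M + 2 * real M * 0.7"
      using psi_double[of M] less.IH[OF M(1)] mult_left_mono[OF l2, of "2 * real M"] by simp
    hence 1: "psi (2*M) \<le> 5.4 * real M" by simp
    show ?thesis
    proof (cases "even N")
      case True
      hence "N = 2 * M" by (simp add: M_def)
      thus ?thesis using 1 by simp
    next
      case odd: False
      hence N: "N = Suc (2 * M)" by (simp add: M_def)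
      have "psi N = psi (2*M) + \<Lambda> (Suc (2*M))" unfolding N psi_Suc ..
      also have "\<Lambda> (Suc (2*M)) \<le> ln (real (Suc (2*M)))" by (intro mangoldt_le_ln) auto
      also have "\<dots> \<le> 2 * M" using ln_add_one_self_le_self[of "real (2*M)"] by (simp add: add.commute)
      finally show ?thesis using 1 N by simp
    qed
  qed
qed

text \<open>With \<open>D = ln (N + 1) - ln N\<close>, a step changes the error by
  \<open>1 - N * D\<close>, which lies between 0 and \<open>1 / (N + 1)\<close>; hence the harmonic
  number on one side and the value at \<open>N = 1\<close> on the other.\<close>

lemma ln_fact_bounds:
  assumes "N \<ge> 1"
  shows "ln (fact N) \<ge> real N * ln (real N) - real N + 1"
    and "ln (fact N) \<le> real N * ln (real N) - real N + harm N"
proof -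
  have "ln (fact N) \<ge> real N * ln (real N) - real N + 1 \<and>
        ln (fact N) \<le> real N * ln (real N) - real N + harm N"
    using assms
  proof (induction N rule: dec_induct)
    case base thus ?case by (simp add: harm_def)
  next
    case (step N)
    define D where "D = ln (real N + 1) - ln (real N)"
    have D1: "real N * D \<le> 1"
      using ln_diff_le_inverse[of "real N"] step.hyps by (auto simp: D_def field_simps)
    have D2: "real N * D \<ge> 1 - 1 / (real N + 1)"
    proof -
      have "ln (real N / (real N + 1)) \<le> real N / (real N + 1) - 1"
        using step.hyps by (intro ln_le_minus_one) auto
      hence "D \<ge> 1 / (real N + 1)"
        using step.hyps by (simp add: D_def ln_div field_simps)
      hence "real N * D \<ge> real N * (1 / (real N + 1))" by (intro mult_left_mono) auto
      also have "real N * (1 / (real N + 1)) = 1 - 1 / (real N + 1)" by (simp add: field_simps)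
      finally show ?thesis .
    qed
    have f: "ln (fact (Suc N) :: real) = ln (real N + 1) + ln (fact N)"
      by (simp add: ln_mult add.commute)
    have g: "real (Suc N) * ln (real (Suc N)) - real (Suc N) =
      (real N * ln (real N) - real N) + real N * D + ln (real N + 1) - 1"
      by (simp add: D_def algebra_simps)
    have "harm (Suc N) = harm N + 1 / (real N + 1)" by (simp add: harm_Suc field_simps)
    thus ?case unfolding f g using D1 D2 step.IH by linarith
  qed
  thus "ln (fact N) \<ge> real N * ln (real N) - real N + 1"
    "ln (fact N) \<le> real N * ln (real N) - real N + harm N" by auto
qed

lemma harm_bounds:
  assumes "M \<ge> 1"
  shows "harm M \<ge> ln (real M) + euler_mascheroni"
    and "harm M \<le> ln (real M) + euler_mascheroni + 1 / real M"
proof -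
  have "(euler_mascheroni :: real) \<le> harm M - ln (of_nat M)"
  proof (rule LIMSEQ_le_const2[OF euler_mascheroni_LIMSEQ])
    show "\<exists>N. \<forall>n\<ge>N. harm n - ln (of_nat n) \<le> harm M - ln (real M)"
      using assms by (intro exI[of _ M] allI impI euler_mascheroni_sequence_decreasing) auto
  qed
  thus "harm M \<ge> ln (real M) + euler_mascheroni" by simp
  obtain n where M: "M = Suc n" using assms by (cases M) auto
  have "harm M \<le> euler_mascheroni + ln (real M + 1)"
    using euler_mascheroni_lower[of n] unfolding M by (simp add: add_ac) (smt (verit) of_nat_0_le_iff divide_nonneg_nonneg)
  also have "ln (real M + 1) \<le> ln (real M) + 1 / real M"
    using ln_diff_le_inverse[of "real M"] assms by (simp add: inverse_eq_divide)
  finally show "harm M \<le> ln (real M) + euler_mascheroni + 1 / real M" by simp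
qed

lemma euler_mascheroni_le_1: "(euler_mascheroni :: real) \<le> 1"
  using harm_bounds(1)[of 1] by (simp add: harm_def)

lemma harm_le_1_ln: assumes "M \<ge> 1" shows "harm M \<le> 1 + ln (real M)"
  using euler_mascheroni_sequence_decreasing[of 1 M] assms by (simp add: harm_def)

definition mertens :: "nat \<Rightarrow> real" where "mertens N = (\<Sum>n=1..N. \<Lambda> n / real n)"

text \<open>Mertens' first theorem. \<open>N * mertens N - ln (fact N)\<close> weights
  \<open>\<Lambda> d\<close> by the fractional part of \<open>N / d\<close>, so it lies between 0
  and \<open>psi N\<close>.\<close>

lemma mertens_bounds:
  assumes "N \<ge> 1"
  shows "mertens N \<ge> ln (real N) - 1" "mertens N \<le> ln (real N) + 4"
proof -
  have e: "real N * mertens N - ln (fact N) = (\<Sum>d=1..N. \<Lambda> d * (real N / real d - real (N div d)))"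
    unfolding ln_fact_mangoldt mertens_def by (simp add: sum_distrib_left sum_subtractf algebra_simps)
  have l: "real (N div d) \<le> real N / real d" for d by (rule of_nat_div_le_of_nat)
  have u: "real N / real d - real (N div d) \<le> 1" for d
    using floor_divide_of_nat_eq[of N d, where 'a = real] by linarith
  have "(\<Sum>d=1..N. \<Lambda> d * (real N / real d - real (N div d))) \<ge> 0"
    using l by (intro sum_nonneg mult_nonneg_nonneg) (auto simp: mangoldt_nonneg)
  with e have 1: "real N * mertens N \<ge> ln (fact N)" by simp
  have "(\<Sum>d=1..N. \<Lambda> d * (real N / real d - real (N div d))) \<le> (\<Sum>d=1..N. \<Lambda> d * 1)"
    using u by (intro sum_mono mult_left_mono) (auto simp: mangoldt_nonneg)
  also have "\<dots> \<le> 4 * real N" using psi_le[of N] by (simp add: psi_def)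
  finally have 2: "real N * mertens N \<le> ln (fact N) + 4 * real N" using e by simp
  have "real N * (ln (real N) - 1) \<le> real N * mertens N"
    using 1 ln_fact_bounds(1)[OF assms] by (simp add: algebra_simps)
  thus "mertens N \<ge> ln (real N) - 1" using assms by simp
  have "ln (fact N) \<le> real N * ln (real N)"
  proof -
    have "ln (fact N) = (\<Sum>n=1..N. ln (real n))" by (rule ln_fact_sum)
    also have "\<dots> \<le> (\<Sum>n=1..N. ln (real N))" by (intro sum_mono) auto
    finally show ?thesis by simp
  qed
  hence "real N * mertens N \<le> real N * (ln (real N) + 4)" using 2 by (simp add: algebra_simps)
  thus "mertens N \<le> ln (real N) + 4" using assms by simp
qed

section \<open>Selberg's formula\<close>

definition mu :: "nat \<Rightarrow> real" where
  "mu n = (if squarefree n then (-1) ^ card (prime_factors n) else 0)"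

lemma abs_mu_le_1: "\<bar>mu n\<bar> \<le> 1"
  by (simp add: mu_def power_abs)

text \<open>For a prime \<open>p\<close> dividing \<open>n\<close>, multiplication by
  \<open>p\<close> pairs the squarefree divisors prime to \<open>p\<close> with the remaining
  squarefree ones and flips the sign.\<close>

lemma sum_mu_divisors:
  assumes "n \<ge> 1"
  shows "(\<Sum>d | d dvd n. mu d) = (if n = 1 then 1 else 0)"
proof (cases "n = 1")
  case True
  thus ?thesis by (simp add: mu_def)
next
  case False
  then obtain p where p: "prime p" "p dvd n" using prime_factor_nat by auto
  define D where "D = {d. d dvd n \<and> squarefree d}"
  define A where "A = {d \<in> D. \<not> p dvd d}"
  define B where "B = {d \<in> D. p dvd d}"
  have fin: "finite D" using assms by (auto simp: D_def)
  have "(\<Sum>d | d dvd n. mu d) = (\<Sum>d\<in>D. (-1) ^ card (prime_factors d))"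
    unfolding D_def mu_def using assms by (intro sum.mono_neutral_cong_right) auto
  also have "D = A \<union> B" by (auto simp: A_def B_def)
  also have "(\<Sum>d\<in>A \<union> B. (-1) ^ card (prime_factors d)) =
     (\<Sum>d\<in>A. (-1) ^ card (prime_factors d)) + (\<Sum>d\<in>B. (-1::real) ^ card (prime_factors d))"
    using fin by (intro sum.union_disjoint) (auto simp: A_def B_def)
  also have "(\<Sum>d\<in>B. (-1::real) ^ card (prime_factors d)) = (\<Sum>d\<in>A. - ((-1) ^ card (prime_factors d)))"
  proof (rule sum.reindex_bij_witness[where i = "\<lambda>d. p * d" and j = "\<lambda>d. d div p"])
    fix d assume d: "d \<in> B"
    thus "p * (d div p) = d" by (auto simp: B_def)
    then obtain e where e: "d = p * e" by metis
    have sf: "squarefree (p * e)" using d e by (auto simp: B_def D_def)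
    have "\<not> p dvd e"
    proof
      assume "p dvd e"
      hence "p ^ 2 dvd p * e" by (auto simp: power2_eq_square)
      with sf have "is_unit p" by (auto simp: squarefree_def)
      thus False using p by auto
    qed
    moreover have "squarefree e" "e dvd n"
      using squarefree_multD(2)[OF sf] d e by (auto simp: B_def D_def intro: dvd_mult_right)
    ultimately show "d div p \<in> A" using e p by (auto simp: A_def D_def)
    have e0: "e \<noteq> 0" using sf by (intro notI) auto
    have "prime_factors d = insert p (prime_factors e)"
      using p e0 by (simp add: e prime_factors_product prime_prime_factors)
    moreover have "p \<notin> prime_factors e" using \<open>\<not> p dvd e\<close> by auto
    ultimately show "- ((- 1) ^ card (prime_factors (d div p))) = (- 1::real) ^ card (prime_factors d)"
      using e p by simp
  next
    fix d assume d: "d \<in> A"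
    show "p * d div p = d" using p by (auto simp: prime_gt_0_nat)
    have cop: "coprime p d" using d p by (auto simp: A_def prime_imp_coprime)
    hence "squarefree (p * d)"
      using d p by (auto simp: A_def D_def squarefree_mult_coprime squarefree_prime)
    moreover have "p * d dvd n" using d p cop by (auto simp: A_def D_def intro: divides_mult)
    ultimately show "p * d \<in> B" by (auto simp: B_def D_def)
  qed
  finally show ?thesis using False by (simp add: sum_negf)
qed

text \<open>Moebius inversion of \<open>mangoldt_sum\<close> yields \<open>\<Lambda>\<close> as the
  convolution of \<open>mu\<close> with \<open>ln\<close>; then
  \<open>ln (k div n) = ln k - ln n\<close>, and \<open>ln k\<close> is multiplied by a sum that
  vanishes unless \<open>k = 1\<close>, where \<open>ln k = 0\<close>.\<close>

lemma sum_mu_ln: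
  assumes "k \<ge> 1"
  shows "(\<Sum>n | n dvd k. mu n * ln (real n)) = - \<Lambda> k"
proof -
  let ?P = "SIGMA n:{n. n dvd k}. {e. e dvd k div n}"
  let ?Q = "SIGMA e:{e. e dvd k}. {n. n dvd k div e}"
  have k: "k \<noteq> 0" using assms by simp
  have fd: "finite {d. d dvd k div n}" if "n dvd k" for n
    using that k by (intro finite_divisors_nat) (auto elim!: dvdE)
  have ln: "ln (real (k div n)) = ln (real k) - ln (real n)" if "n dvd k" for n
    using that k by (auto elim!: dvdE simp: ln_mult)
  have "(\<Sum>n | n dvd k. mu n * ln (real (k div n))) = (\<Sum>n | n dvd k. \<Sum>e | e dvd k div n. mu n * \<Lambda> e)"
  proof (rule sum.cong[OF refl])
    fix n assume n: "n \<in> {n. n dvd k}"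
    hence "k div n \<noteq> 0" using k by (auto elim!: dvdE)
    from mangoldt_sum[OF this, where 'a = real]
    show "mu n * ln (real (k div n)) = (\<Sum>e | e dvd k div n. mu n * \<Lambda> e)"
      by (simp flip: sum_distrib_left)
  qed
  also have "\<dots> = (\<Sum>(n,e)\<in>?P. mu n * \<Lambda> e)"
    using k fd by (intro sum.Sigma) auto
  also have "\<dots> = (\<Sum>(e,n)\<in>?Q. mu n * \<Lambda> e)"
    by (rule sum.reindex_bij_witness[where i = "\<lambda>(a,b). (b,a)" and j = "\<lambda>(a,b). (b,a)"])
       (use k in \<open>auto elim!: dvdE simp: mult_ac\<close>)
  also have "\<dots> = (\<Sum>e | e dvd k. \<Sum>n | n dvd k div e. mu n * \<Lambda> e)"
    using k fd by (intro sum.Sigma[symmetric]) auto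
  also have "\<dots> = (\<Sum>e | e dvd k. if e = k then \<Lambda> e else 0)"
  proof (rule sum.cong[OF refl])
    fix e assume e: "e \<in> {e. e dvd k}"
    hence "k div e \<ge> 1" using k by (auto elim!: dvdE simp: Suc_le_eq)
    moreover have "k div e = 1 \<longleftrightarrow> e = k" using e k by (auto elim!: dvdE)
    ultimately show "(\<Sum>n | n dvd k div e. mu n * \<Lambda> e) = (if e = k then \<Lambda> e else 0)"
      using sum_mu_divisors[of "k div e"] by (simp flip: sum_distrib_right)
  qed
  also have "\<dots> = \<Lambda> k" using k by (simp add: sum.delta)
  finally have "(\<Sum>n | n dvd k. mu n * ln (real (k div n))) = \<Lambda> k" .
  also have "(\<Sum>n | n dvd k. mu n * ln (real (k div n))) =
      (\<Sum>n | n dvd k. mu n * ln (real k) - mu n * ln (real n))"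
    by (intro sum.cong) (auto simp: ln right_diff_distrib)
  also have "\<dots> = (\<Sum>n | n dvd k. mu n) * ln (real k) - (\<Sum>n | n dvd k. mu n * ln (real n))"
    by (simp add: sum_subtractf sum_distrib_right)
  also have "(\<Sum>n | n dvd k. mu n) * ln (real k) = 0"
    using sum_mu_divisors[OF assms] by auto
  finally show ?thesis by simp
qed

text \<open>Moebius inversion with the extra weight \<open>ln (N / n)\<close>: the coefficient of
  \<open>G k\<close> is \<open>ln N\<close> times the divisor sum of \<open>mu\<close>, minus the
  divisor sum of \<open>mu n * ln n\<close>. Thus \<open>\<Lambda>\<close> enters without any
  information on the size of sums of \<open>mu\<close>.\<close>

lemma tatuzawa_iseki:
  fixes G :: "nat \<Rightarrow> real"
  assumes "N \<ge> 1"
  shows "(\<Sum>n=1..N. mu n * ln (real N / real n) * (\<Sum>m=1..N div n. G (n * m))) =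
         G 1 * ln (real N) + (\<Sum>k=1..N. \<Lambda> k * G k)"
proof -
  have "(\<Sum>n=1..N. mu n * ln (real N / real n) * (\<Sum>m=1..N div n. G (n * m))) =
        (\<Sum>n=1..N. \<Sum>m=1..N div n. mu n * ln (real N / real n) * G (n * m))"
    by (simp add: sum_distrib_left)
  also have "\<dots> = (\<Sum>k=1..N. \<Sum>n | n dvd k. mu n * ln (real N / real n) * G (n * (k div n)))"
    by (rule sum_divisors_swap[symmetric])
  also have "\<dots> = (\<Sum>k=1..N. (if k = 1 then G 1 * ln (real N) else 0) + \<Lambda> k * G k)"
  proof (rule sum.cong[OF refl])
    fix k assume k: "k \<in> {1..N}"
    have "(\<Sum>n | n dvd k. mu n * ln (real N / real n) * G (n * (k div n))) =
          (\<Sum>n | n dvd k. mu n * ln (real N) * G k - mu n * ln (real n) * G k)"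
    proof (rule sum.cong[OF refl])
      fix n assume n: "n \<in> {n. n dvd k}"
      hence "n > 0" using k by (auto intro: Nat.gr0I)
      thus "mu n * ln (real N / real n) * G (n * (k div n)) =
              mu n * ln (real N) * G k - mu n * ln (real n) * G k"
        using n assms by (simp add: ln_div algebra_simps)
    qed
    also have "\<dots> = (\<Sum>n | n dvd k. mu n) * ln (real N) * G k - (\<Sum>n | n dvd k. mu n * ln (real n)) * G k"
      by (simp add: sum_subtractf sum_distrib_right)
    also have "\<dots> = (if k = 1 then G 1 * ln (real N) else 0) + \<Lambda> k * G k"
      using k by (subst sum_mu_divisors, simp, subst sum_mu_ln) auto
    finally show "(\<Sum>n | n dvd k. mu n * ln (real N / real n) * G (n * (k div n))) =
      (if k = 1 then G 1 * ln (real N) else 0) + \<Lambda> k * G k" .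
  qed
  also have "\<dots> = G 1 * ln (real N) + (\<Sum>k=1..N. \<Lambda> k * G k)"
    using assms by (simp add: sum.distrib sum.delta)
  finally show ?thesis .
qed

lemma sum_inverse_sqrt: "(\<Sum>n=1..N. 1 / sqrt (real n)) \<le> 2 * sqrt (real N)"
proof (induction N)
  case (Suc N)
  have "1 / sqrt (real (Suc N)) \<le> 2 * (sqrt (real (Suc N)) - sqrt (real N))"
  proof -
    have "(sqrt (real (Suc N)) - sqrt (real N)) * (sqrt (real (Suc N)) + sqrt (real N)) = 1"
      by (simp add: algebra_simps)
    moreover have "sqrt (real N) \<le> sqrt (real (Suc N))" by simp
    hence "(sqrt (real (Suc N)) - sqrt (real N)) * (sqrt (real (Suc N)) + sqrt (real N)) \<le>
       (sqrt (real (Suc N)) - sqrt (real N)) * (2 * sqrt (real (Suc N)))"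
      by (intro mult_left_mono) auto
    ultimately show ?thesis by (simp add: field_simps del: real_sqrt_le_iff)
  qed
  thus ?case using Suc.IH by simp
qed auto

text \<open>Any power of \<open>u\<close> below the first would serve: for \<open>u = N / n\<close>
  its sum over \<open>n\<close> stays linear in \<open>N\<close>. With
  \<open>v = sqrt (sqrt u)\<close> each logarithmic factor is at most \<open>4 * v\<close>.\<close>

lemma ln_mult_one_plus_ln_le:
  assumes "u \<ge> (1::real)"
  shows "ln u * (1 + ln u) \<le> 16 * sqrt u"
proof -
  define v where "v = sqrt (sqrt u)"
  have v: "v \<ge> 1" using assms by (simp add: v_def)
  have u: "sqrt u = v ^ 2" "u = (v ^ 2) ^ 2" using assms by (simp_all add: v_def)
  have "ln u = 4 * ln v" unfolding u(2) using v by (simp add: ln_realpow)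
  moreover have "ln v \<le> v - 1" using v by (intro ln_le_minus_one) auto
  ultimately have 1: "ln u \<le> 4 * v" "1 + ln u \<le> 4 * v" using v by linarith+
  have "ln u * (1 + ln u) \<le> (4 * v) * (4 * v)"
    using 1 assms v by (intro mult_mono) auto
  thus ?thesis unfolding u(1) by (simp add: power2_eq_square)
qed

text \<open>Selberg's symmetry formula. Applying the inversion above to \<open>psi\<close> minus its
  expected value, whose sums over multiples are only logarithmic, leaves an error of
  \<open>32 * N\<close>; Mertens' theorem evaluates the remaining sums.\<close>

lemma psi_selberg:
  assumes "N \<ge> 1"
  shows "\<bar>psi N * ln (real N) + (\<Sum>k=1..N. \<Lambda> k * psi (N div k)) - 2 * real N * ln (real N)\<bar> \<le> 50 * real N"
proof -
  define g where "g = (euler_mascheroni :: real)"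
  have g: "0 \<le> g" "g \<le> 1"
    using euler_mascheroni_le_1 euler_mascheroni_pos by (auto simp: g_def)
  \<comment> \<open>The constants are chosen for cancellation in \<open>H\<close>: summed over
    \<open>m\<close>, \<open>psi\<close> gives about \<open>M * ln M - M\<close>,
    \<open>N / k\<close> gives about \<open>M * ln M\<close> plus Euler's constant times
    \<open>M\<close>, and \<open>1 + g\<close> removes what is left.\<close>
  define G where "G k = psi (N div k) - real N / real k + 1 + g" for k
  define H where "H n = (\<Sum>m=1..N div n. G (n * m))" for n
  have H: "\<bar>H n\<bar> \<le> 1 + ln (real N / real n)" if n: "n \<in> {1..N}" for n
  proof -
    define M where "M = N div n"
    have M: "M \<ge> 1" using n unfolding M_def by (simp add: Suc_le_eq div_greater_zero_iff)
    define z where "z = real N / real n"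
    have z1: "real M \<le> z" unfolding M_def z_def by (rule of_nat_div_le_of_nat)
    have z2: "z \<le> real M + 1"
      unfolding M_def z_def using floor_divide_of_nat_eq[of N n, where 'a = real] by linarith
    have "H n = (\<Sum>m=1..M. psi (M div m) - z * (1 / real m) + (1 + g))"
      unfolding H_def M_def G_def z_def by (intro sum.cong) (auto simp: div_mult2_eq)
    also have "\<dots> = ln (fact M) - z * harm M + (1 + g) * real M"
      by (simp add: sum.distrib sum_subtractf ln_fact_psi harm_def inverse_eq_divide sum_distrib_left)
    finally have Hn: "H n = ln (fact M) - z * harm M + (1 + g) * real M" .
    define f where "f = z - real M"
    have f: "0 \<le> f" "f \<le> 1" using z1 z2 by (auto simp: f_def)
    define e where "e = harm M - (ln (real M) + g)"
    have e: "0 \<le> e" "real M * e \<le> 1"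
      using harm_bounds[OF M] M by (auto simp: e_def g_def field_simps)
    have zh: "z * harm M = real M * ln (real M) + real M * g + real M * e + f * harm M"
      by (simp add: f_def e_def algebra_simps)
    have fh: "0 \<le> f * harm M" "f * harm M \<le> harm M"
      using f by (auto simp: harm_nonneg mult_left_le_one_le)
    have "0 \<le> real M * e" using e by simp
    moreover have "(1 + g) * real M = real M + real M * g" by (simp add: algebra_simps)
    ultimately have "\<bar>H n\<bar> \<le> harm M"
      using ln_fact_bounds[OF M] e fh zh unfolding Hn abs_le_iff by linarith
    also have "harm M \<le> 1 + ln (real M)" using harm_le_1_ln[OF M] .
    also have "ln (real M) \<le> ln z" using z1 M by (subst ln_le_cancel_iff) auto
    finally show ?thesis unfolding z_def by simp
  qed
  have "\<bar>\<Sum>n=1..N. mu n * ln (real N / real n) * H n\<bar> \<le> (\<Sum>n=1..N. 16 * sqrt (real N) * (1 / sqrt (real n)))"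
  proof (intro order.trans[OF sum_abs] sum_mono)
    fix n assume n: "n \<in> {1..N}"
    have u: "real N / real n \<ge> 1" using n by auto
    have "\<bar>mu n * ln (real N / real n) * H n\<bar> = \<bar>mu n\<bar> * (ln (real N / real n) * \<bar>H n\<bar>)"
      using u by (simp add: abs_mult)
    also have "\<dots> \<le> 1 * (ln (real N / real n) * (1 + ln (real N / real n)))"
      using u H[OF n] by (intro mult_mono abs_mu_le_1) auto
    also have "\<dots> \<le> 16 * sqrt (real N / real n)"
      using ln_mult_one_plus_ln_le[OF u] by simp
    finally show "\<bar>mu n * ln (real N / real n) * H n\<bar> \<le> 16 * sqrt (real N) * (1 / sqrt (real n))"
      by (simp add: real_sqrt_divide)
  qed
  also have "\<dots> = 16 * sqrt (real N) * (\<Sum>n=1..N. 1 / sqrt (real n))"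
    by (simp add: sum_distrib_left)
  also have "\<dots> \<le> 16 * sqrt (real N) * (2 * sqrt (real N))"
    by (intro mult_left_mono sum_inverse_sqrt) auto
  also have "\<dots> = 32 * real N" by simp
  finally have 1: "\<bar>G 1 * ln (real N) + (\<Sum>k=1..N. \<Lambda> k * G k)\<bar> \<le> 32 * real N"
    unfolding H_def tatuzawa_iseki[OF assms] .
  have 2: "(\<Sum>k=1..N. \<Lambda> k * G k) =
      (\<Sum>k=1..N. \<Lambda> k * psi (N div k)) - real N * mertens N + (1 + g) * psi N"
    unfolding G_def mertens_def psi_def
    by (simp add: sum.distrib sum_subtractf algebra_simps sum_distrib_left)
  have 3: "G 1 * ln (real N) = psi N * ln (real N) - real N * ln (real N) + (1 + g) * ln (real N)"
    by (simp add: G_def algebra_simps)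
  have 4: "0 \<le> (1 + g) * psi N" "(1 + g) * psi N \<le> 8 * real N"
    using mult_mono[of "1 + g" 2 "psi N" "4 * real N"] g psi_nonneg[of N] psi_le[of N] by auto
  have 5: "0 \<le> (1 + g) * ln (real N)" "(1 + g) * ln (real N) \<le> 2 * real N"
    using mult_mono[of "1 + g" 2 "ln (real N)" "real N"] g assms ln_le_minus_one[of "real N"] by auto
  have "real N * mertens N \<ge> real N * (ln (real N) - 1)" "real N * mertens N \<le> real N * (ln (real N) + 4)"
    using mertens_bounds[OF assms] by (auto intro!: mult_left_mono)
  hence 6: "real N * mertens N \<ge> real N * ln (real N) - real N" "real N * mertens N \<le> real N * ln (real N) + 4 * real N"
    by (auto simp: algebra_simps)
  show ?thesis using 1 4 5 6 unfolding 2 3 by (simp add: abs_le_iff)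
qed

text \<open>Selberg's function, the convolution of the Moebius function with the squared logarithm.
  Its average order is \<open>2 * ln n\<close>.\<close>

definition mangoldt2 :: "nat \<Rightarrow> real" where
  "mangoldt2 n = \<Lambda> n * ln (real n) + (\<Sum>d | d dvd n. \<Lambda> d * \<Lambda> (n div d))"

lemma sum_mangoldt_ln:
  assumes "N \<ge> 1"
  shows "(\<Sum>n=1..N. \<Lambda> n * ln (real n)) \<ge> psi N * ln (real N) - 4 * real N"
    and "(\<Sum>n=1..N. \<Lambda> n * ln (real n)) \<le> psi N * ln (real N)"
proof -
  show "(\<Sum>n=1..N. \<Lambda> n * ln (real n)) \<le> psi N * ln (real N)"
    unfolding psi_def sum_distrib_right
    by (intro sum_mono mult_left_mono) (auto simp: mangoldt_nonneg)
  show "(\<Sum>n=1..N. \<Lambda> n * ln (real n)) \<ge> psi N * ln (real N) - 4 * real N"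
    using assms
  proof (induction N rule: dec_induct)
    case base thus ?case by simp
  next
    case (step N)
    have "psi N * (ln (real (Suc N)) - ln (real N)) \<le> (4 * real N) * (1 / real N)"
      using psi_le[of N] psi_nonneg[of N] ln_diff_le_inverse[of "real N"] step.hyps
      by (intro mult_mono) (auto simp: inverse_eq_divide add.commute)
    also have "\<dots> = 4" using step.hyps by simp
    finally show ?case using step.IH by (simp add: psi_Suc algebra_simps)
  qed
qed

text \<open>Comparing with \<open>2 * ln (fact N)\<close>, itself the sum of
  \<open>2 * ln n\<close>, turns the error into a partial sum, ready for Abel summation.\<close>

lemma sum_mangoldt2:
  assumes "N \<ge> 1"
  shows "\<bar>(\<Sum>n=1..N. mangoldt2 n) - 2 * ln (fact N)\<bar> \<le> 56 * real N"
proof -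
  have "(\<Sum>n=1..N. mangoldt2 n) = (\<Sum>n=1..N. \<Lambda> n * ln (real n)) + (\<Sum>k=1..N. \<Lambda> k * psi (N div k))"
    using sum_divisors_swap[of "\<lambda>d m. \<Lambda> d * \<Lambda> m" N]
    unfolding mangoldt2_def psi_def by (simp add: sum.distrib sum_distrib_left)
  moreover have "harm N \<le> real N"
    using harm_le_1_ln[OF assms] ln_le_minus_one[of "real N"] assms by simp
  ultimately show ?thesis
    using sum_mangoldt_ln[OF assms] psi_selberg[OF assms] ln_fact_bounds[OF assms] assms
    by (simp add: abs_le_iff)
qed

text \<open>Abel summation: partial sums of size \<open>56 * N\<close> cost 56 at each end and at
  most \<open>56 * 3\<close> in between, because the range has ratio at most 4.\<close>

lemma mangoldt2_partial_summation:
  assumes "X \<ge> 1" "X \<le> Y" "Y \<le> 4 * X"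
  shows "\<bar>(\<Sum>n=X+1..Y. mangoldt2 n / real n) - 2 * (\<Sum>n=X+1..Y. ln (real n) / real n)\<bar> \<le> 280"
proof -
  define a where "a n = mangoldt2 n - 2 * ln (real n)" for n
  define E where "E N = (\<Sum>n=1..N. a n)" for N
  have E: "\<bar>E N\<bar> \<le> 56 * real N" if "N \<ge> 1" for N
    using sum_mangoldt2[OF that] by (simp add: E_def a_def sum_subtractf ln_fact_sum sum_distrib_left)
  have "(\<Sum>n=X+1..Y. a n / real n) =
          E Y / real (Y + 1) - E X / real (X + 1) + (\<Sum>n=X+1..Y. E n / (real n * real (n + 1)))"
    using assms(2)
  proof (induction Y rule: dec_induct)
    case (step Y)
    define u where "u = real Y + 1"
    have u: "u > 0" by (simp add: u_def)
    have "a (Suc Y) / u = E (Suc Y) / (u + 1) + E (Suc Y) / (u * (u + 1)) - E Y / u"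
    proof -
      have "w / (u + 1) + w / (u * (u + 1)) = w / u" for w using u by (simp add: divide_simps) (simp add: algebra_simps)
      from this[of "E (Suc Y)"] show ?thesis by (simp add: E_def add_divide_distrib)
    qed
    thus ?case using step.IH step.hyps by (simp add: u_def add_ac)
  qed auto
  also have "\<bar>\<dots>\<bar> \<le> 56 + 56 + 56 * 3"
  proof -
    have q: "\<bar>E N / real (N + 1)\<bar> \<le> 56" if "N \<ge> 1" for N
      using E[OF that] by (simp add: field_simps abs_le_iff)
    have "\<bar>\<Sum>n=X+1..Y. E n / (real n * real (n + 1))\<bar> \<le> (\<Sum>n=X+1..Y. 56 / real X)"
    proof (intro order.trans[OF sum_abs] sum_mono)
      fix n assume n: "n \<in> {X+1..Y}"
      have "\<bar>E n / (real n * real (n + 1))\<bar> \<le> 56 * real n / (real n * real (n + 1))"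
        unfolding abs_divide using E[of n] n by (intro frac_le) auto
      also have "\<dots> = 56 / real (n + 1)" using n by simp
      also have "\<dots> \<le> 56 / real X" using n assms by (intro frac_le) auto
      finally show "\<bar>E n / (real n * real (n + 1))\<bar> \<le> 56 / real X" .
    qed
    also have "\<dots> = 56 * (real (Y - X) / real X)" by simp
    also have "\<dots> \<le> 56 * 3" using assms by (intro mult_left_mono) (auto simp: field_simps)
    finally show ?thesis using q[of X] q[of Y] assms by linarith
  qed
  also have "(\<Sum>n=X+1..Y. a n / real n) = (\<Sum>n=X+1..Y. mangoldt2 n / real n) - 2 * (\<Sum>n=X+1..Y. ln (real n) / real n)"
    by (simp add: a_def diff_divide_distrib sum_subtractf sum_distrib_left)
  finally show ?thesis by simp
qed

section \<open>Mass of the prime powers in short intervals\<close>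

definition mert :: "real \<Rightarrow> real" where "mert x = mertens (nat \<lfloor>x\<rfloor>)"

lemma mertens_mono: "M \<le> N \<Longrightarrow> mertens M \<le> mertens N"
  unfolding mertens_def by (intro sum_mono2) (auto simp: mangoldt_nonneg)

lemma mert_mono: "x \<le> y \<Longrightarrow> mert x \<le> mert y"
  unfolding mert_def by (intro mertens_mono nat_mono floor_mono)

lemma mertens_diff: "M \<le> N \<Longrightarrow> mertens N - mertens M = (\<Sum>n=M+1..N. \<Lambda> n / real n)"
  unfolding mertens_def using sum.ub_add_nat[of 1 M "\<lambda>n. \<Lambda> n / real n" "N - M"] by simp

lemma mert_0: "x < 1 \<Longrightarrow> mert x = 0"
  by (simp add: mert_def mertens_def)

lemma floor_props:
  assumes "x \<ge> 1"
  defines "X \<equiv> nat \<lfloor>x\<rfloor>"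
  shows "X \<ge> 1" "real X \<le> x" "x < real X + 1" "ln (real X) \<le> ln x" "ln x \<le> ln (real X) + 1 / real X"
proof -
  show 1: "X \<ge> 1" using assms by (simp add: X_def le_nat_iff)
  show 2: "real X \<le> x" "x < real X + 1" using assms unfolding X_def by linarith+
  show "ln (real X) \<le> ln x" using 1 2 by simp
  have "ln x \<le> ln (real X + 1)" using 1 2 by simp
  also have "\<dots> \<le> ln (real X) + 1 / real X"
    using ln_diff_le_inverse[of "real X"] 1 by (simp add: inverse_eq_divide)
  finally show "ln x \<le> ln (real X) + 1 / real X" .
qed

lemma mert_bounds:
  assumes "x \<ge> 1"
  shows "\<bar>mert x - ln x\<bar> \<le> 4"
proof -
  define X where "X = nat \<lfloor>x\<rfloor>"
  note F = floor_props[OF assms, folded X_def]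
  have "1 / real X \<le> 1" using F(1) by simp
  thus ?thesis using F(4,5) mertens_bounds[OF F(1)]
    unfolding mert_def X_def[symmetric] abs_le_iff by linarith
qed

text \<open>Selberg's formula with weights \<open>1 / n\<close>, localised to the interval from
  \<open>x\<close> to \<open>y\<close>: the error stays bounded while the main term grows with
  \<open>ln x\<close>. Writing \<open>ln x\<close> for \<open>ln n\<close> costs at most
  \<open>D \<le> 9\<close> and \<open>2 * R \<le> 6\<close>, writing \<open>ln (y / x)\<close> for
  \<open>R\<close> costs 4; with the 280 from partial summation this stays below 300.\<close>

lemma mert_selberg:
  assumes "x \<ge> 1" "x \<le> y" "y \<le> 2 * x"
  shows "\<bar>(mert y - mert x) * ln x + (\<Sum>k=1..nat \<lfloor>y\<rfloor>. \<Lambda> k / real k * (mert (y / real k) - mert (x / real k)))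
          - 2 * ln (y / x) * ln x\<bar> \<le> 300"
proof -
  define X Y where "X = nat \<lfloor>x\<rfloor>" and "Y = nat \<lfloor>y\<rfloor>"
  note F = floor_props[OF assms(1), folded X_def]
  have y: "y \<ge> 1" using assms by simp
  note F' = floor_props[OF y, folded Y_def]
  have XY: "X \<le> Y" unfolding X_def Y_def using assms by (intro nat_mono floor_mono)
  have "real X \<ge> 1" using F(1) by simp
  hence "real Y < 4 * real X + 1" using F(2,3) F'(2) assms by linarith
  hence Y4: "Y \<le> 4 * X" by linarith
  define A2 where "A2 = (\<Sum>k=1..Y. \<Lambda> k / real k * (mert (y / real k) - mert (x / real k)))"
  have div: "mert (z / real k) = mertens (nat \<lfloor>z\<rfloor> div k)" if "z \<ge> 1" for z k
    using floor_divide_real_eq_div[of "int k" z] that by (simp add: mert_def nat_div_distrib)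
  have swap: "(\<Sum>n=1..N. (\<Sum>d | d dvd n. \<Lambda> d * \<Lambda> (n div d)) / real n) =
      (\<Sum>k=1..N. \<Lambda> k / real k * mertens (N div k))" for N
  proof -
    have "(\<Sum>n=1..N. (\<Sum>d | d dvd n. \<Lambda> d * \<Lambda> (n div d)) / real n) =
       (\<Sum>n=1..N. \<Sum>d | d dvd n. (\<Lambda> d / real d) * (\<Lambda> (n div d) / real (n div d)))"
      unfolding sum_divide_distrib
      by (intro sum.cong refl) (auto elim!: dvdE)
    also have "\<dots> = (\<Sum>k=1..N. \<Lambda> k / real k * mertens (N div k))"
      by (subst sum_divisors_swap[of "\<lambda>d m. (\<Lambda> d / real d) * (\<Lambda> m / real m)"])
         (simp add: mertens_def sum_distrib_left)
    finally show ?thesis .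
  qed
  have "(\<Sum>n=X+1..Y. (\<Sum>d | d dvd n. \<Lambda> d * \<Lambda> (n div d)) / real n) =
        (\<Sum>k=1..Y. \<Lambda> k / real k * mertens (Y div k)) - (\<Sum>k=1..X. \<Lambda> k / real k * mertens (X div k))"
    unfolding swap[symmetric] using sum.ub_add_nat[of 1 X "\<lambda>n. (\<Sum>d | d dvd n. \<Lambda> d * \<Lambda> (n div d)) / real n" "Y - X"] XY by simp
  also have "(\<Sum>k=1..X. \<Lambda> k / real k * mertens (X div k)) = (\<Sum>k=1..Y. \<Lambda> k / real k * mertens (X div k))"
    using XY by (intro sum.mono_neutral_left) (auto simp: mertens_def)
  finally have A2: "(\<Sum>n=X+1..Y. (\<Sum>d | d dvd n. \<Lambda> d * \<Lambda> (n div d)) / real n) = A2"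
    using assms y by (simp add: A2_def div X_def Y_def right_diff_distrib sum_subtractf)
  define A1 where "A1 = (\<Sum>n=X+1..Y. \<Lambda> n / real n * ln (real n))"
  have S: "(\<Sum>n=X+1..Y. mangoldt2 n / real n) = A1 + A2"
    unfolding A2[symmetric] A1_def mangoldt2_def by (simp add: add_divide_distrib sum.distrib)
  have lx: "ln x \<ge> 0" using assms by simp
  have ln: "ln x \<le> ln (real n)" "ln (real n) \<le> ln x + 1" if n: "n \<in> {X+1..Y}" for n
  proof -
    have "x \<le> real n" using n F(3) by simp
    thus "ln x \<le> ln (real n)" using assms by simp
    have "ln (real n) \<le> ln (2 * x)" using n F'(2) assms by (subst ln_le_cancel_iff) auto
    also have "\<dots> \<le> ln x + 1" using assms ln2_le_25_over_36 by (simp add: ln_mult)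
    finally show "ln (real n) \<le> ln x + 1" .
  qed
  define D where "D = mert y - mert x"
  have D: "D = (\<Sum>n=X+1..Y. \<Lambda> n / real n)"
    using mertens_diff[OF XY] by (simp add: D_def mert_def X_def Y_def)
  have D7: "D \<le> 9"
  proof -
    have "ln y \<le> ln (2 * x)" using assms by simp
    also have "\<dots> \<le> ln x + 1" using assms ln2_le_25_over_36 by (simp add: ln_mult)
    finally show ?thesis using mert_bounds[OF assms(1)] mert_bounds[OF y] by (simp add: D_def abs_le_iff)
  qed
  have A1: "A1 \<ge> D * ln x" "A1 \<le> D * (ln x + 1)"
    unfolding A1_def D sum_distrib_right
    by (intro sum_mono mult_left_mono ln divide_nonneg_nonneg mangoldt_nonneg; simp)+
  define R where "R = (\<Sum>n=X+1..Y. 1 / real n)"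
  define T where "T = (\<Sum>n=X+1..Y. ln (real n) / real n)"
  have T: "T \<ge> R * ln x" "T \<le> R * (ln x + 1)"
    unfolding T_def R_def sum_distrib_right
    using ln by (auto intro!: sum_mono divide_right_mono simp del: atLeastAtMost_iff)
  have R3: "R \<le> 3"
  proof -
    have "R \<le> (\<Sum>n=X+1..Y. 1 / real X)" unfolding R_def using F by (intro sum_mono frac_le) auto
    also have "\<dots> = real (Y - X) / real X" by simp
    also have "\<dots> \<le> 3" using Y4 XY F by (auto simp: field_simps)
    finally show ?thesis .
  qed
  have "harm Y - harm X = R"
    unfolding R_def harm_def inverse_eq_divide
    using sum.ub_add_nat[of 1 X "\<lambda>n. 1 / real n" "Y - X"] XY by simp
  moreover have "1 / real Y \<le> 1 / real X" using XY F by (intro frac_le) auto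
  moreover have lyx: "ln (y / x) = ln y - ln x" using assms by (simp add: ln_div)
  ultimately have "\<bar>R - ln (y / x)\<bar> \<le> 2 * (1 / real X)"
    using F(4,5) F'(4,5) harm_bounds[OF F(1)] harm_bounds[OF F'(1)] lyx
    unfolding abs_le_iff by linarith
  hence "\<bar>R - ln (y / x)\<bar> * ln x \<le> (2 * (1 / real X)) * real X"
    using lx F ln_le_minus_one[of x] assms by (intro mult_mono) auto
  hence "\<bar>(R - ln (y / x)) * ln x\<bar> \<le> 2" using F lx by (simp add: abs_mult)
  hence R: "\<bar>R * ln x - ln (y / x) * ln x\<bar> \<le> 2" by (simp add: left_diff_distrib)
  show ?thesis
    using mangoldt2_partial_summation[OF F(1) XY Y4] S A1 T R3 R D7
    unfolding T_def[symmetric] D_def[symmetric] A2_def[symmetric] Y_def[symmetric]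
    by (simp add: abs_le_iff algebra_simps)
qed

text \<open>The second sum in Selberg's formula is nonnegative, so an interval carries at most twice
  its average mass, up to a vanishing error.\<close>

lemma mert_diff_le:
  assumes "x > 1" "x \<le> y" "y \<le> 2 * x"
  shows "mert y - mert x \<le> 2 * ln (y / x) + 300 / ln x"
proof -
  have "(\<Sum>k=1..nat \<lfloor>y\<rfloor>. \<Lambda> k / real k * (mert (y / real k) - mert (x / real k))) \<ge> 0"
    using assms by (intro sum_nonneg mult_nonneg_nonneg)
      (auto simp: mangoldt_nonneg intro!: mert_mono divide_right_mono)
  hence "(mert y - mert x) * ln x \<le> 2 * ln (y / x) * ln x + 300"
    using mert_selberg[of x y] assms by (simp add: abs_le_iff)
  thus ?thesis using assms by (simp add: field_simps)
qed

text \<open>Only proper prime powers are left: bases up to \<open>sqrt (2 * x)\<close>, exponents up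
  to \<open>log 2 (2 * x)\<close>, each of weight at most \<open>ln (2 * x) / x\<close>.\<close>

lemma mert_diff_no_primes:
  assumes "x \<ge> 1" "x \<le> y" "y \<le> 2 * x" and np: "\<And>p. prime p \<Longrightarrow> \<not> (x < real p \<and> real p \<le> y)"
  shows "mert y - mert x \<le> (sqrt (2 * x) + 1) * (log 2 (2 * x) + 1) * ln (2 * x) / x"
proof -
  define X Y where "X = nat \<lfloor>x\<rfloor>" and "Y = nat \<lfloor>y\<rfloor>"
  note F = floor_props[OF assms(1), folded X_def]
  have y: "y \<ge> 1" using assms by simp
  note F' = floor_props[OF y, folded Y_def]
  have XY: "X \<le> Y" unfolding X_def Y_def using assms by (intro nat_mono floor_mono)
  define P where "P = {n \<in> {X+1..Y}. primepow n}"
  define a b where "a = nat \<lfloor>sqrt (2 * x)\<rfloor>" and "b = nat \<lfloor>log 2 (2 * x)\<rfloor>"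
  have "P \<subseteq> (\<lambda>(p,k). p ^ k) ` ({..a} \<times> {..b})"
  proof
    fix n assume n: "n \<in> P"
    then obtain p k where pk: "prime p" "k > 0" "n = p ^ k" by (auto simp: P_def primepow_def)
    have nn: "x < real n" "real n \<le> y" using n F F' by (auto simp: P_def)
    have "k \<noteq> 1" using np[OF pk(1)] nn pk(3) by auto
    hence k: "k \<ge> 2" using pk by simp
    have "real p ^ 2 \<le> real p ^ k" using pk k prime_ge_1_nat[of p] by (intro power_increasing) auto
    also have "\<dots> = real n" using pk by simp
    also have "\<dots> \<le> 2 * x" using nn assms by simp
    finally have "real p \<le> sqrt (2 * x)" by (intro real_le_rsqrt)
    hence 1: "p \<le> a" unfolding a_def by (simp add: le_nat_floor)
    have "2 powr real k = 2 ^ k" by (simp add: powr_realpow)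
    also have "\<dots> \<le> real p ^ k" using prime_ge_2_nat[OF pk(1)] by (intro power_mono) auto
    also have "\<dots> = real n" using pk by simp
    also have "\<dots> \<le> 2 * x" using nn assms by simp
    finally have "real k \<le> log 2 (2 * x)" using assms by (subst le_log_iff) auto
    hence 2: "k \<le> b" unfolding b_def by (simp add: le_nat_floor)
    show "n \<in> (\<lambda>(p,k). p ^ k) ` ({..a} \<times> {..b})" using 1 2 pk by auto
  qed
  hence "card P \<le> card ((\<lambda>(p,k). p ^ k :: nat) ` ({..a} \<times> {..b}))" by (intro card_mono) auto
  also have "\<dots> \<le> card ({..a} \<times> {..b})" by (intro card_image_le) auto
  also have "\<dots> = (a + 1) * (b + 1)" by simp
  finally have "real (card P) \<le> real ((a + 1) * (b + 1))" by (simp only: of_nat_le_iff)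
  also have "\<dots> = (real a + 1) * (real b + 1)" by (simp add: algebra_simps)
  also have "\<dots> \<le> (sqrt (2 * x) + 1) * (log 2 (2 * x) + 1)"
    using assms by (intro mult_mono add_mono) (auto simp: a_def b_def intro!: of_nat_floor)
  finally have card: "real (card P) \<le> (sqrt (2 * x) + 1) * (log 2 (2 * x) + 1)" .
  have "mert y - mert x = (\<Sum>n=X+1..Y. \<Lambda> n / real n)"
    using mertens_diff[OF XY] by (simp add: mert_def X_def Y_def)
  also have "\<dots> = (\<Sum>n\<in>P. \<Lambda> n / real n)"
    unfolding P_def by (intro sum.mono_neutral_right) (auto simp: mangoldt_def)
  also have "\<dots> \<le> (\<Sum>n\<in>P. ln (2 * x) / x)"
  proof (intro sum_mono frac_le)
    fix n assume "n \<in> P"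
    hence n: "x < real n" "real n \<le> y" using F F' by (auto simp: P_def)
    hence "\<Lambda> n \<le> ln (real n)" using assms by (intro mangoldt_le_ln) auto
    also have "\<dots> \<le> ln (2 * x)" using n assms by simp
    finally show "\<Lambda> n \<le> ln (2 * x)" .
    show "x \<le> real n" using n by simp
  qed (use assms in auto)
  also have "\<dots> = real (card P) * (ln (2 * x) / x)" by simp
  also have "\<dots> \<le> (sqrt (2 * x) + 1) * (log 2 (2 * x) + 1) * (ln (2 * x) / x)"
    using assms by (intro mult_right_mono card) auto
  finally show ?thesis by simp
qed

section \<open>Primes in short intervals\<close>

definition cell :: "real \<Rightarrow> real \<Rightarrow> nat set" where
  "cell a b = {k. a < real k \<and> real k \<le> b}"

lemma finite_cell [simp]: "finite (cell a b)"
  by (rule finite_subset[of _ "{..nat \<lceil>b\<rceil>}"]) (auto simp: cell_def le_nat_iff, linarith)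

lemma sum_cell_add:
  fixes f :: "nat \<Rightarrow> real"
  assumes "a \<le> b" "b \<le> c"
  shows "sum f (cell a c) = sum f (cell a b) + sum f (cell b c)"
proof -
  have "cell a c = cell a b \<union> cell b c" "cell a b \<inter> cell b c = {}"
    using assms by (auto simp: cell_def)
  thus ?thesis by (simp add: sum.union_disjoint)
qed

lemma mert_diff_cell:
  assumes "0 \<le> a" "a \<le> b"
  shows "mert b - mert a = (\<Sum>k\<in>cell a b. \<Lambda> k / real k)"
proof -
  have "cell a b = {nat \<lfloor>a\<rfloor> + 1..nat \<lfloor>b\<rfloor>}"
    using assms by (auto simp: cell_def le_nat_iff nat_le_iff Suc_le_eq nat_less_iff le_floor_iff floor_less_iff)
  moreover have "nat \<lfloor>a\<rfloor> \<le> nat \<lfloor>b\<rfloor>" using assms by (intro nat_mono floor_mono)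
  ultimately show ?thesis unfolding mert_def using mertens_diff by simp
qed

text \<open>Charge every element to the last element of its run. As the run stops within
  \<open>l\<close> steps, each end is charged at most \<open>l\<close> times.\<close>

lemma card_le_runs:
  fixes A :: "nat set"
  assumes "finite A" and norun: "\<And>i. \<not> {i..<i+l} \<subseteq> A"
  shows "card A \<le> l * card {i\<in>A. Suc i \<notin> A}"
proof -
  let ?E = "{i\<in>A. Suc i \<notin> A}"
  have "A \<subseteq> (\<Union>e\<in>?E. {e + 1 - l..e})"
  proof
    fix i assume i: "i \<in> A"
    obtain k where k: "i + k \<notin> A" "k < l"
      using norun[of i] by (auto simp: subset_iff) (metis add_diff_inverse_nat less_diff_conv2 not_less add.commute)
    define m where "m = (LEAST k. i + k \<notin> A)"
    have m: "i + m \<notin> A" "m \<le> k" unfolding m_def using k(1) by (rule LeastI, intro Least_le)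
    have m0: "m \<noteq> 0" using m(1) i by (intro notI) simp
    have "\<not> (i + (m - 1) \<notin> A)"
      using not_less_Least[of "m - 1" "\<lambda>k. i + k \<notin> A", folded m_def] m0 by auto
    hence "i + (m - 1) \<in> ?E" using m(1) m0 by auto
    moreover have "i \<in> {i + (m - 1) + 1 - l..i + (m - 1)}" using m(2) k(2) m0 by auto
    ultimately show "i \<in> (\<Union>e\<in>?E. {e + 1 - l..e})" by blast
  qed
  hence "card A \<le> card (\<Union>e\<in>?E. {e + 1 - l..e})" using assms by (intro card_mono) auto
  also have "\<dots> \<le> (\<Sum>e\<in>?E. card {e + 1 - l..e})" using assms by (intro card_UN_le) auto
  also have "\<dots> \<le> (\<Sum>e\<in>?E. l)" by (intro sum_mono) auto
  finally show ?thesis by (simp add: mult.commute)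
qed

text \<open>
  A cell of the window carrying at least mass \<open>1/K\<close> forces two adjacent reflected cells to carry
  twice the average mass.  As Mertens' theorem allows only half of all cells to do so and
  requires half of the cells of the window to be occupied, the occupied cells form boundedly many
  runs; but Mertens' theorem also bounds the length of a run of full cells.
\<close>

lemma window_contradiction:
  fixes g h \<eta> \<rho> Z W v :: real and K :: nat
  assumes g: "g > 1" "g ^ 3 \<le> 2" and h: "h = ln g"
    and K: "real K * h > 10 + 20 * (16 / h + 1)"
    and pos: "\<eta> > 0" "\<rho> > 0"
    and small: "(2 * \<rho> * real K + 3 * \<eta>) * (real K + 1) \<le> 1" "2 * \<rho> * real K + 3 * \<eta> \<le> h / 2"
    and Z: "Z \<ge> 1" "\<And>z y. z \<ge> Z \<Longrightarrow> z \<le> y \<Longrightarrow> y \<le> 2 * z \<Longrightarrow> mert y - mert z \<le> 2 * ln (y / z) + \<eta>"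
    and Wv: "W \<ge> Z" "v \<ge> Z"
    and sum: "(\<Sum>k\<in>cell W (W * g ^ K). \<Lambda> k / real k *
               (6 * h + \<eta> - (mert (g ^ 3 * (v * g ^ K * W / real k)) - mert (v * g ^ K * W / real k)))) \<le> \<rho>"
  shows False
proof -
  have h0: "h > 0" using g h by simp
  have "real 3 * h \<le> ln 2" using g h by (subst h, subst ln_realpow[symmetric]) auto
  hence h1: "h \<le> 1" using ln2_le_25_over_36 by simp
  have K0: "K > 0" by (rule Nat.gr0I) (use K h0 in \<open>auto simp: field_simps\<close>)
  \<comment> \<open>The deficit of a reflected cell from the full mass \<open>2 * h\<close>:
    \<open>2 * \<rho> * K\<close> by the choice of \<open>k\<close> in \<open>full\<close>,
    \<open>2 * \<eta>\<close> for the two margins and one more \<eta> for the excess of the other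
    cell.\<close>
  define \<tau> where "\<tau> = 2 * \<rho> * real K + 3 * \<eta>"
  have \<tau>: "\<tau> > 0" "\<tau> * (real K + 1) \<le> 1" "\<tau> \<le> h / 2" using small pos K0 by (auto simp: \<tau>_def intro: add_nonneg_pos)
  have \<eta>\<tau>: "\<eta> \<le> \<tau>" using pos by (simp add: \<tau>_def)
  have Wp: "W > 0" "v > 0" using Wv Z by auto
  have gp: "g ^ n > 0" "g ^ n \<ge> 1" for n using g by auto
  have step: "2 * ln (a * g ^ Suc n / (a * g ^ n)) = 2 * h" if "a > 0" for a n
    using that gp[of n] g by (simp add: h)
  have ge: "a * g ^ n \<ge> Z" if "a \<ge> Z" for a n
    using mult_mono[OF that gp(2)[of n]] that Z(1) by simp
  have g3: "g \<le> g ^ 3" using power_increasing[of 1 3 g] g by simp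
  have g2: "g \<le> 2" using g g3 by simp
  \<comment> \<open>\<open>P i\<close> is the mass of the \<open>i\<close>-th cell of the window.
    Under \<open>k \<mapsto> v * g ^ K * W / k\<close> this cell goes to the one just below those
    that \<open>R (Suc i)\<close> and \<open>R i\<close> measure; an interval of ratio
    \<open>g ^ 3\<close> starting there contains both of them.\<close>
  define P where "P i = mert (W * g ^ Suc i) - mert (W * g ^ i)" for i
  define R where "R j = mert (v * g ^ (K + 2 - j)) - mert (v * g ^ (K + 1 - j))" for j
  have P_le: "P i \<le> 2 * h + \<eta>" for i
    unfolding P_def using Z(2)[of "W * g ^ i" "W * g ^ Suc i"] ge[OF Wv(1)] g g2 step[OF Wp(1)] Wp gp[of i]
    by (simp add: field_simps)
  have R_le: "R j \<le> 2 * h + \<eta>" if "j \<le> K" for j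
  proof -
    have e: "K + 2 - j = Suc (K + 1 - j)" using that by simp
    show ?thesis unfolding R_def e
      using Z(2)[of "v * g ^ (K + 1 - j)" "v * g ^ Suc (K + 1 - j)"] ge[OF Wv(2)] g g2 step[OF Wp(2)] Wp gp[of "K + 1 - j"]
      by (simp add: field_simps)
  qed
  have R_nonneg: "R j \<ge> 0" for j
    unfolding R_def using Wp g by (auto intro!: mert_mono power_increasing mult_left_mono)
  \<comment> \<open>With the threshold \<open>1 / K\<close> the cells outside \<open>Occ\<close>
    hold a total mass of at most 1.\<close>
  define Occ where "Occ = {i. i < K \<and> P i \<ge> 1 / real K}"
  have finO: "finite Occ" by (simp add: Occ_def)
  have mert_lb: "mert (a * g ^ n) - mert a \<ge> real n * h - 8" "mert (a * g ^ n) - mert a \<le> real n * h + 8"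
    if "a \<ge> Z" for a n
  proof -
    have a: "a \<ge> 1" using that Z by simp
    have b: "a * g ^ n \<ge> 1" using ge[OF that, of n] Z by simp
    have "ln (a * g ^ n) = ln a + real n * h" using a g by (simp add: ln_mult ln_realpow h)
    thus "mert (a * g ^ n) - mert a \<ge> real n * h - 8" "mert (a * g ^ n) - mert a \<le> real n * h + 8"
      using mert_bounds[OF a] mert_bounds[OF b] by (auto simp: abs_le_iff)
  qed
  have occ: "2 * h * real (card Occ) \<ge> real K * h - 10"
  proof -
    have "real K * h - 8 \<le> mert (W * g ^ K) - mert W" using mert_lb(1)[OF Wv(1)] .
    also have "\<dots> = (\<Sum>i<K. P i)" unfolding P_def
      by (subst sum_lessThan_telescope) auto
    also have "\<dots> \<le> (\<Sum>i<K. (if i \<in> Occ then 2 * h + \<eta> else 0) + 1 / real K)"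
      using P_le K0 pos h0 by (intro sum_mono) (auto simp: Occ_def add_increasing2)
    also have "\<dots> = (\<Sum>i\<in>Occ. 2 * h + \<eta>) + 1"
    proof -
      have "{..<K} \<inter> Occ = Occ" by (auto simp: Occ_def)
      thus ?thesis using K0 by (simp add: sum.distrib sum.If_cases)
    qed
    also have "\<dots> = 2 * h * real (card Occ) + \<eta> * real (card Occ) + 1" by (simp add: algebra_simps)
    also have "\<eta> * real (card Occ) \<le> \<tau> * (real K + 1)"
    proof -
      have "card Occ \<le> card {..<K}" by (intro card_mono) (auto simp: Occ_def)
      thus ?thesis using \<eta>\<tau> pos by (intro mult_mono) auto
    qed
    finally show ?thesis using \<tau> by linarith
  qed
  have full: "R i \<ge> 2 * h - \<tau> \<and> R (Suc i) \<ge> 2 * h - \<tau>" if i: "i \<in> Occ" for i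
  proof -
    let ?x = "v * g ^ K * W"
    define D where "D z = mert (g ^ 3 * z) - mert z" for z
    have iK: "i < K" "P i \<ge> 1 / real K" using i by (auto simp: Occ_def)
    define C where "C = cell (W * g ^ i) (W * g ^ Suc i)"
    have C_sub: "C \<subseteq> cell W (W * g ^ K)"
    proof -
      have "W * 1 \<le> W * g ^ i" "W * g ^ Suc i \<le> W * g ^ K"
        using Wp g iK gp by (intro mult_left_mono power_increasing; simp)+
      thus ?thesis unfolding C_def cell_def by auto
    qed
    have zk: "v * g ^ (K - Suc i) \<le> ?x / real k" "?x / real k \<le> v * g ^ (K - i)" if "k \<in> cell (W * g ^ a) (W * g ^ Suc a)" "a = i" for k a
    proof -
      have k: "W * g ^ i < real k" "real k \<le> W * g ^ Suc i" using that by (auto simp: cell_def)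
      have kp: "real k > 0" using k Wp gp[of i] by (smt (verit) mult_pos_pos)
      have e1: "g ^ K = g ^ (K - Suc i) * g ^ Suc i" "g ^ K = g ^ (K - i) * g ^ i"
        using iK by (simp_all del: power_Suc flip: power_add)
      have "v * g ^ (K - Suc i) * real k \<le> v * g ^ (K - Suc i) * (W * g ^ Suc i)"
        using k Wp gp[of "K - Suc i"] by (intro mult_left_mono) auto
      also have "\<dots> = ?x" by (simp add: e1(1))
      finally show "v * g ^ (K - Suc i) \<le> ?x / real k" using kp by (simp add: field_simps)
      have "v * g ^ (K - i) * real k \<ge> v * g ^ (K - i) * (W * g ^ i)"
        using k Wp gp[of "K - i"] by (intro mult_left_mono) auto
      also have "v * g ^ (K - i) * (W * g ^ i) = ?x" by (simp add: e1(2))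
      finally show "?x / real k \<le> v * g ^ (K - i)" using kp by (simp add: field_simps)
    qed
    have zZ: "?x / real k \<ge> Z" if "k \<in> cell W (W * g ^ K)" for k
    proof -
      have k: "W < real k" "real k \<le> W * g ^ K" using that by (auto simp: cell_def)
      have "v * real k \<le> v * (W * g ^ K)" using k Wp by (intro mult_left_mono) auto
      hence "v \<le> ?x / real k" using k Wp by (simp add: field_simps)
      thus ?thesis using Wv by simp
    qed
    have D_le: "D z \<le> 6 * h + \<eta>" if "z \<ge> Z" for z
    proof -
      have "g ^ 3 * z \<le> 2 * z" using g that Z by (intro mult_right_mono) auto
      moreover have "z \<le> g ^ 3 * z" using gp[of 3] that Z by simp
      ultimately have "D z \<le> 2 * ln (g ^ 3 * z / z) + \<eta>" unfolding D_def using that by (intro Z(2)) auto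
      also have "ln (g ^ 3 * z / z) = 3 * h" using that Z g by (simp add: h ln_realpow)
      finally show ?thesis by simp
    qed
    \<comment> \<open>Otherwise this cell alone, of mass at least \<open>1 / K\<close>, would
      contribute \<open>2 * \<rho>\<close> to a sum that is at most \<rho>.\<close>
    have "\<exists>k\<in>C. 6 * h + \<eta> - D (?x / real k) \<le> 2 * \<rho> * real K"
    proof (rule ccontr)
      assume "\<not> ?thesis"
      hence *: "2 * \<rho> * real K \<le> 6 * h + \<eta> - D (?x / real k)" if "k \<in> C" for k using that by force
      have "2 * \<rho> = (2 * \<rho> * real K) * (1 / real K)" using K0 by simp
      also have "\<dots> \<le> (2 * \<rho> * real K) * P i" using iK pos by (intro mult_left_mono) auto
      also have "P i = (\<Sum>k\<in>C. \<Lambda> k / real k)"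
        unfolding P_def C_def using Wp g by (intro mert_diff_cell) (auto intro!: power_increasing)
      also have "(2 * \<rho> * real K) * \<dots> = (\<Sum>k\<in>C. \<Lambda> k / real k * (2 * \<rho> * real K))"
        by (simp add: sum_distrib_left mult_ac)
      also have "\<dots> \<le> (\<Sum>k\<in>C. \<Lambda> k / real k * (6 * h + \<eta> - D (?x / real k)))"
        using * by (intro sum_mono mult_left_mono) (auto simp: mangoldt_nonneg)
      also have "\<dots> \<le> (\<Sum>k\<in>cell W (W * g ^ K). \<Lambda> k / real k * (6 * h + \<eta> - D (?x / real k)))"
        using C_sub D_le zZ by (intro sum_mono2) (auto simp: mangoldt_nonneg)
      also have "\<dots> \<le> \<rho>" using sum by (simp add: D_def)
      finally show False using pos by simp
    qed
    then obtain k where k: "k \<in> C" "D (?x / real k) \<ge> 6 * h - 2 * \<rho> * real K" using pos by force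
    define z where "z = ?x / real k"
    define a0 a1 a2 where "a0 = v * g ^ (K - i)" and "a1 = v * g ^ (K + 1 - i)" and "a2 = v * g ^ (K + 2 - i)"
    have Ri: "R i = mert a2 - mert a1" "R (Suc i) = mert a1 - mert a0" using iK
      by (auto simp: R_def a0_def a1_def a2_def Suc_diff_le)
    have z: "v * g ^ (K - Suc i) \<le> z" "z \<le> a0" "z \<ge> Z" using zk k zZ C_sub by (auto simp: z_def a0_def C_def)
    have zp: "z > 0" using z Z by simp
    have e: "g * (v * g ^ (K - Suc i)) = a0" "a2 = g ^ 2 * a0"
    proof -
      have s: "K - i = Suc (K - Suc i)" "K + 2 - i = (K - i) + 2" using iK by auto
      show "g * (v * g ^ (K - Suc i)) = a0" unfolding a0_def s(1) by simp
      show "a2 = g ^ 2 * a0" unfolding a0_def a2_def s(2) power_add by simp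
    qed
    have a0: "a0 \<le> g * z" using z(1) e(1) g mult_left_mono[of "v * g ^ (K - Suc i)" z g] by simp
    have a2: "a2 \<le> g ^ 3 * z"
      using mult_left_mono[OF a0, of "g ^ 2"] g unfolding e(2) by (simp add: power2_eq_square power3_eq_cube mult_ac)
    have a0p: "a0 > 0" using z zp by simp
    \<comment> \<open>The two margins, below \<open>a0\<close> and above \<open>a2\<close>, have
      logarithmic lengths adding up to \<open>h\<close>, so together they hold at most
      \<open>2 * h + 2 * \<eta>\<close>.\<close>
    have "mert a0 - mert z \<le> 2 * ln (a0 / z) + \<eta>"
      using z order.trans[OF a0 mult_right_mono[OF g2]] zp by (intro Z(2)) auto
    moreover have "mert (g ^ 3 * z) - mert a2 \<le> 2 * ln (g ^ 3 * z / a2) + \<eta>"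
    proof (intro Z(2) a2)
      show "Z \<le> a2" unfolding a2_def by (rule ge[OF Wv(2)])
      have "g ^ 3 * z \<le> g ^ 3 * a0" using z g by (intro mult_left_mono) auto
      also have "\<dots> = g * a2" by (simp add: e(2) power3_eq_cube power2_eq_square)
      also have "\<dots> \<le> 2 * a2" using g2 a0p unfolding e(2) by (intro mult_right_mono) auto
      finally show "g ^ 3 * z \<le> 2 * a2" .
    qed
    moreover have "ln (a0 / z) + ln (g ^ 3 * z / a2) = h"
      using zp a0p g unfolding e(2) h by (simp add: ln_div ln_mult ln_realpow)
    ultimately have "R i + R (Suc i) \<ge> D z - 2 * h - 2 * \<eta>"
      unfolding Ri D_def by linarith
    moreover have "R i \<le> 2 * h + \<eta>" "R (Suc i) \<le> 2 * h + \<eta>" using R_le iK by auto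
    ultimately show ?thesis using k(2) unfolding z_def[symmetric] \<tau>_def by linarith
  qed
  have Rsum: "(\<Sum>j\<in>{a..<b}. R j) \<le> real (b - a) * h + 8" if "a \<le> b" "b \<le> K + 1" for a b
  proof -
    have "(\<Sum>j\<in>{a..<b}. R j) = mert (v * g ^ (K + 2 - a)) - mert (v * g ^ (K + 2 - b))"
      using that(1) that(2)
    proof (induction b rule: dec_induct)
      case (step n)
      have "K + 1 - n = K + 2 - Suc n" by simp
      thus ?case using step by (simp add: R_def)
    qed simp
    also have "K + 2 - a = (K + 2 - b) + (b - a)" using that by simp
    also have "v * g ^ \<dots> = v * g ^ (K + 2 - b) * g ^ (b - a)" by (simp add: power_add)
    finally show ?thesis using mert_lb(2)[OF ge[OF Wv(2)], of "K + 2 - b" "b - a"] by simp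
  qed
  define Ends where "Ends = {i\<in>Occ. Suc i \<notin> Occ}"
  have finE: "finite Ends" using finO by (simp add: Ends_def)
  have "2 * h * (real (card Occ) + real (card Ends)) \<le> real K * h + 10"
  proof -
    \<comment> \<open>The index after the end of each run is full as well without being occupied;
      these extra full cells are what bounds the number of runs.\<close>
    define F where "F = Occ \<union> Suc ` Ends"
    have "card F = card Occ + card Ends"
      unfolding F_def using finO finE by (subst card_Un_disjoint) (auto simp: Ends_def card_image)
    hence "(2 * h - \<tau>) * (real (card Occ) + real (card Ends)) = (\<Sum>j\<in>F. 2 * h - \<tau>)" by simp
    also have "\<dots> \<le> (\<Sum>j\<in>F. R j)" using full by (intro sum_mono) (auto simp: F_def Ends_def)
    also have "\<dots> \<le> (\<Sum>j\<in>{0..<K+1}. R j)"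
      using R_nonneg by (intro sum_mono2) (auto simp: F_def Ends_def Occ_def)
    also have "\<dots> \<le> real (K + 1) * h + 8" using Rsum[of 0 "K+1"] by simp
    finally have "2 * h * (real (card Occ) + real (card Ends)) \<le>
       real (K + 1) * h + 8 + \<tau> * (real (card Occ) + real (card Ends))" by (simp add: algebra_simps)
    also have "\<tau> * (real (card Occ) + real (card Ends)) \<le> \<tau> * (real K + 1)"
    proof -
      have "card F \<le> card {..K}" by (intro card_mono) (auto simp: F_def Ends_def Occ_def)
      hence "real (card Occ) + real (card Ends) \<le> real K + 1"
        using \<open>card F = card Occ + card Ends\<close> by simp
      thus ?thesis using \<tau> by (intro mult_left_mono) auto
    qed
    finally show ?thesis using \<tau> h1 by (simp add: algebra_simps)
  qed
  hence ends: "real (card Ends) * h \<le> 10" using occ by (simp add: algebra_simps)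
  \<comment> \<open>A run of \<open>l\<close> full cells has mass at least
    \<open>3 / 2 * h * l\<close>, as \<tau> is at most \<open>h / 2\<close>, against
    \<open>h * l + 8\<close> from Mertens' theorem.\<close>
  define l where "l = nat \<lfloor>16 / h\<rfloor> + 1"
  have l: "16 / h < real l" "real l \<le> 16 / h + 1" using h0 unfolding l_def by (auto, linarith)
  have "card Occ \<le> l * card Ends"
    unfolding Ends_def
  proof (intro card_le_runs finO notI)
    fix i assume run: "{i..<i+l} \<subseteq> Occ"
    have "i + l - 1 \<in> Occ" using run by (auto simp: l_def)
    hence iK: "i + l \<le> K" by (auto simp: Occ_def)
    have "(2 * h - \<tau>) * real l = (\<Sum>j\<in>{i..<i+l}. 2 * h - \<tau>)" by simp
    also have "\<dots> \<le> (\<Sum>j\<in>{i..<i+l}. R j)" using full run by (intro sum_mono) auto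
    also have "\<dots> \<le> real l * h + 8" using Rsum[of i "i+l"] iK by simp
    finally have "(h - \<tau>) * real l \<le> 8" by (simp add: algebra_simps)
    moreover have "(h / 2) * real l \<le> (h - \<tau>) * real l" using \<tau> by (intro mult_right_mono) auto
    ultimately have "h * real l \<le> 16" by simp
    thus False using l(1) h0 by (simp add: field_simps)
  qed
  hence "real (card Occ) \<le> real l * real (card Ends)" by (metis of_nat_le_iff of_nat_mult)
  \<comment> \<open>Boundedly many runs of bounded length, against the growth with \<open>K\<close>
    in \<open>occ\<close>: this is the origin of the lower bound on \<open>K * h\<close>.\<close>
  hence "2 * h * real (card Occ) \<le> 2 * h * (real l * real (card Ends))"
    using h0 by (intro mult_left_mono) auto
  also have "\<dots> = 2 * real l * (real (card Ends) * h)" by simp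
  also have "\<dots> \<le> 2 * (16 / h + 1) * 10" using l ends h0 by (intro mult_mono) auto
  finally show False using occ K by simp
qed

text \<open>If large \<open>x\<close> had no prime up to \<open>(1 + \<epsilon>) * x\<close>,
  Selberg's formula would leave a total defect \<open>w\<close> below
  \<open>3 * \<eta> * ln x\<close> against the bound of \<open>mert_diff_le\<close>. The range below
  \<open>x / Z\<close> contains at least \<open>ln x / (2 * L)\<close> disjoint windows of
  logarithmic length \<open>L\<close>, so one of them has defect at most
  \<open>\<rho> = 6 * L * \<eta>\<close>, and \<open>window_contradiction\<close> applies.\<close>

theorem prime_in_short_interval:
  fixes \<epsilon> :: real
  assumes "\<epsilon> > 0"
  shows "\<exists>x0. \<forall>x\<ge>x0. \<exists>p. prime p \<and> x < real p \<and> real p \<le> (1 + \<epsilon>) * x"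
proof -
  \<comment> \<open>For \<open>0 \<le> d \<le> 1\<close> the cube of \<open>1 + d\<close> is at most
    \<open>1 + 7 * d\<close>.\<close>
  define g where "g = 1 + min \<epsilon> 1 / 7"
  define h where "h = ln g"
  define lam where "lam = g ^ 3"
  have g: "g > 1" using assms by (simp add: g_def)
  have "g ^ 3 \<le> 1 + min \<epsilon> 1"
  proof -
    define d where "d = min \<epsilon> 1 / 7"
    have d: "0 \<le> d" "d \<le> 1" using assms by (auto simp: d_def)
    have "d * d \<le> d" "d * (d * d) \<le> d" using d by (auto intro: mult_left_le mult_le_one)
    hence "(1 + d) ^ 3 \<le> 1 + 7 * d" by (simp add: power3_eq_cube algebra_simps)
    thus ?thesis by (simp add: g_def d_def)
  qed
  hence lam: "lam \<le> 2" "lam \<le> 1 + \<epsilon>" "lam > 1" using g by (auto simp: lam_def)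
  have h0: "h > 0" using g by (simp add: h_def)
  have lnlam: "ln lam = 3 * h" using g by (simp add: lam_def h_def ln_realpow)
  obtain K :: nat where K: "real K > (10 + 20 * (16 / h + 1)) / h" using reals_Archimedean2 by blast
  hence Kh: "real K * h > 10 + 20 * (16 / h + 1)" using h0 by (simp add: field_simps)
  have K0: "K > 0" by (rule Nat.gr0I) (use Kh h0 in \<open>auto simp: field_simps\<close>)
  define L where "L = real K * h"
  have L0: "L > 0" using K0 h0 by (simp add: L_def)
  \<comment> \<open>Chosen so that the deficit \<open>2 * \<rho> * K + 3 * \<eta>\<close> becomes
    \<open>c * \<eta>\<close>; \<open>K\<close> is fixed first, so \<eta> can still be taken small
    against it.\<close>
  define c where "c = 2 * (6 * L) * real K + 3"
  have c0: "c > 0" using L0 by (simp add: c_def add_nonneg_pos)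
  define \<eta> where "\<eta> = min (1 / (c * (real K + 1))) (h / (2 * c))"
  have \<eta>0: "\<eta> > 0" using c0 h0 by (simp add: \<eta>_def)
  define \<rho> where "\<rho> = 6 * L * \<eta>"
  have \<rho>0: "\<rho> > 0" using L0 \<eta>0 by (simp add: \<rho>_def)
  have \<rho>c: "2 * \<rho> * real K + 3 * \<eta> = c * \<eta>" by (simp add: \<rho>_def c_def algebra_simps)
  have small1: "c * \<eta> * (real K + 1) \<le> 1"
  proof -
    have "\<eta> \<le> 1 / (c * (real K + 1))" by (simp add: \<eta>_def)
    moreover have "c * (real K + 1) > 0" using c0 by (simp add: add_nonneg_pos)
    ultimately have "\<eta> * (c * (real K + 1)) \<le> 1" by (simp only: pos_le_divide_eq)
    thus ?thesis by (simp add: mult_ac)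
  qed
  have small2: "c * \<eta> \<le> h / 2"
  proof -
    have "\<eta> \<le> h / (2 * c)" by (simp add: \<eta>_def)
    thus ?thesis using c0 by (simp add: field_simps)
  qed
  \<comment> \<open>Beyond \<open>Z\<close> the error \<open>300 / ln z\<close> of
    \<open>mert_diff_le\<close> is at most \<eta>.\<close>
  define Z where "Z = max 2 (exp (300 / \<eta>))"
  have Z1: "Z \<ge> 2" by (simp add: Z_def)
  have ZU: "mert y - mert z \<le> 2 * ln (y / z) + \<eta>" if "z \<ge> Z" "z \<le> y" "y \<le> 2 * z" for z y
  proof -
    have "ln z \<ge> ln (exp (300 / \<eta>))" using that Z1 by (subst ln_le_cancel_iff) (auto simp: Z_def)
    hence "300 \<le> ln z * \<eta>" using \<eta>0 by (simp add: field_simps)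
    moreover have "ln z > 0" using that Z1 by simp
    ultimately have "300 / ln z \<le> \<eta>" by (simp add: pos_divide_le_eq mult.commute)
    moreover have "mert y - mert z \<le> 2 * ln (y / z) + 300 / ln z"
      using that Z1 by (intro mert_diff_le) auto
    ultimately show ?thesis by simp
  qed
  define c1 c2 where "c1 = mert (lam * Z)" and "c2 = ln (lam * Z) + 8"
  define j0 where "j0 = nat \<lceil>ln Z / L\<rceil>"
  have "eventually (\<lambda>x. (sqrt (2 * x) + 1) * (log 2 (2 * x) + 1) * ln (2 * x) / x < \<eta>) at_top"
    by (rule order_tendstoD[OF _ \<eta>0]) real_asymp
  moreover have "eventually (\<lambda>x. ln x > ((6 * h + \<eta>) * 4 + 300 + c1 * c2) / \<eta>) at_top"
    using filterlim_at_top_dense[THEN iffD1, OF ln_at_top] by blast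
  moreover have "eventually (\<lambda>x. ln x > 2 * (ln Z + L + L * real j0)) at_top"
    using filterlim_at_top_dense[THEN iffD1, OF ln_at_top] by blast
  moreover have "eventually (\<lambda>x. x \<ge> Z) at_top" by (rule eventually_ge_at_top)
  ultimately have "eventually (\<lambda>x. \<exists>p. prime p \<and> x < real p \<and> real p \<le> (1 + \<epsilon>) * x) at_top"
  proof eventually_elim
    case (elim x)
    show ?case
    proof (rule ccontr)
      assume np: "\<not> (\<exists>p. prime p \<and> x < real p \<and> real p \<le> (1 + \<epsilon>) * x)"
      have x: "x \<ge> Z" "x \<ge> 2" using elim Z1 by auto
      have lx: "ln x > 0" using x by simp
      define y where "y = lam * x"
      have y: "x \<le> y" "y \<le> 2 * x" "y \<le> (1 + \<epsilon>) * x" using lam x by (auto simp: y_def intro!: mult_right_mono)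
      define D where "D z = mert (lam * z) - mert z" for z
      have D_le: "D z \<le> 6 * h + \<eta>" if "z \<ge> Z" for z
      proof -
        have "D z \<le> 2 * ln (lam * z / z) + \<eta>" unfolding D_def using that lam Z1 by (intro ZU) auto
        also have "lam * z / z = lam" using that Z1 by simp
        finally show ?thesis by (simp add: lnlam)
      qed
      define w where "w k = \<Lambda> k / real k * (6 * h + \<eta> - D (x / real k))" for k
      have wpos: "w k \<ge> 0" if "k \<in> cell 0 (x / Z)" for k
      proof -
        have "x / real k \<ge> Z" using that Z1 by (auto simp: cell_def field_simps)
        thus ?thesis unfolding w_def using D_le by (intro mult_nonneg_nonneg) (auto simp: mangoldt_nonneg)
      qed
      have xZ: "1 \<le> x / Z" "x / Z \<le> y" "x / Z \<le> x"
      proof -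
        show "1 \<le> x / Z" using x Z1 by (simp add: le_divide_eq)
        show "x / Z \<le> x" using x Z1 mult_left_mono[of 1 Z x] by (simp add: divide_le_eq)
        thus "x / Z \<le> y" using y by simp
      qed
      \<comment> \<open>The gap makes the first term of Selberg's formula negligible, so the second
        has to supply nearly all of \<open>6 * h * ln x\<close>. This is about the most it can:
        Mertens' theorem bounds the mass of the \<open>k\<close>, and each \<open>D\<close> is at
        most \<open>6 * h + \<eta>\<close>.\<close>
      have T: "sum w (cell 0 (x / Z)) < 3 * \<eta> * ln x"
      proof -
        have "mert y - mert x \<le> \<eta>"
        proof -
          have "\<not> (x < real p \<and> real p \<le> y)" if "prime p" for p
            using np that y(3) by (meson order.trans)
          from mert_diff_no_primes[OF _ y(1,2) this] show ?thesis using elim(1) x by simp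
        qed
        hence e1: "(mert y - mert x) * ln x \<le> \<eta> * ln x" using lx by (intro mult_right_mono) auto
        have e2: "{1..nat \<lfloor>y\<rfloor>} = cell 0 y"
          using y x by (auto simp: cell_def le_nat_iff le_floor_iff)
        have e3: "mert (y / real k) - mert (x / real k) = D (x / real k)" for k
          by (simp add: D_def y_def)
        have e4: "ln (y / x) = 3 * h" using x by (simp add: y_def lnlam)
        have "2 * (3 * h) * ln x - 300 \<le>
            (mert y - mert x) * ln x + (\<Sum>k\<in>cell 0 y. \<Lambda> k / real k * D (x / real k))"
          using mert_selberg[of x y] x y unfolding e2 e3 e4 abs_le_iff by linarith
        hence "(\<Sum>k\<in>cell 0 y. \<Lambda> k / real k * D (x / real k)) \<ge> 6 * h * ln x - 300 - \<eta> * ln x"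
          using e1 by linarith
        also have "(\<Sum>k\<in>cell 0 y. \<Lambda> k / real k * D (x / real k)) =
            (\<Sum>k\<in>cell 0 (x / Z). \<Lambda> k / real k * D (x / real k)) +
            (\<Sum>k\<in>cell (x / Z) y. \<Lambda> k / real k * D (x / real k))"
          using xZ by (intro sum_cell_add) auto
        also have "(\<Sum>k\<in>cell (x / Z) y. \<Lambda> k / real k * D (x / real k)) \<le> c2 * c1"
        proof -
          have "(\<Sum>k\<in>cell (x / Z) y. \<Lambda> k / real k * D (x / real k)) \<le> (\<Sum>k\<in>cell (x / Z) y. \<Lambda> k / real k * c1)"
          proof (intro sum_mono mult_left_mono)
            fix k assume k: "k \<in> cell (x / Z) y"
            hence *: "x < Z * real k" using Z1 by (auto simp: cell_def field_simps)
            hence "k \<noteq> 0" using x by (intro notI) simp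
            hence "x / real k \<le> Z" using * by (simp add: pos_divide_le_eq)
            hence "mert (lam * (x / real k)) \<le> c1" unfolding c1_def using lam by (intro mert_mono mult_left_mono) auto
            moreover have "mert (x / real k) \<ge> 0"
              by (auto simp: mert_def mertens_def mangoldt_nonneg intro!: sum_nonneg)
            ultimately show "D (x / real k) \<le> c1" by (simp add: D_def)
          qed (auto simp: mangoldt_nonneg)
          also have "\<dots> = (mert y - mert (x / Z)) * c1"
            using xZ by (subst mert_diff_cell) (auto simp: sum_distrib_right)
          also have "\<dots> \<le> c2 * c1"
          proof (intro mult_right_mono)
            have "mert y - mert (x / Z) \<le> ln y - ln (x / Z) + 8"
              using mert_bounds[of y] mert_bounds[of "x / Z"] xZ by (simp add: abs_le_iff)
            also have "ln y - ln (x / Z) = ln (lam * Z)"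
              using x Z1 lam by (simp add: y_def ln_mult ln_div)
            finally show "mert y - mert (x / Z) \<le> c2" by (simp add: c2_def)
            show "c1 \<ge> 0" by (auto simp: c1_def mert_def mertens_def mangoldt_nonneg intro!: sum_nonneg)
          qed
          finally show ?thesis .
        qed
        finally have 1: "(\<Sum>k\<in>cell 0 (x / Z). \<Lambda> k / real k * D (x / real k)) \<ge> 6 * h * ln x - 300 - \<eta> * ln x - c2 * c1"
          by simp
        have "sum w (cell 0 (x / Z)) = (6 * h + \<eta>) * (\<Sum>k\<in>cell 0 (x / Z). \<Lambda> k / real k) -
                (\<Sum>k\<in>cell 0 (x / Z). \<Lambda> k / real k * D (x / real k))"
          unfolding w_def by (simp add: sum_subtractf sum_distrib_left algebra_simps sum.distrib)
        also have "(\<Sum>k\<in>cell 0 (x / Z). \<Lambda> k / real k) = mert (x / Z)"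
          using xZ mert_diff_cell[of 0 "x / Z"] by (simp add: mert_0)
        also have "(6 * h + \<eta>) * mert (x / Z) \<le> (6 * h + \<eta>) * (ln x + 4)"
        proof (intro mult_left_mono)
          have "ln (x / Z) \<le> ln x" using xZ by simp
          thus "mert (x / Z) \<le> ln x + 4" using mert_bounds[OF xZ(1)] by (simp add: abs_le_iff)
        qed (use h0 \<eta>0 in auto)
        finally have "sum w (cell 0 (x / Z)) \<le> 2 * \<eta> * ln x + ((6 * h + \<eta>) * 4 + 300 + c1 * c2)"
          using 1 by (simp add: algebra_simps)
        also have "(6 * h + \<eta>) * 4 + 300 + c1 * c2 < \<eta> * ln x"
          using elim(2) \<eta>0 by (simp add: field_simps)
        finally show ?thesis by simp
      qed
      define a where "a j = g ^ (K * j)" for j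
      have a: "a j = exp (L * real j)" for j
        using g by (simp add: a_def L_def h_def powr_realpow[symmetric] powr_def)
      define J where "J = nat \<lfloor>ln (x / Z) / L\<rfloor> - j0"
      have lnxZ: "ln (x / Z) = ln x - ln Z" using x Z1 by (simp add: ln_div)
      have Jr: "real (j0 + J) \<le> ln (x / Z) / L" "real J \<ge> ln x / (2 * L)"
      proof -
        have *: "ln (x / Z) / L - 1 - real j0 \<ge> ln x / (2 * L)"
          unfolding lnxZ using elim(3) L0 by (simp add: field_simps)
        have "ln x / (2 * L) > 0" using lx L0 by simp
        with * have fl: "real (nat \<lfloor>ln (x / Z) / L\<rfloor>) \<le> ln (x / Z) / L"
           "real (nat \<lfloor>ln (x / Z) / L\<rfloor>) > ln (x / Z) / L - 1" by linarith+
        with * have le: "j0 \<le> nat \<lfloor>ln (x / Z) / L\<rfloor>" using \<open>ln x / (2 * L) > 0\<close> by linarith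
        have "real (j0 + J) = real (nat \<lfloor>ln (x / Z) / L\<rfloor>)" using le by (simp add: J_def)
        thus "real (j0 + J) \<le> ln (x / Z) / L" "real J \<ge> ln x / (2 * L)" using fl * by linarith+
      qed
      have amono: "a i \<le> a j" if "i \<le> j" for i j unfolding a using that L0 by simp
      have aZ: "a j \<ge> Z" if "j \<ge> j0" for j
      proof -
        have "real j0 \<ge> ln Z / L" unfolding j0_def by linarith
        hence "L * real j \<ge> ln Z" using that L0 by (simp add: field_simps) (smt (verit) mult_left_mono of_nat_mono)
        thus ?thesis unfolding a using Z1 by (metis exp_le_cancel_iff exp_ln less_le_trans zero_less_numeral)
      qed
      have ax: "a j \<le> x / Z" if "j \<le> j0 + J" for j
      proof -
        have "real j \<le> ln (x / Z) / L" using Jr(1) that by linarith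
        hence "L * real j \<le> ln (x / Z)" using L0 by (simp add: field_simps)
        thus ?thesis unfolding a using xZ by (subst ln_ge_iff[symmetric]) auto
      qed
      have tel: "(\<Sum>j=j0..<j0+n. sum w (cell (a j) (a (Suc j)))) = sum w (cell (a j0) (a (j0 + n)))" for n
      proof (induction n)
        case 0
        have "cell (a j0) (a j0) = {}" by (auto simp: cell_def)
        thus ?case by simp
      next
        case (Suc n)
        thus ?case using sum_cell_add[of "a j0" "a (j0 + n)" "a (j0 + Suc n)" w] amono by simp
      qed
      have "\<exists>j\<in>{j0..<j0+J}. sum w (cell (a j) (a (Suc j))) \<le> \<rho>"
      proof (rule ccontr)
        assume "\<not> ?thesis"
        hence *: "\<rho> \<le> sum w (cell (a j) (a (Suc j)))" if "j \<in> {j0..<j0+J}" for j using that by force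
        have "3 * \<eta> * ln x = \<rho> * (ln x / (2 * L))" using L0 by (simp add: \<rho>_def)
        also have "\<dots> \<le> \<rho> * real J" using Jr \<rho>0 by (intro mult_left_mono) auto
        also have "\<dots> = (\<Sum>j=j0..<j0+J. \<rho>)" by simp
        also have "\<dots> \<le> (\<Sum>j=j0..<j0+J. sum w (cell (a j) (a (Suc j))))" using * by (intro sum_mono)
        also have "\<dots> = sum w (cell (a j0) (a (j0 + J)))" by (rule tel)
        also have "\<dots> \<le> sum w (cell 0 (x / Z))"
        proof (intro sum_mono2 finite_cell)
          show "cell (a j0) (a (j0 + J)) \<subseteq> cell 0 (x / Z)"
            using ax[of "j0 + J"] aZ[of j0] Z1 by (auto simp: cell_def)
        qed (use wpos in auto)
        finally show False using T by simp
      qed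
      then obtain j where j: "j0 \<le> j" "j < j0 + J" "sum w (cell (a j) (a (Suc j))) \<le> \<rho>" by auto
      define W v where "W = a j" and "v = x / a (Suc j)"
      have aS: "a (Suc j) = W * g ^ K" by (simp add: W_def a_def power_add)
      have W: "W \<ge> Z" unfolding W_def by (rule aZ) (use j in simp)
      have v: "v \<ge> Z"
        using ax[of "Suc j"] j Z1 aZ[of "Suc j"] by (simp add: v_def field_simps)
      have vx: "v * g ^ K * W = x" using W Z1 g by (simp add: v_def aS)
      show False
      proof (rule window_contradiction[of g h K \<eta> \<rho> Z W v])
        show "(\<Sum>k\<in>cell W (W * g ^ K). \<Lambda> k / real k *
               (6 * h + \<eta> - (mert (g ^ 3 * (v * g ^ K * W / real k)) - mert (v * g ^ K * W / real k)))) \<le> \<rho>"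
          using j(3) unfolding vx aS W_def[symmetric] w_def D_def lam_def .
        show "(2 * \<rho> * real K + 3 * \<eta>) * (real K + 1) \<le> 1" using small1 unfolding \<rho>c .
        show "2 * \<rho> * real K + 3 * \<eta> \<le> h / 2" using small2 unfolding \<rho>c .
        show "mert y - mert z \<le> 2 * ln (y / z) + \<eta>" if "z \<ge> Z" "z \<le> y" "y \<le> 2 * z" for z y
          using that by (rule ZU)
        show "g ^ 3 \<le> 2" using lam(1) by (simp add: lam_def)
        show "Z \<ge> 1" using Z1 by simp
      qed (fact h_def g Kh \<eta>0 \<rho>0 W v)+
    qed
  qed
  thus ?thesis unfolding eventually_at_top_linorder by blast
qed

section \<open>Messages about independent inputs\<close>

text \<open>Hoeffding's lemma for a uniform element of \<open>Y\<close>: the chord of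
  \<open>exp\<close> over the unit interval reduces it to a two-point distribution.\<close>

lemma sum_exp_le:
  fixes f :: "'a \<Rightarrow> real"
  assumes "finite Y" "Y \<noteq> {}" "\<And>y. y \<in> Y \<Longrightarrow> 0 \<le> f y \<and> f y \<le> 1" "l \<ge> 0"
  shows "(\<Sum>y\<in>Y. exp (l * (f y - sum f Y / card Y))) \<le> card Y * exp (l\<^sup>2 / 8)"
proof -
  define n where "n = real (card Y)"
  have n: "n > 0" using assms by (simp add: n_def card_gt_0_iff)
  define p where "p = sum f Y / n"
  have p: "p \<ge> 0" using assms n by (auto simp: p_def intro!: sum_nonneg divide_nonneg_nonneg)
  have 1: "1 + p * (exp l - 1) > 0" using p assms by (intro add_pos_nonneg mult_nonneg_nonneg) auto
  have "(\<Sum>y\<in>Y. exp (l * f y)) \<le> (\<Sum>y\<in>Y. 1 + f y * (exp l - 1))"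
  proof (intro sum_mono)
    fix y assume y: "y \<in> Y"
    have "exp (l * ((1 - f y) * 0 + f y * 1)) \<le> (1 - f y) * exp (l * 0) + f y * exp (l * 1)"
      using convex_onD[OF convex_on_exp[OF assms(4)], of "f y" 0 1] assms(3)[OF y] by simp
    thus "exp (l * f y) \<le> 1 + f y * (exp l - 1)" by (simp add: algebra_simps)
  qed
  also have "\<dots> = n * (1 + p * (exp l - 1))"
  proof -
    have "(\<Sum>y\<in>Y. 1 + f y * (exp l - 1)) = n + sum f Y * (exp l - 1)"
      by (simp add: sum.distrib n_def sum_distrib_right)
    thus ?thesis using n by (simp add: p_def distrib_left)
  qed
  finally have "(\<Sum>y\<in>Y. exp (l * f y)) \<le> n * (1 + p * (exp l - 1))" .
  hence "exp (- l * p) * (\<Sum>y\<in>Y. exp (l * f y)) \<le> exp (- l * p) * (n * (1 + p * (exp l - 1)))"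
    by (intro mult_left_mono) auto
  also have "\<dots> = n * exp (- l * p + ln (1 + p * (exp l - 1)))"
    unfolding exp_add using 1 by simp
  also have "\<dots> \<le> n * exp (l\<^sup>2 / 8)"
    using Hoeffdings_lemma_aux[OF assms(4) p] n by simp
  also have "exp (- l * p) * (\<Sum>y\<in>Y. exp (l * f y)) = (\<Sum>y\<in>Y. exp (l * (f y - p)))"
    by (simp add: sum_distrib_left algebra_simps flip: exp_add)
  finally show ?thesis by (simp add: p_def n_def)
qed

text \<open>
  Here \<open>g\<close> is a message about \<open>t\<close> independent uniform elements of \<open>Y\<close>.  The message is replaced
  by a sum over all possible messages inside the exponential moment.
\<close>

lemma message_advantage_le:
  fixes f :: "nat \<Rightarrow> 'm \<Rightarrow> 'a \<Rightarrow> real" and part :: "nat \<Rightarrow> 'x \<Rightarrow> 'a" and g :: "'x \<Rightarrow> 'm"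
  assumes Y: "finite Y" "Y \<noteq> {}" and t: "t > 0" and M: "finite M"
    and bij: "bij_betw (\<lambda>x. \<lambda>r\<in>{..<t}. part r x) \<Omega> (PiE {..<t} (\<lambda>_. Y))"
    and g: "\<And>x. x \<in> \<Omega> \<Longrightarrow> g x \<in> M"
    and f: "\<And>r m y. 0 \<le> f r m y \<and> f r m y \<le> 1"
  shows "(\<Sum>x\<in>\<Omega>. \<Sum>r<t. f r (g x) (part r x) - sum (f r (g x)) Y / card Y)
           \<le> card \<Omega> * sqrt (t * ln (card M) / 2)"
proof -
  define n where "n = real (card \<Omega>)"
  define \<phi> where "\<phi> r m y = f r m y - sum (f r m) Y / card Y" for r m y
  define Z where "Z x = (\<Sum>r<t. \<phi> r (g x) (part r x))" for x
  have card\<Omega>: "n = real (card Y) ^ t"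
    using bij_betw_same_card[OF bij] by (simp add: n_def card_PiE)
  have n0: "n > 0" using Y by (simp add: card\<Omega> card_gt_0_iff)
  hence fin: "finite \<Omega>" and "\<Omega> \<noteq> {}" unfolding n_def by (auto simp: card_gt_0_iff)
  hence "M \<noteq> {}" using g by auto
  hence M1: "card M \<ge> 1" using M by (simp add: Suc_le_eq card_gt_0_iff)
  define b where "b = ln (real (card M))"
  have b0: "b \<ge> 0" using M1 by (simp add: b_def)
  define a where "a = (\<Sum>x\<in>\<Omega>. Z x) / n"
  have main: "a * l \<le> b + t * l\<^sup>2 / 8" if l: "l > 0" for l :: real
  proof -
    have "n * exp (l * a) \<le> (\<Sum>x\<in>\<Omega>. exp (l * Z x))"
    proof -
      \<comment> \<open>Jensen's inequality through the tangent of \<open>exp\<close> at the mean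
        \<open>l * a\<close>.\<close>
      have "(\<Sum>x\<in>\<Omega>. exp (l * a) * (1 + (l * Z x - l * a))) \<le> (\<Sum>x\<in>\<Omega>. exp (l * a) * exp (l * Z x - l * a))"
        by (intro sum_mono mult_left_mono) auto
      also have "\<dots> = (\<Sum>x\<in>\<Omega>. exp (l * Z x))" by (simp flip: exp_add)
      also have "(\<Sum>x\<in>\<Omega>. exp (l * a) * (1 + (l * Z x - l * a))) = exp (l * a) * (n + l * (\<Sum>x\<in>\<Omega>. Z x) - n * (l * a))"
        by (simp add: n_def sum_distrib_left sum.distrib sum_subtractf algebra_simps)
      also have "\<dots> = n * exp (l * a)" using n0 by (simp add: a_def)
      finally show ?thesis .
    qed
    also have "\<dots> \<le> (\<Sum>x\<in>\<Omega>. \<Sum>m\<in>M. \<Prod>r<t. exp (l * \<phi> r m (part r x)))"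
    proof (intro sum_mono)
      fix x assume x: "x \<in> \<Omega>"
      have "exp (l * Z x) = (\<Prod>r<t. exp (l * \<phi> r (g x) (part r x)))"
        by (simp add: Z_def sum_distrib_left exp_sum)
      also have "\<dots> \<le> (\<Sum>m\<in>M. \<Prod>r<t. exp (l * \<phi> r m (part r x)))"
        using M g[OF x] by (intro member_le_sum[where f = "\<lambda>m. \<Prod>r<t. exp (l * \<phi> r m (part r x))"]) (auto intro!: prod_nonneg)
      finally show "exp (l * Z x) \<le> (\<Sum>m\<in>M. \<Prod>r<t. exp (l * \<phi> r m (part r x)))" .
    qed
    also have "\<dots> = (\<Sum>m\<in>M. \<Sum>x\<in>\<Omega>. \<Prod>r<t. exp (l * \<phi> r m (part r x)))" by (rule sum.swap)
    also have "\<dots> \<le> (\<Sum>m\<in>M. n * exp (t * l\<^sup>2 / 8))"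
    proof (intro sum_mono)
      fix m assume "m \<in> M"
      have "(\<Sum>x\<in>\<Omega>. \<Prod>r<t. exp (l * \<phi> r m (part r x))) =
            (\<Sum>x\<in>\<Omega>. (\<lambda>ys. \<Prod>r<t. exp (l * \<phi> r m (ys r))) (\<lambda>r\<in>{..<t}. part r x))"
        by (intro sum.cong prod.cong) auto
      also have "\<dots> = (\<Sum>ys\<in>PiE {..<t} (\<lambda>_. Y). \<Prod>r<t. exp (l * \<phi> r m (ys r)))"
        by (rule sum.reindex_bij_betw[OF bij])
      also have "\<dots> = (\<Prod>r<t. \<Sum>y\<in>Y. exp (l * \<phi> r m y))"
        using Y by (subst prod_sum_PiE) auto
      also have "\<dots> \<le> (\<Prod>r<t. card Y * exp (l\<^sup>2 / 8))"
        unfolding \<phi>_def using f l Y by (intro prod_mono conjI sum_nonneg sum_exp_le) auto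
      also have "\<dots> = n * exp (t * l\<^sup>2 / 8)"
        by (simp add: card\<Omega> power_mult_distrib flip: exp_of_nat_mult)
      finally show "(\<Sum>x\<in>\<Omega>. \<Prod>r<t. exp (l * \<phi> r m (part r x))) \<le> n * exp (t * l\<^sup>2 / 8)" .
    qed
    also have "\<dots> = n * (exp b * exp (t * l\<^sup>2 / 8))" using M1 by (simp add: b_def)
    finally have "exp (l * a) \<le> exp (b + t * l\<^sup>2 / 8)" using n0 by (simp add: exp_add)
    thus ?thesis by (simp add: mult.commute)
  qed
  have "a \<le> sqrt (t * b / 2)"
  proof (cases "b = 0")
    case True
    \<comment> \<open>With a single possible message the optimal \<open>l\<close> used below would
      be 0; a suitable positive multiple of \<open>a\<close> contradicts \<open>main\<close>
      instead.\<close>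
    have "a \<le> 0"
    proof (rule ccontr)
      assume "\<not> a \<le> 0"
      hence a: "a > 0" by simp
      define l where "l = 4 * a / t"
      have l: "l > 0" using a t by (simp add: l_def)
      have "a * l \<le> (t * l / 8) * l" using main[OF l] True by (simp add: power2_eq_square)
      hence "a \<le> t * l / 8" using l by (rule mult_right_le_imp_le)
      also have "t * l / 8 = a / 2" using t by (simp add: l_def)
      finally show False using a by simp
    qed
    thus ?thesis using True by simp
  next
    case False
    \<comment> \<open>The minimiser of \<open>b / l + t * l / 8\<close>.\<close>
    define l where "l = sqrt (8 * b / t)"
    have l: "l > 0" using False b0 t by (simp add: l_def)
    have l2: "l\<^sup>2 = 8 * b / t" using b0 by (simp add: l_def)
    have "a * l \<le> 2 * b" using main[OF l] t unfolding l2 by simp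
    also have "2 * b = sqrt (t * b / 2) * l"
    proof -
      have "sqrt (t * b / 2) * l = sqrt ((t * b / 2) * (8 * b / t))" by (simp only: l_def real_sqrt_mult)
      also have "(t * b / 2) * (8 * b / t) = (2 * b)\<^sup>2" using t by (simp add: power2_eq_square)
      finally have "sqrt (t * b / 2) * l = sqrt ((2 * b)\<^sup>2)" .
      thus ?thesis using b0 by (simp only: real_sqrt_abs)
    qed
    finally show ?thesis using l by simp
  qed
  hence "n * a \<le> n * sqrt (t * b / 2)" using n0 by (intro mult_left_mono) auto
  also have "n * a = (\<Sum>x\<in>\<Omega>. Z x)" using n0 by (simp add: a_def)
  finally show ?thesis by (simp add: Z_def \<phi>_def b_def n_def)
qed

text \<open>
  Players who hold \<open>y j\<close> and privately sample from \<open>G j (y j)\<close> can be derandomised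
  simultaneously, one coordinate at a time.
\<close>

lemma derandomise_product:
  fixes F :: "('j \<Rightarrow> 'a) \<Rightarrow> ('j \<Rightarrow> 'b) \<Rightarrow> real"
  assumes "finite J" "\<And>j. j \<in> J \<Longrightarrow> finite (A j)" "\<And>j a. j \<in> J \<Longrightarrow> finite (G j a)"
    and "\<And>y x. F y x \<ge> 0"
  shows "\<exists>\<rho>. (\<Sum>y\<in>PiE J A. sum (F y) (PiE J (\<lambda>j. G j (y j))) / card (PiE J (\<lambda>j. G j (y j))))
              \<le> (\<Sum>y\<in>PiE J A. F y (\<lambda>j\<in>J. \<rho> j (y j)))"
  using assms
proof (induction J arbitrary: F rule: finite_induct)
  case empty
  thus ?case by (auto simp: restrict_def)
next
  case (insert i J)
  define E where "E F' y = sum F' (PiE J (\<lambda>j. G j (y j))) / card (PiE J (\<lambda>j. G j (y j)))" for F' :: "('j \<Rightarrow> 'b) \<Rightarrow> real" and y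
  define \<Psi> where "\<Psi> a b = (\<Sum>y\<in>PiE J A. E (\<lambda>x. F (y(i := a)) (x(i := b))) y)" for a b
  have \<Psi>0: "\<Psi> a b \<ge> 0" for a b
    unfolding \<Psi>_def E_def using insert.prems by (intro sum_nonneg divide_nonneg_nonneg) auto
  have split: "sum f (PiE (insert i J) B) = (\<Sum>b\<in>B i. \<Sum>x\<in>PiE J B. f (x(i := b)))"
    if "\<And>j. j \<in> insert i J \<Longrightarrow> finite (B j)" for f :: "('j \<Rightarrow> 'c) \<Rightarrow> real" and B
  proof -
    have "sum f (PiE (insert i J) B) = (\<Sum>(b, x)\<in>B i \<times> PiE J B. f (x(i := b)))"
      unfolding PiE_insert_eq using insert.hyps
      by (subst sum.reindex) (auto intro!: inj_combinator, auto simp: case_prod_unfold)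
    also have "\<dots> = (\<Sum>b\<in>B i. \<Sum>x\<in>PiE J B. f (x(i := b)))"
      by (rule sum.cartesian_product[symmetric])
    finally show ?thesis .
  qed
  have "\<exists>b. sum (\<Psi> a) (G i a) / card (G i a) \<le> \<Psi> a b" if a: "a \<in> A i" for a
  \<comment> \<open>Over an empty set the average is 0 by division by zero, and any \<open>b\<close>
    serves.\<close>
  proof (cases "G i a = {}")
    case False
    have fin: "finite (G i a)" using insert.prems by auto
    have "\<exists>b\<in>G i a. sum (\<Psi> a) (G i a) \<le> card (G i a) * \<Psi> a b"
    proof (rule ccontr)
      assume "\<not> ?thesis"
      hence "card (G i a) * \<Psi> a b < sum (\<Psi> a) (G i a)" if "b \<in> G i a" for b using that by force
      hence "(\<Sum>b\<in>G i a. card (G i a) * \<Psi> a b) < (\<Sum>b\<in>G i a. sum (\<Psi> a) (G i a))"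
        by (intro sum_strict_mono fin False)
      thus False by (simp flip: sum_distrib_left)
    qed
    thus ?thesis using False fin by (auto simp: field_simps card_gt_0_iff)
  qed (use \<Psi>0 in auto)
  then obtain \<rho>i where \<rho>i: "\<And>a. a \<in> A i \<Longrightarrow> sum (\<Psi> a) (G i a) / card (G i a) \<le> \<Psi> a (\<rho>i a)" by metis
  define F' where "F' y x = (\<Sum>a\<in>A i. F (y(i := a)) (x(i := \<rho>i a)))" for y x
  have "\<exists>\<rho>. (\<Sum>y\<in>PiE J A. E (F' y) y) \<le> (\<Sum>y\<in>PiE J A. F' y (\<lambda>j\<in>J. \<rho> j (y j)))"
    unfolding E_def by (rule insert.IH) (use insert.prems in \<open>auto simp: F'_def intro!: sum_nonneg\<close>)
  then obtain \<rho> where \<rho>: "(\<Sum>y\<in>PiE J A. E (F' y) y) \<le> (\<Sum>y\<in>PiE J A. F' y (\<lambda>j\<in>J. \<rho> j (y j)))" ..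
  have "(\<Sum>y\<in>PiE (insert i J) A. sum (F y) (PiE (insert i J) (\<lambda>j. G j (y j))) / card (PiE (insert i J) (\<lambda>j. G j (y j))))
      = (\<Sum>a\<in>A i. \<Sum>y\<in>PiE J A. sum (F (y(i := a))) (PiE (insert i J) (\<lambda>j. G j ((y(i := a)) j))) / card (PiE (insert i J) (\<lambda>j. G j ((y(i := a)) j))))"
    using insert.prems by (subst split) auto
  also have "\<dots> = (\<Sum>a\<in>A i. \<Sum>y\<in>PiE J A. (\<Sum>b\<in>G i a. E (\<lambda>x. F (y(i := a)) (x(i := b))) y) / card (G i a))"
  proof (intro sum.cong refl)
    fix a y assume "a \<in> A i" "y \<in> PiE J A"
    have e: "PiE J (\<lambda>j. G j (if j = i then a else y j)) = PiE J (\<lambda>j. G j (y j))"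
      using insert.hyps by (intro PiE_cong) auto
    have "sum (F (y(i := a))) (PiE (insert i J) (\<lambda>j. G j ((y(i := a)) j))) =
      (\<Sum>b\<in>G i a. \<Sum>x\<in>PiE J (\<lambda>j. G j (y j)). F (y(i := a)) (x(i := b)))"
      using insert.prems by (subst split) (auto simp: e)
    moreover have "card (PiE (insert i J) (\<lambda>j. G j ((y(i := a)) j))) = card (G i a) * card (PiE J (\<lambda>j. G j (y j)))"
    proof -
      have "(\<Prod>j\<in>J. card (G j ((y(i := a)) j))) = (\<Prod>j\<in>J. card (G j (y j)))"
        using insert.hyps by (intro prod.cong) auto
      thus ?thesis using insert.hyps insert.prems by (simp add: card_PiE)
    qed
    ultimately show "sum (F (y(i := a))) (PiE (insert i J) (\<lambda>j. G j ((y(i := a)) j))) / card (PiE (insert i J) (\<lambda>j. G j ((y(i := a)) j)))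
      = (\<Sum>b\<in>G i a. E (\<lambda>x. F (y(i := a)) (x(i := b))) y) / card (G i a)"
      by (simp add: E_def mult.commute flip: sum_divide_distrib)
  qed
  also have "\<dots> = (\<Sum>a\<in>A i. sum (\<Psi> a) (G i a) / card (G i a))"
    unfolding \<Psi>_def by (intro sum.cong refl, subst sum.swap) (simp add: sum_divide_distrib)
  also have "\<dots> \<le> (\<Sum>a\<in>A i. \<Psi> a (\<rho>i a))" by (intro sum_mono \<rho>i)
  also have "\<dots> = (\<Sum>y\<in>PiE J A. \<Sum>a\<in>A i. E (\<lambda>x. F (y(i := a)) (x(i := \<rho>i a))) y)"
    unfolding \<Psi>_def by (rule sum.swap)
  also have "\<dots> = (\<Sum>y\<in>PiE J A. E (F' y) y)"
    unfolding E_def F'_def by (intro sum.cong refl, subst sum.swap) (simp add: sum_divide_distrib)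
  also note \<rho>
  also have "(\<Sum>y\<in>PiE J A. F' y (\<lambda>j\<in>J. \<rho> j (y j))) =
     (\<Sum>a\<in>A i. \<Sum>y\<in>PiE J A. F (y(i := a)) ((\<lambda>j\<in>J. \<rho> j (y j))(i := \<rho>i a)))"
    unfolding F'_def by (rule sum.swap)
  also have "\<dots> = (\<Sum>y\<in>PiE (insert i J) A. F y (\<lambda>j\<in>insert i J. (\<rho>(i := \<rho>i)) j (y j)))"
  proof (subst split)
    show "(\<Sum>a\<in>A i. \<Sum>y\<in>PiE J A. F (y(i := a)) ((\<lambda>j\<in>J. \<rho> j (y j))(i := \<rho>i a))) =
      (\<Sum>b\<in>A i. \<Sum>x\<in>PiE J A. F (x(i := b)) (\<lambda>j\<in>insert i J. (\<rho>(i := \<rho>i)) j ((x(i := b)) j)))"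
      by (intro sum.cong refl arg_cong2[of _ _ _ _ F] ext) (use insert.hyps in auto)
  qed (use insert.prems in auto)
  finally show ?case by blast
qed

text \<open>Conditional expectation given \<kappa>: averaging over the fibres does not change the
  total.\<close>

lemma sum_fibre_average:
  fixes F :: "'x \<Rightarrow> real"
  assumes "finite A"
  shows "(\<Sum>x\<in>A. F x) = (\<Sum>x\<in>A. sum F {x'\<in>A. \<kappa> x' = \<kappa> x} / card {x'\<in>A. \<kappa> x' = \<kappa> x})"
proof -
  have "(\<Sum>x\<in>A. sum F {x'\<in>A. \<kappa> x' = \<kappa> x} / card {x'\<in>A. \<kappa> x' = \<kappa> x}) =
     (\<Sum>v\<in>\<kappa> ` A. \<Sum>x\<in>{x\<in>A. \<kappa> x = v}. sum F {x'\<in>A. \<kappa> x' = \<kappa> x} / card {x'\<in>A. \<kappa> x' = \<kappa> x})"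
    using assms by (rule sum.image_gen)
  also have "\<dots> = (\<Sum>v\<in>\<kappa> ` A. \<Sum>x\<in>{x\<in>A. \<kappa> x = v}. sum F {x'\<in>A. \<kappa> x' = v} / card {x'\<in>A. \<kappa> x' = v})"
    by (intro sum.cong refl) auto
  also have "\<dots> = (\<Sum>v\<in>\<kappa> ` A. sum F {x'\<in>A. \<kappa> x' = v})"
  proof (rule sum.cong[OF refl])
    fix v assume "v \<in> \<kappa> ` A"
    hence "card {x\<in>A. \<kappa> x = v} > 0" using assms by (auto simp: card_gt_0_iff)
    thus "(\<Sum>x\<in>{x\<in>A. \<kappa> x = v}. sum F {x'\<in>A. \<kappa> x' = v} / card {x'\<in>A. \<kappa> x' = v}) = sum F {x'\<in>A. \<kappa> x' = v}"
      by simp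
  qed
  also have "\<dots> = (\<Sum>x\<in>A. F x)" using assms by (rule sum.image_gen[symmetric])
  finally show ?thesis ..
qed

section \<open>Pointer jumping on trees\<close>

text \<open>
  Tree pointer jumping on the complete \<open>t\<close>-ary tree of depth \<open>k\<close>: an input \<open>X\<close> assigns to a vertex
  \<open>w\<close> of depth \<open>j < k\<close> a child \<open>X j w\<close>, and to a leaf a bit.
\<close>

definition addr :: "nat \<Rightarrow> nat \<Rightarrow> nat list set" where
  "addr t j = {w. length w = j \<and> set w \<subseteq> {..<t}}"

definition level_data :: "nat \<Rightarrow> nat \<Rightarrow> nat \<Rightarrow> (nat list \<Rightarrow> nat) set" where
  "level_data t k j = PiE (addr t j) (\<lambda>_. if j = k then {..<2} else {..<t})"

definition tree_inputs :: "nat \<Rightarrow> nat \<Rightarrow> (nat \<Rightarrow> nat list \<Rightarrow> nat) set" where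
  "tree_inputs t k = PiE {..k} (level_data t k)"

definition subdata :: "nat \<Rightarrow> (nat list \<Rightarrow> nat) \<Rightarrow> nat list \<Rightarrow> nat" where
  "subdata r d = (\<lambda>w. d (r # w))"

fun leaf_bit :: "nat \<Rightarrow> (nat \<Rightarrow> nat list \<Rightarrow> nat) \<Rightarrow> nat" where
  "leaf_bit 0 X = X 0 []"
| "leaf_bit (Suc k) X = leaf_bit k (\<lambda>j\<in>{..k}. subdata (X 0 []) (X (Suc j)))"

text \<open>In each pass the levels speak from the leaves to the root.\<close>

definition one_pass :: "(nat \<Rightarrow> 's \<Rightarrow> 'd \<Rightarrow> 's) \<Rightarrow> nat \<Rightarrow> (nat \<Rightarrow> 'd) \<Rightarrow> 's \<Rightarrow> 's" where
  "one_pass v k X s = foldr (\<lambda>j s. v j s (X j)) [0..<Suc k] s"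

fun run_passes :: "(nat \<Rightarrow> nat \<Rightarrow> 's \<Rightarrow> 'd \<Rightarrow> 's) \<Rightarrow> nat \<Rightarrow> (nat \<Rightarrow> 'd) \<Rightarrow> nat \<Rightarrow> 's \<Rightarrow> 's" where
  "run_passes u k X 0 s = s"
| "run_passes u k X (Suc p) s = run_passes (\<lambda>i. u (Suc i)) k X p (one_pass (u 0) k X s)"

lemma finite_addr [simp]: "finite (addr t j)"
proof -
  have "addr t j = {w. set w \<subseteq> {..<t} \<and> length w = j}" by (auto simp: addr_def)
  thus ?thesis using finite_lists_length_eq[of "{..<t}" j] by simp
qed

lemma finite_level_data [simp]: "finite (level_data t k j)"
  unfolding level_data_def by (intro finite_PiE) auto

lemma finite_tree_inputs [simp]: "finite (tree_inputs t k)"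
  unfolding tree_inputs_def by (intro finite_PiE) auto

lemma tree_inputs_nonempty: "t > 0 \<Longrightarrow> tree_inputs t k \<noteq> {}"
  unfolding tree_inputs_def level_data_def by (auto simp: PiE_eq_empty_iff lessThan_empty_iff)

lemma Cons_in_addr: "r # w \<in> addr t (Suc j) \<longleftrightarrow> r < t \<and> w \<in> addr t j"
  by (auto simp: addr_def)

lemma one_pass_closed:
  assumes "\<And>j s d. s \<in> S \<Longrightarrow> v j s d \<in> S" "s \<in> S"
  shows "foldr (\<lambda>j s. v j s (X j)) js s \<in> S"
  using assms(2) by (induction js) (auto intro: assms(1))

lemma one_pass_Suc:
  "one_pass v (Suc k) X s = v 0 (foldr (\<lambda>j s. v (Suc j) s (X (Suc j))) [0..<Suc k] s) (X 0)"
proof -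
  have "[0..<Suc (Suc k)] = 0 # map Suc [0..<Suc k]"
    by (simp only: map_Suc_upt upt_conv_Cons[of 0 "Suc (Suc k)"])
  thus ?thesis unfolding one_pass_def by (simp only: foldr.simps foldr_map o_def)
qed

section \<open>Splitting a tree into its root and \<open>t\<close> independent subtrees\<close>

definition root_data :: "nat \<Rightarrow> nat list \<Rightarrow> nat" where
  "root_data r = (\<lambda>w. if w = [] then r else undefined)"

definition glue :: "nat \<Rightarrow> (nat \<Rightarrow> nat list \<Rightarrow> nat) \<Rightarrow> nat \<Rightarrow> nat list \<Rightarrow> nat" where
  "glue r x j = (case j of 0 \<Rightarrow> root_data r | Suc i \<Rightarrow> x i)"

text \<open>Index \<open>j\<close> holds level \<open>Suc j\<close>, still addressed from the root
  of the whole tree.\<close>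

definition lower_inputs :: "nat \<Rightarrow> nat \<Rightarrow> (nat \<Rightarrow> nat list \<Rightarrow> nat) set" where
  "lower_inputs t k = PiE {..k} (\<lambda>j. level_data t (Suc k) (Suc j))"

definition subtree :: "nat \<Rightarrow> nat \<Rightarrow> (nat \<Rightarrow> nat list \<Rightarrow> nat) \<Rightarrow> nat \<Rightarrow> nat list \<Rightarrow> nat" where
  "subtree k r x = (\<lambda>j\<in>{..k}. subdata r (x j))"

lemma finite_lower_inputs [simp]: "finite (lower_inputs t k)"
  unfolding lower_inputs_def by (intro finite_PiE) auto

lemma leaf_bit_glue: "leaf_bit (Suc k) (glue r x) = leaf_bit k (subtree k r x)"
  by (simp add: glue_def root_data_def subtree_def)

lemma addr_0: "addr t 0 = {[]}" by (auto simp: addr_def)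

lemma sum_tree_inputs_Suc:
  fixes F :: "_ \<Rightarrow> real"
  shows "sum F (tree_inputs t (Suc k)) = (\<Sum>r<t. \<Sum>x\<in>lower_inputs t k. F (glue r x))"
proof -
  have "sum F (tree_inputs t (Suc k)) = (\<Sum>(r,x)\<in>{..<t} \<times> lower_inputs t k. F (glue r x))"
  proof (rule sum.reindex_bij_witness[where j = "\<lambda>X. (X 0 [], \<lambda>j. X (Suc j))" and i = "\<lambda>(r,x). glue r x"], goal_cases)
    case (1 X)
    have "X 0 \<in> level_data t (Suc k) 0" using 1 by (auto simp: tree_inputs_def)
    hence "root_data (X 0 []) = X 0"
      by (auto simp: level_data_def addr_0 root_data_def PiE_def extensional_def)
    thus ?case by (auto simp: glue_def split: nat.splits)
  next
    case (2 X)
    hence "X 0 [] < t" by (auto simp: tree_inputs_def level_data_def addr_0 PiE_def Pi_def)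
    moreover have "(\<lambda>j. X (Suc j)) \<in> lower_inputs t k"
      using 2 by (auto simp: tree_inputs_def lower_inputs_def PiE_def Pi_def extensional_def)
    ultimately show ?case by simp
  next
    case (3 b) thus ?case by (auto simp: glue_def root_data_def)
  next
    case (4 b)
    then obtain r x where b: "b = (r, x)" "r < t" "x \<in> lower_inputs t k" by auto
    have "glue r x \<in> tree_inputs t (Suc k)"
      unfolding tree_inputs_def
    proof (rule PiE_I)
      fix j assume j: "j \<in> {..Suc k}"
      show "glue r x j \<in> level_data t (Suc k) j"
      proof (cases j)
        case 0
        thus ?thesis using b by (auto simp: glue_def root_data_def level_data_def addr_0 PiE_iff extensional_def)
      next
        case (Suc i)
        thus ?thesis using b j by (auto simp: glue_def lower_inputs_def)
      qed
    next
      fix j assume "j \<notin> {..Suc k}"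
      thus "glue r x j = undefined"
        using b by (cases j) (auto simp: glue_def lower_inputs_def PiE_def extensional_def)
    qed
    thus ?case using b by simp
  next
    case (5 X)
    have "X 0 \<in> level_data t (Suc k) 0" using 5 by (auto simp: tree_inputs_def)
    hence "root_data (X 0 []) = X 0"
      by (auto simp: level_data_def addr_0 root_data_def PiE_def extensional_def)
    hence "glue (X 0 []) (\<lambda>j. X (Suc j)) = X" by (auto simp: glue_def split: nat.splits)
    thus ?case by simp
  qed
  thus ?thesis by (simp add: sum.cartesian_product)
qed

text \<open>The independence needed for \<open>message_advantage_le\<close>: a uniform choice of the
  lower levels is a choice of \<open>t\<close> independent uniform inputs for the subtrees.\<close>

lemma bij_subtrees:
  "bij_betw (\<lambda>x. \<lambda>r\<in>{..<t}. subtree k r x) (lower_inputs t k) (PiE {..<t} (\<lambda>_. tree_inputs t k))"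
proof (rule bij_betwI[where g = "\<lambda>ys. \<lambda>j\<in>{..k}. \<lambda>w. if w \<in> addr t (Suc j) then ys (hd w) j (tl w) else undefined"])
  show "(\<lambda>x. \<lambda>r\<in>{..<t}. subtree k r x) \<in> lower_inputs t k \<rightarrow> PiE {..<t} (\<lambda>_. tree_inputs t k)"
    by (auto simp: lower_inputs_def tree_inputs_def subtree_def level_data_def subdata_def PiE_iff
          extensional_def Cons_in_addr)
  show "(\<lambda>ys. \<lambda>j\<in>{..k}. \<lambda>w. if w \<in> addr t (Suc j) then ys (hd w) j (tl w) else undefined)
          \<in> PiE {..<t} (\<lambda>_. tree_inputs t k) \<rightarrow> lower_inputs t k"
  proof (rule funcsetI)
    fix ys assume ys: "ys \<in> PiE {..<t} (\<lambda>_. tree_inputs t k)"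
    have "ys (hd w) j (tl w) \<in> (if j = k then {..<2} else {..<t})" if wj: "w \<in> addr t (Suc j)" "j \<le> k" for w j
    proof -
      obtain r v where w: "w = r # v" using wj by (cases w) (auto simp: addr_def)
      hence "r < t" "v \<in> addr t j" using wj by (auto simp: Cons_in_addr)
      moreover have "ys r \<in> tree_inputs t k" using ys \<open>r < t\<close> by auto
      hence "ys r j \<in> level_data t k j" using wj by (auto simp: tree_inputs_def)
      ultimately show ?thesis using w by (auto simp: level_data_def PiE_iff)
    qed
    thus "(\<lambda>j\<in>{..k}. \<lambda>w. if w \<in> addr t (Suc j) then ys (hd w) j (tl w) else undefined) \<in> lower_inputs t k"
      by (force simp: lower_inputs_def level_data_def PiE_iff extensional_def)
  qed
next
  fix x assume x: "x \<in> lower_inputs t k"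
  show "(\<lambda>j\<in>{..k}. \<lambda>w. if w \<in> addr t (Suc j) then (\<lambda>r\<in>{..<t}. subtree k r x) (hd w) j (tl w) else undefined) = x"
  proof (intro ext)
    fix j w
    show "(\<lambda>j\<in>{..k}. \<lambda>w. if w \<in> addr t (Suc j) then (\<lambda>r\<in>{..<t}. subtree k r x) (hd w) j (tl w) else undefined) j w = x j w"
    proof (cases "j \<le> k")
      case True
      hence "x j \<in> level_data t (Suc k) (Suc j)" using x by (auto simp: lower_inputs_def)
      hence "w \<notin> addr t (Suc j) \<Longrightarrow> x j w = undefined" by (auto simp: level_data_def PiE_def extensional_def)
      moreover have "(\<lambda>r\<in>{..<t}. subtree k r x) (hd w) j (tl w) = x j w" if "w \<in> addr t (Suc j)"
        using that True by (cases w) (auto simp: addr_def subtree_def subdata_def)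
      ultimately show ?thesis using True by auto
    next
      case False
      thus ?thesis using x by (auto simp: lower_inputs_def PiE_def extensional_def)
    qed
  qed
next
  fix ys assume ys: "ys \<in> PiE {..<t} (\<lambda>_. tree_inputs t k)"
  show "(\<lambda>r\<in>{..<t}. subtree k r (\<lambda>j\<in>{..k}. \<lambda>w. if w \<in> addr t (Suc j) then ys (hd w) j (tl w) else undefined)) = ys"
  proof (intro ext)
    fix r j w
    show "(\<lambda>r\<in>{..<t}. subtree k r (\<lambda>j\<in>{..k}. \<lambda>w. if w \<in> addr t (Suc j) then ys (hd w) j (tl w) else undefined)) r j w = ys r j w"
    proof (cases "r < t")
      case True
      hence y: "ys r \<in> tree_inputs t k" using ys by auto
      show ?thesis
      proof (cases "j \<le> k")
        case jk: True
        hence "ys r j \<in> level_data t k j" using y by (auto simp: tree_inputs_def)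
        thus ?thesis using True jk by (auto simp: subtree_def subdata_def Cons_in_addr level_data_def PiE_def extensional_def)
      next
        case False
        thus ?thesis using True y by (auto simp: subtree_def tree_inputs_def PiE_def extensional_def)
      qed
    next
      case False
      thus ?thesis using ys by (auto simp: PiE_def extensional_def)
    qed
  qed
qed

text \<open>Entry \<open>j\<close> is the message that level \<open>Suc j\<close> sends in a pass starting in memory state \<open>s\<close>.\<close>

definition first_messages :: "(nat \<Rightarrow> 's \<Rightarrow> 'd \<Rightarrow> 's) \<Rightarrow> nat \<Rightarrow> 's \<Rightarrow> (nat \<Rightarrow> 'd) \<Rightarrow> nat \<Rightarrow> 's" where
  "first_messages v k s x = (\<lambda>j\<in>{..k}. foldr (\<lambda>i s. v (Suc i) s (x i)) [j..<Suc k] s)"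

text \<open>Once the whole vector of messages is fixed, each level imposes a condition on its own
  data alone. Hence the inputs that lead to given messages form a product set, and conditioning on
  the messages keeps the levels independent.\<close>

lemma first_messages_eq_iff:
  assumes "m \<in> extensional {..k}"
  shows "first_messages v k s x = m \<longleftrightarrow>
           (\<forall>j\<le>k. m j = v (Suc j) (if j = k then s else m (Suc j)) (x j))"
proof
  assume m: "first_messages v k s x = m"
  show "\<forall>j\<le>k. m j = v (Suc j) (if j = k then s else m (Suc j)) (x j)"
  proof (intro allI impI)
    fix j assume j: "j \<le> k"
    have "[j..<Suc k] = j # [Suc j..<Suc k]" using j by (simp add: upt_conv_Cons del: upt_Suc)
    thus "m j = v (Suc j) (if j = k then s else m (Suc j)) (x j)"
      using j unfolding m[symmetric] first_messages_def by (auto simp del: upt_Suc)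
  qed
next
  assume m: "\<forall>j\<le>k. m j = v (Suc j) (if j = k then s else m (Suc j)) (x j)"
  have "foldr (\<lambda>i s. v (Suc i) s (x i)) [j..<Suc k] s = m j" if "j \<le> k" for j
    using that
  proof (induction j rule: inc_induct)
    case base
    show ?case using m[rule_format, of k] by simp
  next
    case (step j)
    have "[j..<Suc k] = j # [Suc j..<Suc k]" using step.hyps by (simp add: upt_conv_Cons del: upt_Suc)
    thus ?case using step m[rule_format, of j] by (simp del: upt_Suc)
  qed
  thus "first_messages v k s x = m"
    using assms by (auto simp: first_messages_def extensional_def fun_eq_iff simp del: upt_Suc)
qed

text \<open>With the root pointer \<open>r\<close> known and every level extending its part of
  subtree \<open>r\<close> to the full level by a private rule \<open>\<rho> j\<close>, the
  remaining passes are a protocol for the smaller tree: its root also speaks for the old root, whose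
  data are now constant.\<close>

lemma run_passes_eliminate:
  fixes u :: "nat \<Rightarrow> nat \<Rightarrow> 's \<Rightarrow> (nat list \<Rightarrow> nat) \<Rightarrow> 's"
  defines "v \<equiv> \<lambda>\<rho> r i j s d. (let s' = u i (Suc j) s (\<rho> j d) in if j = 0 then u i 0 s' (root_data r) else s')"
  shows "run_passes (v \<rho> r) k y p s = run_passes u (Suc k) (glue r (\<lambda>j\<in>{..k}. \<rho> j (y j))) p s"
  unfolding v_def
proof (induction p arbitrary: u s)
  case (Suc p)
  have eq: "one_pass (\<lambda>j s d. let s' = u 0 (Suc j) s (\<rho> j d) in if j = 0 then u 0 0 s' (root_data r) else s') k y s
      = one_pass (u 0) (Suc k) (glue r (\<lambda>j\<in>{..k}. \<rho> j (y j))) s"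
  proof -
    have c: "[0..<Suc k] = 0 # [1..<Suc k]" by (simp add: upt_conv_Cons del: upt_Suc)
    have f: "foldr (\<lambda>j s. let s' = u 0 (Suc j) s (\<rho> j (y j)) in if j = 0 then u 0 0 s' (root_data r) else s') [1..<Suc k] s
      = foldr (\<lambda>j s. u 0 (Suc j) s (glue r (\<lambda>j\<in>{..k}. \<rho> j (y j)) (Suc j))) [1..<Suc k] s"
      by (intro foldr_cong) (auto simp: glue_def)
    show ?thesis
      unfolding one_pass_Suc unfolding one_pass_def c foldr.simps o_def f by (simp add: glue_def Let_def)
  qed
  show ?case unfolding run_passes.simps eq by (rule Suc.IH[of "\<lambda>i. u (Suc i)"])
qed simp

text \<open>Induction on \<open>k\<close>, which is both the depth and the number of passes. For
  fixed messages of the first pass and a fixed root pointer, the success averaged over the subtree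
  obeys the induction hypothesis; what the true messages gain over fixed ones is paid for by
  \<open>message_advantage_le\<close>, where \<open>card M = card S ^ Suc k\<close>.\<close>

theorem pointer_jumping_bound:
  fixes u :: "nat \<Rightarrow> nat \<Rightarrow> 's \<Rightarrow> (nat list \<Rightarrow> nat) \<Rightarrow> 's" and out :: "'s \<Rightarrow> nat"
  assumes "finite S" "t > 0" "s0 \<in> S" "\<And>i j s d. s \<in> S \<Longrightarrow> u i j s d \<in> S"
  shows "(\<Sum>X\<in>tree_inputs t k. of_bool (out (run_passes u k X k s0) = leaf_bit k X))
           \<le> card (tree_inputs t k) * (1 / 2 + (\<Sum>i=1..k. sqrt (real i * ln (card S) / (2 * real t))))"
  using assms(3,4)
proof (induction k arbitrary: u s0)
  case 0
  define c where "c b = (\<lambda>j\<in>{0::nat}. \<lambda>w\<in>{[]::nat list}. b)" for b :: nat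
  have c0: "c b 0 [] = b" for b by (simp add: c_def)
  have T0: "tree_inputs t 0 = PiE {0} (\<lambda>_. PiE {[]} (\<lambda>_. {..<2}))"
  proof -
    have e: "{..0::nat} = {0}" by auto
    show ?thesis unfolding tree_inputs_def e by (rule PiE_cong) (auto simp: level_data_def addr_0)
  qed
  have c_in: "c b \<in> tree_inputs t 0" if "b < 2" for b
    unfolding T0 c_def using that by (intro restrict_PiE_iff[THEN iffD2] ballI) auto
  have c_inv: "c (X 0 []) = X \<and> X 0 [] < 2" if "X \<in> tree_inputs t 0" for X
  proof -
    have X: "X \<in> extensional {0}" "X 0 \<in> extensional {[]}" "X 0 [] < 2"
      using that unfolding T0 PiE_iff by auto
    have "c (X 0 []) j w = X j w" for j w
      using X(1,2) by (cases "j = 0"; cases "w = []") (simp_all add: c_def extensional_def)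
    thus ?thesis using X(3) by blast
  qed
  have bij: "bij_betw c {..<2} (tree_inputs t 0)"
    by (rule bij_betwI[where g = "\<lambda>X. X 0 []"]) (use c_in c_inv c0 in auto)
  \<comment> \<open>No pass is made, so the output is constant and agrees with the bit for at most
    one of its two values.\<close>
  have "(\<Sum>X\<in>tree_inputs t 0. of_bool (out (run_passes u 0 X 0 s0) = leaf_bit 0 X)) =
          (\<Sum>b\<in>{..<2}. of_bool (out s0 = b) :: real)"
    by (subst sum.reindex_bij_betw[OF bij, symmetric]) (simp add: c0)
  also have "{..<2::nat} = {0, 1}" by auto
  also have "(\<Sum>b\<in>{0, 1}. of_bool (out s0 = b) :: real) = of_bool (out s0 = 0) + of_bool (out s0 = 1)"
    by (subst sum.insert) auto
  also have "\<dots> \<le> 1" by auto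
  finally show ?case using bij_betw_same_card[OF bij] by simp
next
  case (Suc k)
  define K where "K = Suc k"
  define XS where "XS = lower_inputs t k"
  define Y where "Y = tree_inputs t k"
  define M where "M = PiE {..k} (\<lambda>_. S)"
  define mm where "mm = first_messages (u 0) k s0"
  define u' where "u' = (\<lambda>i. u (Suc i))"
  \<comment> \<open>Success when the first pass leaves messages \<open>m\<close>, the lower levels
    are \<open>x\<close> and the bit sought is that of \<open>y\<close>; keeping the three apart
    allows combinations that no actual run produces.\<close>
  define A where "A r m x y = (of_bool (out (run_passes u' K (glue r x) k (u 0 0 (m 0) (root_data r))) = leaf_bit k y) :: real)" for r and m :: "nat \<Rightarrow> 's" and x y
  define G where "G r m j e = {d \<in> level_data t K (Suc j). subdata r d = e \<and>
      m j = u 0 (Suc j) (if j = k then s0 else m (Suc j)) d}" for r m j e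
  \<comment> \<open>Success probability conditioned on the messages and on subtree \<open>r\<close>,
    the other subtrees being resampled. The factors \<open>G r m j\<close> are local to a level, so
    each player can do its resampling privately.\<close>
  define h where "h r m y = (\<Sum>x\<in>PiE {..k} (\<lambda>j. G r m j (y j)). A r m x y) / card (PiE {..k} (\<lambda>j. G r m j (y j)))" for r m y
  define B where "B = 1 / 2 + (\<Sum>i=1..k. sqrt (real i * ln (card S) / (2 * real t)))"
  have Y: "finite Y" "Y \<noteq> {}" using assms(2) tree_inputs_nonempty by (auto simp: Y_def)
  have mmM: "mm x \<in> M" for x
    unfolding mm_def M_def first_messages_def
    using Suc.prems by (auto simp del: upt_Suc intro!: one_pass_closed[where S = S])
  have fib: "{x' \<in> XS. (mm x', subtree k r x') = (m, y)} = PiE {..k} (\<lambda>j. G r m j (y j))" if "m \<in> M" "y \<in> Y" for r m y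
  proof -
    have ext: "m \<in> extensional {..k}" "y \<in> extensional {..k}"
      using that by (auto simp: M_def Y_def tree_inputs_def PiE_def)
    have sub: "subtree k r x' = y \<longleftrightarrow> (\<forall>j\<le>k. subdata r (x' j) = y j)" for x'
      using ext(2) by (auto simp: subtree_def fun_eq_iff extensional_def)
    show ?thesis
      unfolding mm_def prod.inject first_messages_eq_iff[OF ext(1)] sub XS_def lower_inputs_def G_def K_def[symmetric]
      by (auto simp: PiE_iff K_def extensional_def)
  qed
  have sub_in: "subtree k r x \<in> Y" if "r < t" "x \<in> XS" for r x
    using bij_betw_apply[OF bij_subtrees, of x t k] that unfolding XS_def Y_def by (auto simp: PiE_iff)
  have h01: "0 \<le> h r m y \<and> h r m y \<le> 1" for r m y
  proof -
    have "(\<Sum>x\<in>PiE {..k} (\<lambda>j. G r m j (y j)). A r m x y) \<le> card (PiE {..k} (\<lambda>j. G r m j (y j))) * 1"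
      by (rule sum_bounded_above[where K = "1::real", unfolded mult_1_right, THEN order.trans]) (auto simp: A_def)
    moreover have "(\<Sum>x\<in>PiE {..k} (\<lambda>j. G r m j (y j)). A r m x y) \<ge> 0" by (intro sum_nonneg) (auto simp: A_def)
    ultimately show ?thesis unfolding h_def by (auto simp: divide_le_eq_1)
  qed
  \<comment> \<open>Private resampling can be replaced by fixed rules \<open>\<rho> j\<close>
    without loss, and then the induction hypothesis covers the remaining \<open>k\<close>
    passes.\<close>
  have hB: "(\<Sum>y\<in>Y. h r m y) \<le> card Y * B" if m: "m \<in> M" for r m
  proof -
    have "\<exists>\<rho>. (\<Sum>y\<in>PiE {..k} (level_data t k). h r m y) \<le> (\<Sum>y\<in>PiE {..k} (level_data t k). A r m (\<lambda>j\<in>{..k}. \<rho> j (y j)) y)"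
      unfolding h_def
      by (rule derandomise_product[of "{..k}" "level_data t k" "G r m" "\<lambda>y x. A r m x y"]) (auto simp: A_def G_def)
    then obtain \<rho> where \<rho>: "(\<Sum>y\<in>Y. h r m y) \<le> (\<Sum>y\<in>Y. A r m (\<lambda>j\<in>{..k}. \<rho> j (y j)) y)"
      unfolding Y_def tree_inputs_def by blast
    define v where "v i j s d = (let s' = u' i (Suc j) s (\<rho> j d) in if j = 0 then u' i 0 s' (root_data r) else s')" for i j s d
    have "m 0 \<in> S" using m by (auto simp: M_def)
    hence s1: "u 0 0 (m 0) (root_data r) \<in> S" using Suc.prems by auto
    have "(\<Sum>y\<in>Y. A r m (\<lambda>j\<in>{..k}. \<rho> j (y j)) y) =
       (\<Sum>y\<in>Y. of_bool (out (run_passes v k y k (u 0 0 (m 0) (root_data r))) = leaf_bit k y) :: real)"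
      unfolding A_def K_def v_def by (intro sum.cong refl, subst run_passes_eliminate) simp
    also have "\<dots> \<le> card Y * B"
      unfolding Y_def B_def by (rule Suc.IH[where u = v, OF s1]) (use Suc.prems in \<open>auto simp: v_def u'_def Let_def\<close>)
    finally show ?thesis using \<rho> by linarith
  qed
  have run: "run_passes u K (glue r x) K s0 = run_passes u' K (glue r x) k (u 0 0 (mm x 0) (root_data r))" for r x
    by (simp add: K_def one_pass_Suc u'_def mm_def first_messages_def glue_def del: upt_Suc)
  have "(\<Sum>X\<in>tree_inputs t K. of_bool (out (run_passes u K X K s0) = leaf_bit K X) :: real) =
        (\<Sum>r<t. \<Sum>x\<in>XS. of_bool (out (run_passes u K (glue r x) K s0) = leaf_bit k (subtree k r x)))"
    unfolding K_def sum_tree_inputs_Suc leaf_bit_glue XS_def ..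
  also have "\<dots> = (\<Sum>r<t. \<Sum>x\<in>XS. A r (mm x) x (subtree k r x))"
    unfolding A_def run ..
  also have "\<dots> = (\<Sum>r<t. \<Sum>x\<in>XS. h r (mm x) (subtree k r x))"
  proof (rule sum.cong[OF refl])
    fix r assume r: "r \<in> {..<t}"
    define \<kappa> where "\<kappa> x = (mm x, subtree k r x)" for x
    have "(\<Sum>x\<in>XS. A r (mm x) x (subtree k r x)) =
      (\<Sum>x\<in>XS. (\<Sum>x'\<in>{x'\<in>XS. \<kappa> x' = \<kappa> x}. A r (mm x') x' (subtree k r x')) / card {x'\<in>XS. \<kappa> x' = \<kappa> x})"
      by (rule sum_fibre_average) (simp add: XS_def)
    also have "\<dots> = (\<Sum>x\<in>XS. h r (mm x) (subtree k r x))"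
    proof (rule sum.cong[OF refl])
      fix x assume x: "x \<in> XS"
      have f: "{x'\<in>XS. \<kappa> x' = \<kappa> x} = PiE {..k} (\<lambda>j. G r (mm x) j (subtree k r x j))"
        unfolding \<kappa>_def using fib[OF mmM sub_in] r x by auto
      have "(\<Sum>x'\<in>{x'\<in>XS. \<kappa> x' = \<kappa> x}. A r (mm x') x' (subtree k r x')) =
            (\<Sum>x'\<in>{x'\<in>XS. \<kappa> x' = \<kappa> x}. A r (mm x) x' (subtree k r x))"
        by (intro sum.cong) (auto simp: \<kappa>_def)
      thus "(\<Sum>x'\<in>{x'\<in>XS. \<kappa> x' = \<kappa> x}. A r (mm x') x' (subtree k r x')) / card {x'\<in>XS. \<kappa> x' = \<kappa> x}
         = h r (mm x) (subtree k r x)"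
        unfolding f h_def by simp
    qed
    finally show "(\<Sum>x\<in>XS. A r (mm x) x (subtree k r x)) = (\<Sum>x\<in>XS. h r (mm x) (subtree k r x))" .
  qed
  also have "\<dots> = (\<Sum>x\<in>XS. \<Sum>r<t. h r (mm x) (subtree k r x))" by (rule sum.swap)
  also have "\<dots> = (\<Sum>x\<in>XS. \<Sum>r<t. h r (mm x) (subtree k r x) - sum (h r (mm x)) Y / card Y) +
     (\<Sum>x\<in>XS. \<Sum>r<t. sum (h r (mm x)) Y / card Y)"
    by (simp add: sum_subtractf)
  also have "(\<Sum>x\<in>XS. \<Sum>r<t. h r (mm x) (subtree k r x) - sum (h r (mm x)) Y / card Y)
     \<le> card XS * sqrt (t * ln (card M) / 2)"
  proof (rule message_advantage_le[OF Y assms(2)])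
    show "finite M" unfolding M_def using assms(1) by (intro finite_PiE) auto
    show "bij_betw (\<lambda>x. \<lambda>r\<in>{..<t}. subtree k r x) XS (PiE {..<t} (\<lambda>_. Y))"
      unfolding XS_def Y_def by (rule bij_subtrees)
  qed (use mmM h01 in auto)
  also have "(\<Sum>x\<in>XS. \<Sum>r<t. sum (h r (mm x)) Y / card Y) \<le> (\<Sum>x\<in>XS. \<Sum>r<t. B)"
    using hB[OF mmM] Y by (intro sum_mono) (auto simp: divide_le_eq mult.commute card_gt_0_iff)
  also have "(\<Sum>x\<in>XS. \<Sum>r<t. B) = card XS * t * B" by simp
  also have "card XS * sqrt (t * ln (card M) / 2) = card XS * t * sqrt (real K * ln (card S) / (2 * real t))"
  proof -
    have "card S > 0" using assms by (auto simp: card_gt_0_iff)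
    moreover have "card M = card S ^ K" by (simp add: M_def card_PiE K_def)
    ultimately have "ln (card M) = K * ln (card S)" by (simp only: of_nat_power) (simp add: ln_realpow)
    moreover have "sqrt (t * (K * ln (card S)) / 2) = t * sqrt (real K * ln (card S) / (2 * real t))"
    proof -
      have "t * (K * ln (card S)) / 2 = (real t)\<^sup>2 * (real K * ln (card S) / (2 * real t))"
        using assms(2) by (simp add: power2_eq_square)
      hence "sqrt (t * (K * ln (card S)) / 2) = sqrt ((real t)\<^sup>2) * sqrt (real K * ln (card S) / (2 * real t))"
        by (simp only: real_sqrt_mult)
      thus ?thesis by simp
    qed
    ultimately show ?thesis by simp
  qed
  finally have "(\<Sum>X\<in>tree_inputs t K. of_bool (out (run_passes u K X K s0) = leaf_bit K X))
     \<le> card XS * t * (B + sqrt (real K * ln (card S) / (2 * real t)))"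
    by (simp add: algebra_simps)
  also have "card XS * t = card (tree_inputs t K)"
    using sum_tree_inputs_Suc[of "\<lambda>_. 1" t k] by (simp add: XS_def K_def flip: of_nat_mult) 
  finally show ?case by (simp add: B_def K_def add_ac)
qed

section \<open>The set cover instances\<close>

lemma card_poly_roots_mod_prime_le:
  fixes a :: "nat \<Rightarrow> int"
  assumes "prime q" "\<not> int q dvd a d"
  shows "card {x. x < q \<and> int q dvd (\<Sum>i\<le>d. a i * int x ^ i)} \<le> d"
  using assms(2)
proof (induction d arbitrary: a)
  case (Suc d)
  let ?R = "{x. x < q \<and> int q dvd (\<Sum>i\<le>Suc d. a i * int x ^ i)}"
  show ?case
  proof (cases "?R = {}")
    case False
    then obtain z where z: "z < q" "int q dvd (\<Sum>i\<le>Suc d. a i * int z ^ i)" by blast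
    \<comment> \<open>Coefficients of the quotient by \<open>x - z\<close>; the leading one stays
      \<open>a (Suc d)\<close>.\<close>
    define b where "b j = (\<Sum>i=Suc j..Suc d. a i * int z ^ (i - j - 1))" for j
    have bd: "b d = a (Suc d)" by (simp add: b_def)
    have diff: "(\<Sum>i\<le>Suc d. a i * int x ^ i) - (\<Sum>i\<le>Suc d. a i * int z ^ i) =
        (int x - int z) * (\<Sum>j\<le>d. b j * int x ^ j)" for x
      using polyfun_diff[of "Suc d" a "int x" "int z"] by (simp only: b_def lessThan_Suc_atMost)
    have "?R \<subseteq> insert z {x. x < q \<and> int q dvd (\<Sum>j\<le>d. b j * int x ^ j)}"
    proof
      fix x assume x: "x \<in> ?R"
      hence "int q dvd (int x - int z) * (\<Sum>j\<le>d. b j * int x ^ j)"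
        using z(2) unfolding diff[symmetric] by (intro dvd_diff) auto
      hence "int q dvd int x - int z \<or> int q dvd (\<Sum>j\<le>d. b j * int x ^ j)"
        using assms(1) by (simp add: prime_dvd_mult_iff)
      moreover have "x = z" if "int q dvd int x - int z"
        using zdvd_imp_le[of "int q" "\<bar>int x - int z\<bar>"] that x z(1) by fastforce
      ultimately show "x \<in> insert z {x. x < q \<and> int q dvd (\<Sum>j\<le>d. b j * int x ^ j)}" using x by auto
    qed
    hence "card ?R \<le> card (insert z {x. x < q \<and> int q dvd (\<Sum>j\<le>d. b j * int x ^ j)})"
      by (intro card_mono) auto
    also have "\<dots> \<le> Suc (card {x. x < q \<and> int q dvd (\<Sum>j\<le>d. b j * int x ^ j)})"
      by (simp add: card_insert_if)
    also have "\<dots> \<le> Suc d" using Suc.IH[of b] Suc.prems bd by auto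
    finally show ?thesis .
  next
    case True
    show ?thesis unfolding True by simp
  qed
qed auto

lemma digits_neq:
  fixes q :: nat
  assumes "q > 0" "r < q ^ Suc d" "r' < q ^ Suc d" "r \<noteq> r'"
  shows "\<exists>i\<le>d. r div q ^ i mod q \<noteq> r' div q ^ i mod q"
  using assms(2-)
proof (induction d arbitrary: r r')
  case (Suc d)
  show ?case
  proof (cases "r mod q = r' mod q")
    case True
    hence "r div q \<noteq> r' div q" using Suc.prems(3) by (metis div_mod_decomp)
    moreover have "r div q < q ^ Suc d" "r' div q < q ^ Suc d"
      using Suc.prems assms(1) by (auto simp: div_less_iff_less_mult mult.commute)
    ultimately obtain i where "i \<le> d" "r div q div q ^ i mod q \<noteq> r' div q div q ^ i mod q"
      using Suc.IH by blast
    thus ?thesis by (intro exI[of _ "Suc i"]) (simp add: div_mult2_eq)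
  next
    case False
    thus ?thesis by (intro exI[of _ 0]) simp
  qed
qed auto

text \<open>The base \<open>q\<close> digits of \<open>r\<close> serve as the coefficients of a
  polynomial of degree at most \<open>d\<close>; distinct \<open>r\<close> below
  \<open>q ^ Suc d\<close> have distinct digits, and the difference of two such polynomials has at
  most \<open>d\<close> roots.\<close>

lemma exists_low_agreement_functions:
  assumes q: "prime q" and "t \<le> q ^ Suc d"
  shows "\<exists>f :: nat \<Rightarrow> nat \<Rightarrow> nat. (\<forall>r x. f r x < q) \<and>
    (\<forall>r<t. \<forall>r'<t. r \<noteq> r' \<longrightarrow> card {x. x < q \<and> f r x = f r' x} \<le> d)"
proof -
  define c where "c r i = r div q ^ i mod q" for r i
  define f where "f r x = (\<Sum>i\<le>d. c r i * x ^ i) mod q" for r x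
  have q0: "q > 0" using q prime_gt_0_nat by blast
  have "card {x. x < q \<and> f r x = f r' x} \<le> d" if r: "r < t" "r' < t" "r \<noteq> r'" for r r'
  proof -
    define a where "a i = int (c r i) - int (c r' i)" for i
    have a: "int q dvd a i \<longleftrightarrow> c r i = c r' i" for i
    proof
      assume "int q dvd a i"
      hence "int (c r i) mod int q = int (c r' i) mod int q" by (simp add: a_def mod_eq_dvd_iff)
      thus "c r i = c r' i" by (simp add: c_def zmod_int[symmetric])
    qed (simp add: a_def)
    obtain i where i: "i \<le> d" "c r i \<noteq> c r' i"
      using digits_neq[OF q0, of r d r'] r assms(2) by (auto simp: c_def)
    \<comment> \<open>The degree of the difference polynomial, so that its leading coefficient is
      nonzero modulo \<open>q\<close>.\<close>
    define e where "e = Max {i. i \<le> d \<and> c r i \<noteq> c r' i}"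
    have "e \<in> {i. i \<le> d \<and> c r i \<noteq> c r' i}" unfolding e_def by (rule Max_in) (use i in auto)
    hence e: "e \<le> d" "\<not> int q dvd a e" using a by auto
    have above: "c r i = c r' i" if "e < i" "i \<le> d" for i
      using Max_ge[of "{i. i \<le> d \<and> c r i \<noteq> c r' i}" i] that unfolding e_def[symmetric] by force
    have "{x. x < q \<and> f r x = f r' x} \<subseteq> {x. x < q \<and> int q dvd (\<Sum>i\<le>e. a i * int x ^ i)}"
    proof safe
      fix x assume "f r x = f r' x"
      hence "int (\<Sum>i\<le>d. c r i * x ^ i) mod int q = int (\<Sum>i\<le>d. c r' i * x ^ i) mod int q"
        by (simp only: f_def zmod_int[symmetric])
      hence "int q dvd int (\<Sum>i\<le>d. c r i * x ^ i) - int (\<Sum>i\<le>d. c r' i * x ^ i)"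
        by (simp add: mod_eq_dvd_iff)
      also have "int (\<Sum>i\<le>d. c r i * x ^ i) - int (\<Sum>i\<le>d. c r' i * x ^ i) = (\<Sum>i\<le>d. a i * int x ^ i)"
        by (simp add: a_def left_diff_distrib sum_subtractf)
      also have "\<dots> = (\<Sum>i\<le>e. a i * int x ^ i)"
        using e(1) above by (intro sum.mono_neutral_right) (auto simp: a_def)
      finally show "int q dvd (\<Sum>i\<le>e. a i * int x ^ i)" .
    qed
    hence "card {x. x < q \<and> f r x = f r' x} \<le> card {x. x < q \<and> int q dvd (\<Sum>i\<le>e. a i * int x ^ i)}"
      by (intro card_mono) auto
    also have "\<dots> \<le> e" using card_poly_roots_mod_prime_le[of q a e] q e(2) by blast
    finally show ?thesis using e(1) by simp
  qed
  thus ?thesis using q0 by (intro exI[of _ f]) (auto simp: f_def)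
qed

section \<open>The path followed by an input\<close>

primrec tree_path :: "(nat \<Rightarrow> nat list \<Rightarrow> nat) \<Rightarrow> nat \<Rightarrow> nat list" where
  "tree_path X 0 = []"
| "tree_path X (Suc j) = tree_path X j @ [X j (tree_path X j)]"

lemma length_tree_path [simp]: "length (tree_path X j) = j"
  by (induction j) auto

lemma take_tree_path: "i \<le> j \<Longrightarrow> take i (tree_path X j) = tree_path X i"
proof (induction j)
  case (Suc j)
  thus ?case by (cases "i = Suc j") auto
qed auto

lemma leaf_bit_tree_path: "leaf_bit k X = X k (tree_path X k)"
proof (induction k arbitrary: X)
  case (Suc k)
  define X' where "X' = (\<lambda>j\<in>{..k}. subdata (X 0 []) (X (Suc j)))"
  have "tree_path X (Suc j) = X 0 [] # tree_path X' j" if "j \<le> k" for j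
    using that
  proof (induction j)
    case (Suc j)
    hence IH: "tree_path X (Suc j) = X 0 [] # tree_path X' j" by simp
    have "tree_path X (Suc (Suc j)) = tree_path X (Suc j) @ [X (Suc j) (tree_path X (Suc j))]"
      by (simp only: tree_path.simps)
    also have "\<dots> = X 0 [] # tree_path X' (Suc j)"
      unfolding IH using Suc.prems by (simp add: X'_def subdata_def)
    finally show ?case .
  qed simp
  hence path: "tree_path X (Suc k) = X 0 [] # tree_path X' k" by blast
  have "X' k w = X (Suc k) (X 0 [] # w)" for w by (simp add: X'_def subdata_def)
  moreover have "leaf_bit (Suc k) X = leaf_bit k X'" by (simp add: X'_def)
  ultimately show ?case unfolding path Suc.IH by simp
qed simp

lemma tree_path_in_addr:
  assumes "X \<in> tree_inputs t k" "j \<le> k"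
  shows "tree_path X j \<in> addr t j"
  using assms(2)
proof (induction j)
  case (Suc j)
  hence "tree_path X j \<in> addr t j" "X j \<in> level_data t k j" using assms by (auto simp: tree_inputs_def)
  hence "X j (tree_path X j) < t" using Suc.prems by (auto simp: level_data_def PiE_iff)
  thus ?case using Suc by (auto simp: addr_def)
qed (simp add: addr_def)

lemma leaf_bit_less_2:
  assumes "X \<in> tree_inputs t k"
  shows "leaf_bit k X < 2"
proof -
  have "X k \<in> level_data t k k" using assms by (auto simp: tree_inputs_def)
  thus ?thesis using tree_path_in_addr[OF assms order.refl] unfolding leaf_bit_tree_path
    by (auto simp: level_data_def dest: PiE_mem)
qed

lemma card_addr: "card (addr t j) = t ^ j"
proof -
  have "addr t j = {w. set w \<subseteq> {..<t} \<and> length w = j}" by (auto simp: addr_def)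
  thus ?thesis by (simp add: card_lists_length_eq)
qed

text \<open>
  The points of the universe are the lists \<open>[x, y\<^sub>1, \<dots>, y\<^sub>p]\<close> over \<open>{..<q}\<close>, encoded as numbers by \<open>enc\<close>.
  A vertex \<open>w = [r\<^sub>1, \<dots>, r\<^sub>j]\<close> of the tree is represented by the variety
  \<open>y\<^sub>1 = f r\<^sub>1 x, \<dots>, y\<^sub>j = f r\<^sub>j x\<close>.  The remaining elements of the universe only serve to
  make the sets distinct: each set contains its own proper subset \<open>lab\<close> of them, except that
  the set of the root contains all of them.
\<close>

locale set_cover_reduction =
  fixes p q d t n :: nat and f :: "nat \<Rightarrow> nat \<Rightarrow> nat" and enc :: "nat list \<Rightarrow> nat"
    and lab :: "nat list + nat \<Rightarrow> nat set" and vs :: "nat \<Rightarrow> nat list list"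
  assumes p: "p \<ge> 1" and d: "d \<ge> 1" and t: "t \<ge> 1"
    and f_less: "f r x < q"
    and f_agree: "r < t \<Longrightarrow> r' < t \<Longrightarrow> r \<noteq> r' \<Longrightarrow> card {x. x < q \<and> f r x = f r' x} \<le> d"
    and enc: "bij_betw enc (addr q (Suc p)) {..<q ^ Suc p}"
    and qn: "q ^ Suc p \<le> n"
    and lab_inj: "inj_on lab (Inl ` (\<Union>j\<in>{1..p}. addr t j) \<union> Inr ` {..<q ^ Suc p})"
    and lab_sub: "i \<in> Inl ` (\<Union>j\<in>{1..p}. addr t j) \<union> Inr ` {..<q ^ Suc p} \<Longrightarrow> lab i \<subset> {q ^ Suc p..<n}"
    and vs: "distinct (vs j)" "set (vs j) = addr t j"
begin

definition region :: "nat list \<Rightarrow> nat list set" where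
  "region w = {pt \<in> addr q (Suc p). \<forall>i<length w. pt ! Suc i = f (w ! i) (pt ! 0)}"

definition core_set :: "nat \<Rightarrow> (nat list \<Rightarrow> nat) \<Rightarrow> nat list \<Rightarrow> nat list set" where
  "core_set j dt w = (if j < p then region w - region (w @ [dt w]) else if dt w = 1 then region w else {})"

definition full_lab :: "nat list + nat \<Rightarrow> nat set" where
  "full_lab i = (if i = Inl [] then {q ^ Suc p..<n} else lab i)"

fun cover_set :: "nat \<Rightarrow> (nat list \<Rightarrow> nat) \<Rightarrow> nat list + nat \<Rightarrow> nat set" where
  "cover_set j dt (Inl w) = enc ` core_set j dt w \<union> full_lab (Inl w)"
| "cover_set j dt (Inr u) = {u} \<union> full_lab (Inr u)"

text \<open>The singletons \<open>Inr u\<close> do not depend on the input. They keep every input a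
  legal instance, whatever the sets of the tree miss; handing them to the root keeps the stream a
  sequence of one block per level.\<close>

definition items :: "nat \<Rightarrow> (nat list + nat) list" where
  "items j = map Inl (vs j) @ (if j = 0 then map Inr [0..<q ^ Suc p] else [])"

definition all_items :: "(nat list + nat) list" where
  "all_items = concat (map items (rev [0..<Suc p]))"

definition stream :: "(nat \<Rightarrow> nat list \<Rightarrow> nat) \<Rightarrow> nat set list" where
  "stream X = concat (map (\<lambda>j. map (cover_set j (X j)) (items j)) (rev [0..<Suc p]))"

definition item_level :: "nat list + nat \<Rightarrow> nat" where
  "item_level i = (case i of Inl w \<Rightarrow> length w | Inr u \<Rightarrow> 0)"

definition item_set :: "(nat \<Rightarrow> nat list \<Rightarrow> nat) \<Rightarrow> nat list + nat \<Rightarrow> nat set" where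
  "item_set X i = cover_set (item_level i) (X (item_level i)) i"

lemma stream_eq: "stream X = map (item_set X) all_items"
proof -
  have "map (cover_set j (X j)) (items j) = map (item_set X) (items j)" for j
    using vs(2)[of j] by (auto simp: items_def item_set_def item_level_def addr_def)
  thus ?thesis by (simp only: stream_def all_items_def map_concat map_map o_def)
qed

lemma set_all_items: "set all_items = Inl ` (\<Union>j\<in>{0..p}. addr t j) \<union> Inr ` {..<q ^ Suc p}"
proof -
  have "set all_items = (\<Union>j\<in>{..<Suc p}. set (items j))"
    by (simp only: all_items_def set_concat set_map set_rev set_upt atLeast0LessThan image_image)
  also have "\<dots> = Inl ` (\<Union>j\<in>{..<Suc p}. addr t j) \<union> Inr ` {..<q ^ Suc p}"
    using vs(2) by (auto simp: items_def simp del: power_Suc)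
  finally show ?thesis by (simp only: lessThan_Suc_atMost atLeast0AtMost)
qed

lemma set_all_items': "set all_items = insert (Inl []) (Inl ` (\<Union>j\<in>{1..p}. addr t j) \<union> Inr ` {..<q ^ Suc p})"
proof -
  have "{0..p} = insert 0 {1..p}" by auto
  thus ?thesis unfolding set_all_items by (auto simp: addr_0 simp del: power_Suc)
qed

lemma Inl_Nil_notin: "Inl [] \<notin> Inl ` (\<Union>j\<in>{1..p}. addr t j) \<union> Inr ` {..<q ^ Suc p}"
  by (auto simp: addr_def)

lemma distinct_all_items: "distinct all_items"
proof -
  have "distinct (concat (map items js))" if "distinct js" for js
    using that
  proof (induction js)
    case (Cons j js)
    have "set (items j) \<inter> set (items j') = {}" if "j \<noteq> j'" for j'
      using vs(2) that by (auto simp: items_def addr_def simp del: power_Suc)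
    moreover have "distinct (items j)"
      using vs(1)[of j] by (auto simp: items_def distinct_map simp del: power_Suc)
    ultimately show ?case using Cons by (fastforce simp: set_concat)
  qed simp
  from this[of "rev [0..<Suc p]"] show ?thesis
    unfolding all_items_def by (simp only: distinct_rev distinct_upt)
qed

lemma length_all_items: "length all_items = (\<Sum>j\<le>p. t ^ j) + q ^ Suc p"
proof -
  have "length all_items = card (set all_items)" using distinct_all_items by (simp add: distinct_card)
  also have "\<dots> = card (Inl ` (\<Union>j\<in>{0..p}. addr t j) :: (nat list + nat) set) + card (Inr ` {..<q ^ Suc p} :: (nat list + nat) set)"
    unfolding set_all_items by (intro card_Un_disjoint) auto
  also have "\<dots> = card (\<Union>j\<in>{0..p}. addr t j) + q ^ Suc p" by (simp add: card_image del: power_Suc)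
  also have "card (\<Union>j\<in>{0..p}. addr t j) = (\<Sum>j\<in>{0..p}. card (addr t j))"
    by (intro card_UN_disjoint ballI impI finite_addr) (auto simp: addr_def)
  finally show ?thesis by (simp add: card_addr atLeast0AtMost)
qed

lemma full_lab_sub: "i \<in> set all_items \<Longrightarrow> full_lab i \<subseteq> {q ^ Suc p..<n}"
  using lab_sub[of i] unfolding set_all_items' full_lab_def by (auto simp del: power_Suc)

lemma full_lab_inj: "inj_on full_lab (set all_items)"
proof -
  let ?I = "Inl ` (\<Union>j\<in>{1..p}. addr t j) \<union> Inr ` {..<q ^ Suc p} :: (nat list + nat) set"
  have eq: "full_lab i = lab i" if "i \<in> ?I" for i
    using Inl_Nil_notin that unfolding full_lab_def by (metis (lifting))
  have "inj_on full_lab ?I" using lab_inj eq by (subst inj_on_cong[of _ full_lab lab]) auto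
  moreover have "full_lab (Inl []) \<notin> full_lab ` ?I"
  proof
    assume "full_lab (Inl []) \<in> full_lab ` ?I"
    then obtain i where i: "i \<in> ?I" "full_lab (Inl []) = full_lab i" by blast
    hence "{q ^ Suc p..<n} = lab i" using eq[OF i(1)] by (simp add: full_lab_def del: power_Suc)
    with lab_sub[OF i(1)] show False by blast
  qed
  moreover have "?I - {Inl []} = ?I" using Inl_Nil_notin by blast
  ultimately show ?thesis unfolding set_all_items' inj_on_insert by (simp only: simp_thms)
qed

lemma region_sub: "region w \<subseteq> addr q (Suc p)" by (auto simp: region_def)

lemma core_set_sub: "core_set j dt w \<subseteq> region w" by (auto simp: core_set_def)

lemma enc_less: "pt \<in> addr q (Suc p) \<Longrightarrow> enc pt < q ^ Suc p"
  using enc by (auto simp: bij_betw_def simp del: power_Suc)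

lemma enc_inj: "inj_on enc (addr q (Suc p))" using enc by (simp add: bij_betw_def)

text \<open>Encoded points stay below \<open>q ^ Suc p\<close>, so only the label is seen on the
  spare elements; with \<open>full_lab_inj\<close> this makes the sets of a stream pairwise
  distinct.\<close>

lemma item_set_lab:
  assumes "i \<in> set all_items"
  shows "item_set X i \<inter> {q ^ Suc p..<n} = full_lab i"
proof -
  have e: "enc pt < q ^ Suc p" if "pt \<in> core_set j dt w" for pt j dt w
    using that core_set_sub[of j dt w] region_sub[of w] enc_less by blast
  moreover have "u < q ^ Suc p" if "i = Inr u" for u using assms that unfolding set_all_items by auto
  ultimately show ?thesis using full_lab_sub[OF assms]
    by (cases i) (auto simp: item_set_def simp del: power_Suc dest!: e)
qed

lemma stream_in:
  assumes "X \<in> tree_inputs t p"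
  shows "stream X \<in> set_cover_streams n ((\<Sum>j\<le>p. t ^ j) + q ^ Suc p)"
proof -
  have "inj_on (item_set X) (set all_items)"
  proof (rule inj_onI)
    fix i i' assume "i \<in> set all_items" "i' \<in> set all_items" "item_set X i = item_set X i'"
    thus "i = i'" using item_set_lab full_lab_inj by (metis inj_onD)
  qed
  hence "distinct (stream X)" unfolding stream_eq using distinct_all_items by (simp add: distinct_map)
  moreover have "item_set X i \<subseteq> {..<n}" if "i \<in> set all_items" for i
  proof -
    have "enc ` core_set j dt w \<subseteq> {..<n}" for j dt w
      using core_set_sub[of j dt w] region_sub[of w] enc_less qn by (fastforce simp del: power_Suc)
    moreover have "u < n" if "i = Inr u" for u
      using \<open>i \<in> set all_items\<close> that qn unfolding set_all_items by (auto simp del: power_Suc)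
    ultimately show ?thesis using full_lab_sub[OF that]
      by (cases i) (auto simp: item_set_def simp del: power_Suc)
  qed
  moreover have "{..<n} \<subseteq> (\<Union>i\<in>set all_items. item_set X i)"
  proof
    fix u assume u: "u \<in> {..<n}"
    show "u \<in> (\<Union>i\<in>set all_items. item_set X i)"
    proof (cases "u < q ^ Suc p")
      case True
      hence "Inr u \<in> set all_items" unfolding set_all_items by blast
      moreover have "u \<in> item_set X (Inr u)" by (simp add: item_set_def)
      ultimately show ?thesis by blast
    next
      case False
      hence "u \<in> item_set X (Inl [])" using u by (simp add: item_set_def full_lab_def del: power_Suc)
      moreover have "Inl [] \<in> set all_items" unfolding set_all_items' by blast
      ultimately show ?thesis by blast
    qed
  qed
  ultimately show ?thesis
    unfolding set_cover_streams_def set_cover_instance_def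
    by (auto simp: stream_eq length_all_items simp del: power_Suc)
qed

text \<open>The sets along the path are successive differences of nested regions, closed by the full
  curve at the leaf, so they telescope to all points. The root set supplies the spare
  elements.\<close>

lemma opt_le:
  assumes X: "X \<in> tree_inputs t p" and bit: "leaf_bit p X = 1"
  shows "opt {..<n} (set (stream X)) \<le> Suc p"
proof -
  define v where "v j = tree_path X j" for j
  define G where "G = (\<lambda>j. item_set X (Inl (v j))) ` {..p}"
  have v_in: "Inl (v j) \<in> set all_items" if "j \<le> p" for j
  proof -
    have "v j \<in> (\<Union>j\<in>{0..p}. addr t j)"
      using tree_path_in_addr[OF X that] that unfolding v_def by auto
    thus ?thesis unfolding set_all_items by blast
  qed
  have sub: "G \<subseteq> set (stream X)" using v_in by (auto simp: G_def stream_eq)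
  have inst: "\<Union>(set (stream X)) = {..<n}"
    using stream_in[OF X] by (simp add: set_cover_streams_def set_cover_instance_def)
  have set_v: "item_set X (Inl (v j)) = enc ` core_set j (X j) (v j) \<union> full_lab (Inl (v j))" for j
    by (simp add: item_set_def item_level_def v_def)
  have covered: "pt \<in> region (v j) \<Longrightarrow> j \<le> p \<Longrightarrow> \<exists>i\<le>p. pt \<in> core_set i (X i) (v i)" for pt j
  proof (induction "p - j" arbitrary: j)
    case 0
    hence "j = p" by simp
    moreover have "core_set p (X p) (v p) = region (v p)"
      using bit unfolding leaf_bit_tree_path core_set_def v_def by simp
    ultimately show ?case using 0(2) by blast
  next
    case (Suc k)
    hence j: "j < p" by simp
    show ?case
    proof (cases "pt \<in> region (v (Suc j))")
      case True
      thus ?thesis using Suc j by (intro Suc(1)[of "Suc j"]) auto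
    next
      case False
      hence "pt \<in> core_set j (X j) (v j)" using Suc.prems j by (auto simp: core_set_def v_def)
      thus ?thesis using j by (intro exI[of _ j]) auto
    qed
  qed
  have "{..<n} \<subseteq> \<Union>G"
  proof
    fix u assume u: "u \<in> {..<n}"
    show "u \<in> \<Union>G"
    proof (cases "u < q ^ Suc p")
      case True
      then obtain pt where pt: "pt \<in> addr q (Suc p)" "u = enc pt"
        using enc by (auto simp: bij_betw_def simp del: power_Suc)
      hence "pt \<in> region (v 0)" by (simp add: region_def v_def)
      then obtain i where "i \<le> p" "pt \<in> core_set i (X i) (v i)" using covered[of pt 0] by auto
      thus ?thesis unfolding G_def pt(2) set_v by blast
    next
      case False
      hence "u \<in> item_set X (Inl (v 0))" using u by (simp add: item_set_def full_lab_def v_def del: power_Suc)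
      thus ?thesis by (auto simp: G_def)
    qed
  qed
  hence "set_cover {..<n} (set (stream X)) G" using sub inst by (auto simp: set_cover_def)
  hence "opt {..<n} (set (stream X)) \<le> card G" unfolding opt_def by (intro Least_le) blast
  also have "\<dots> \<le> card {..p}" unfolding G_def by (intro card_image_le) auto
  finally show ?thesis by simp
qed

lemma card_region_leaf:
  assumes "length z = p"
  shows "card (region z) = q"
proof -
  have "region z = (\<lambda>x. x # map (\<lambda>r. f r x) z) ` {..<q}"
  proof (intro equalityI subsetI)
    fix pt assume pt: "pt \<in> region z"
    then obtain x ys where x: "pt = x # ys" by (cases pt) (auto simp: region_def addr_def)
    have "ys = map (\<lambda>r. f r x) z"
      using pt assms by (intro nth_equalityI) (auto simp: region_def addr_def x)
    thus "pt \<in> (\<lambda>x. x # map (\<lambda>r. f r x) z) ` {..<q}" using pt x by (auto simp: region_def addr_def)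
  qed (use assms f_less in \<open>auto simp: region_def addr_def\<close>)
  thus ?thesis by (simp add: card_image inj_on_def)
qed

text \<open>At an index where \<open>w\<close> and \<open>z\<close> differ, a common point has the
  same value under two different functions; within the curve \<open>region z\<close> its first
  coordinate determines it.\<close>

lemma card_region_inter:
  assumes "w \<in> addr t j" "z \<in> addr t p" "j \<le> p" "w \<noteq> take j z"
  shows "card (region w \<inter> region z) \<le> d"
proof -
  have len: "length w = j" "length z = p" using assms by (auto simp: addr_def)
  obtain i where i: "i < j" "w ! i \<noteq> z ! i"
    using assms(3,4) len by (metis length_take min.absorb2 nth_equalityI nth_take)
  have "w ! i < t" "z ! i < t" using assms(1-3) i(1) by (auto simp: addr_def subset_iff)
  from f_agree[OF this i(2)] have le: "card {x. x < q \<and> f (w ! i) x = f (z ! i) x} \<le> d" .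
  have "inj_on (\<lambda>pt. pt ! 0) (region z)"
  proof (rule inj_onI)
    fix a b assume ab: "a \<in> region z" "b \<in> region z" "a ! 0 = b ! 0"
    show "a = b"
    proof (rule nth_equalityI)
      show "length a = length b" using ab by (auto simp: region_def addr_def)
      fix i assume "i < length a"
      thus "a ! i = b ! i" using ab len by (cases i) (auto simp: region_def addr_def)
    qed
  qed
  hence "card (region w \<inter> region z) = card ((\<lambda>pt. pt ! 0) ` (region w \<inter> region z))"
    by (intro card_image[symmetric]) (auto intro: inj_on_subset)
  also have "\<dots> \<le> card {x. x < q \<and> f (w ! i) x = f (z ! i) x}"
  proof (intro card_mono image_subsetI)
    fix pt assume pt: "pt \<in> region w \<inter> region z"
    have "pt ! 0 \<in> set pt" using pt by (intro nth_mem) (auto simp: region_def addr_def)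
    moreover have "set pt \<subseteq> {..<q}" using pt by (auto simp: region_def addr_def)
    ultimately have "pt ! 0 < q" by blast
    moreover have "pt ! Suc i = f (w ! i) (pt ! 0)" "pt ! Suc i = f (z ! i) (pt ! 0)"
      using pt i(1) len assms(3) by (auto simp: region_def)
    ultimately show "pt ! 0 \<in> {x. x < q \<and> f (w ! i) x = f (z ! i) x}"
      by simp
  qed auto
  finally show ?thesis using le by simp
qed

lemma region_antimono: "region (w @ w') \<subseteq> region w"
  by (auto simp: region_def nth_append)

lemma finite_region [simp]: "finite (region w)"
  by (rule finite_subset[OF region_sub]) simp

text \<open>The curve at the end of the path has \<open>q\<close> points. A set on the path removes
  the region of the next vertex, which contains the curve, and the last leaf contributes no points;
  a set off the path shares at most \<open>d\<close> points with the curve and a singleton at most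
  1.\<close>

lemma opt_ge:
  assumes X: "X \<in> tree_inputs t p" and bit: "leaf_bit p X = 0"
  shows "q \<le> opt {..<n} (set (stream X)) * d"
proof -
  define z where "z = tree_path X p"
  have z: "z \<in> addr t p" using tree_path_in_addr[OF X] by (simp add: z_def)
  define R where "R = enc ` region z"
  have R: "card R = q" "R \<subseteq> {..<q ^ Suc p}"
    unfolding R_def using card_region_leaf[of z] inj_on_subset[OF enc_inj region_sub] region_sub[of z] enc_less
    by (auto simp: card_image z_def simp del: power_Suc)
  have small: "card (item_set X i \<inter> R) \<le> d" if i: "i \<in> set all_items" for i
  proof (cases i)
    case (Inr u)
    have "item_set X i \<inter> R \<subseteq> {u}"
      using full_lab_sub[OF i] R(2) unfolding Inr by (fastforce simp: item_set_def simp del: power_Suc)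
    hence "card (item_set X i \<inter> R) \<le> card {u}" by (intro card_mono) auto
    thus ?thesis using d by simp
  next
    case (Inl w)
    then obtain j where w: "w \<in> addr t j" "j \<le> p" using i unfolding set_all_items by auto
    have lw: "length w = j" using w by (simp add: addr_def)
    have "item_set X i \<inter> R \<subseteq> enc ` (core_set j (X j) w \<inter> region z)"
    proof
      fix u assume u: "u \<in> item_set X i \<inter> R"
      hence "u \<notin> full_lab (Inl w)" using full_lab_sub[OF i] R(2) unfolding Inl by (fastforce simp del: power_Suc)
      hence "u \<in> enc ` core_set j (X j) w" using u lw by (auto simp: Inl item_set_def item_level_def)
      then obtain a b where "a \<in> core_set j (X j) w" "u = enc a" "b \<in> region z" "u = enc b"
        using u by (auto simp: R_def)
      moreover from this have "a = b"
        using inj_onD[OF enc_inj] core_set_sub region_sub by (metis subsetD)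
      ultimately show "u \<in> enc ` (core_set j (X j) w \<inter> region z)" by blast
    qed
    hence "card (item_set X i \<inter> R) \<le> card (enc ` (core_set j (X j) w \<inter> region z))"
      by (intro card_mono) auto
    also have "\<dots> \<le> card (core_set j (X j) w \<inter> region z)" by (intro card_image_le) auto
    also have "\<dots> \<le> d"
    proof (cases "w = take j z")
      case True
      hence wp: "w = tree_path X j" using take_tree_path[OF w(2)] by (simp add: z_def)
      have "core_set j (X j) w \<inter> region z = {}"
      proof (cases "j < p")
        case j: True
        hence "tree_path X (Suc j) = take (Suc j) z" using take_tree_path[of "Suc j" p X] by (simp add: z_def)
        hence "z = (w @ [X j w]) @ drop (Suc j) z" unfolding wp by (simp add: tree_path.simps(2)[symmetric] del: tree_path.simps)
        hence "region z \<subseteq> region (w @ [X j w])" by (metis region_antimono)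
        thus ?thesis using j by (auto simp: core_set_def)
      next
        case False
        hence "X j w = 0" using w(2) bit wp unfolding leaf_bit_tree_path by simp
        thus ?thesis using False by (simp add: core_set_def)
      qed
      thus ?thesis by simp
    next
      case False
      have "card (core_set j (X j) w \<inter> region z) \<le> card (region w \<inter> region z)"
        using core_set_sub by (intro card_mono) auto
      also have "\<dots> \<le> d" by (rule card_region_inter[OF w(1) z w(2) False])
      finally show ?thesis .
    qed
    finally show ?thesis .
  qed
  have inst: "\<Union>(set (stream X)) = {..<n}"
    using stream_in[OF X] by (simp add: set_cover_streams_def set_cover_instance_def)
  have "\<exists>G. set_cover {..<n} (set (stream X)) G \<and> card G = opt {..<n} (set (stream X))"
    unfolding opt_def by (rule LeastI_ex) (use inst in \<open>auto simp: set_cover_def\<close>)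
  then obtain G where G: "G \<subseteq> set (stream X)" "\<Union>G = {..<n}" "card G = opt {..<n} (set (stream X))"
    by (auto simp: set_cover_def)
  have finG: "finite G" using G(1) finite_subset by blast
  have "R \<subseteq> (\<Union>S\<in>G. S \<inter> R)" using R(2) G(2) qn by (fastforce simp del: power_Suc)
  hence "card R \<le> card (\<Union>S\<in>G. S \<inter> R)"
    using finG by (intro card_mono) (auto simp: R_def)
  also have "\<dots> \<le> (\<Sum>S\<in>G. card (S \<inter> R))" using finG by (intro card_UN_le)
  also have "\<dots> \<le> (\<Sum>S\<in>G. d)"
    using G(1) small by (intro sum_mono) (auto simp: stream_eq)
  finally show ?thesis using R(1) G(3) by simp
qed

end

section \<open>Streaming algorithms as pointer jumping protocols\<close>

text \<open>\<open>pointer_jumping_bound\<close> wants a state space closed under every update, also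
  for states and data that never occur. Emptying an oversized memory achieves this and changes
  nothing along a run that stays within \<open>b\<close> bits.\<close>

lemma fold_clamped_blocks:
  fixes step :: "'i \<Rightarrow> bool list \<Rightarrow> bool list"
  assumes "\<And>m. m \<le> length (concat bs) \<Longrightarrow> length (fold step (take m (concat bs)) s) \<le> b"
  shows "fold (\<lambda>blk s. let s' = fold step blk s in if length s' \<le> b then s' else []) bs s = fold step (concat bs) s"
  using assms
proof (induction bs arbitrary: s)
  case (Cons blk bs)
  have "length (fold step blk s) \<le> b" using Cons.prems[of "length blk"] by simp
  moreover have "length (fold step (take m (concat bs)) (fold step blk s)) \<le> b" if "m \<le> length (concat bs)" for m
    using Cons.prems[of "length blk + m"] that by simp
  ultimately show ?case using Cons.IH[of "fold step blk s"] by simp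
qed simp

lemma run_passes_conv_fold:
  "run_passes u k X p s =
     fold (\<lambda>(i, j) s. u i j s (X j)) (concat (map (\<lambda>i. map (Pair i) (rev [0..<Suc k])) [0..<p])) s"
proof (induction p arbitrary: u s)
  case (Suc p)
  have e: "[0..<Suc p] = 0 # map Suc [0..<p]" by (simp only: map_Suc_upt upt_conv_Cons[of 0 "Suc p"])
  have "fold (\<lambda>(i, j) s. u i j s (X j)) (concat (map (\<lambda>i. map (Pair i) (rev [0..<Suc k])) [0..<Suc p])) s
      = fold (\<lambda>(i, j) s. u i j s (X j)) (concat (map (\<lambda>i. map (Pair (Suc i)) (rev [0..<Suc k])) [0..<p]))
          (one_pass (u 0) k X s)"
    unfolding e one_pass_def foldr_conv_fold by (simp add: fold_map o_def del: upt_Suc)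
  also have "\<dots> = fold (\<lambda>(i, j) s. u (Suc i) j s (X j)) (concat (map (\<lambda>i. map (Pair i) (rev [0..<Suc k])) [0..<p]))
          (one_pass (u 0) k X s)"
  proof -
    have "concat (map (\<lambda>i. map (Pair (Suc i)) (rev [0..<Suc k])) is) =
          map (\<lambda>(i, j). (Suc i, j)) (concat (map (\<lambda>i. map (Pair i) (rev [0..<Suc k])) is))" for "is"
      by (simp add: map_concat o_def del: upt_Suc)
    thus ?thesis by (simp only: fold_map) (simp add: case_prod_unfold o_def del: upt_Suc)
  qed
  finally show ?case using Suc.IH[of "\<lambda>i. u (Suc i)"] by simp
qed simp

lemma passes_conv_concat: "passes p xs = concat (map (\<lambda>i. map (Pair i) xs) [0..<p])"
proof -
  have "List.product is xs = concat (map (\<lambda>i. map (Pair i) xs) is)" for "is" :: "nat list"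
    by (induction "is") auto
  thus ?thesis by (simp add: passes_def)
qed

lemma card_bool_lists_le: "finite {s :: bool list. length s \<le> b}" "card {s :: bool list. length s \<le> b} \<le> 2 ^ Suc b"
proof -
  have e: "{s :: bool list. length s \<le> b} = {s. set s \<subseteq> UNIV \<and> length s \<le> b}" by auto
  show "finite {s :: bool list. length s \<le> b}" unfolding e by (rule finite_lists_length_le) simp
  have "card {s :: bool list. length s \<le> b} = (\<Sum>i\<le>b. 2 ^ i)"
    unfolding e by (subst card_lists_length_le) auto
  also have "\<dots> < 2 ^ Suc b" by (induction b) auto
  finally show "card {s :: bool list. length s \<le> b} \<le> 2 ^ Suc b" by simp
qed

context set_cover_reduction
begin

definition level_update :: "nat \<Rightarrow> streaming_alg \<Rightarrow> nat \<Rightarrow> nat \<Rightarrow> bool list \<Rightarrow> (nat list \<Rightarrow> nat) \<Rightarrow> bool list" where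
  "level_update b a i j s dt =
     (let s' = fold (\<lambda>(i, S). update a i S) (map (Pair i) (map (cover_set j dt) (items j))) s
      in if length s' \<le> b then s' else [])"

lemma run_passes_level_update:
  assumes "bits_used p a (stream X) \<le> b"
  shows "run_passes (level_update b a) p X p (init_mem a) = memory a (passes p (stream X))"
proof -
  define bs where "bs = map (\<lambda>(i, j). map (Pair i) (map (cover_set j (X j)) (items j)))
    (concat (map (\<lambda>i. map (Pair i) (rev [0..<Suc p])) [0..<p]))"
  have bs: "concat bs = passes p (stream X)"
  proof -
    have "concat (map (\<lambda>(i, j). map (Pair i) (map (cover_set j (X j)) (items j))) (concat (map (\<lambda>i. map (Pair i) (rev [0..<Suc p])) is))) =
      concat (map (\<lambda>i. map (Pair i) (stream X)) is)" for "is" :: "nat list"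
      by (induction "is") (simp_all add: stream_def map_concat o_def del: upt_Suc)
    thus ?thesis by (simp only: bs_def passes_conv_concat)
  qed
  have "length (fold (\<lambda>(i, S). update a i S) (take m (concat bs)) (init_mem a)) \<le> b"
    if "m \<le> length (concat bs)" for m
  proof -
    have "m \<le> p * length (stream X)" using that unfolding bs passes_def by simp
    hence "length (memory a (take m (passes p (stream X)))) \<le> bits_used p a (stream X)"
      unfolding bits_used_def by (intro Max_ge) auto
    thus ?thesis using assms by (simp add: memory_def bs)
  qed
  note clamp = fold_clamped_blocks[OF this]
  have "(\<lambda>(i, j) s. level_update b a i j s (X j)) =
    (\<lambda>blk s. let s' = fold (\<lambda>(i, S). update a i S) blk s in if length s' \<le> b then s' else []) \<circ>
      (\<lambda>(i, j). map (Pair i) (map (cover_set j (X j)) (items j)))"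
    by (auto simp: fun_eq_iff level_update_def)
  hence "run_passes (level_update b a) p X p (init_mem a) =
     fold (\<lambda>blk s. let s' = fold (\<lambda>(i, S). update a i S) blk s in if length s' \<le> b then s' else []) bs (init_mem a)"
    unfolding run_passes_conv_fold bs_def fold_map by (simp only:)
  also note clamp
  finally show ?thesis by (simp only: bs memory_def)
qed

text \<open>Averaging over the coins: each input is answered correctly with probability at least
  \<open>2 / 3\<close>, while each deterministic algorithm is correct on at most the fraction from
  \<open>pointer_jumping_bound\<close>. Comparing the answer with \<open>q / d\<close> reveals the
  leaf bit. The summand 1 in \<open>b + 1\<close> arises because strings of all lengths up to
  \<open>b\<close> count as states.\<close>

theorem space_lower_bound:
  fixes A :: "streaming_alg pmf"
  defines "m \<equiv> (\<Sum>j\<le>p. t ^ j) + q ^ Suc p"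
  assumes approx: "approximates_set_cover p A n m \<beta>" and \<beta>: "\<beta> * real (Suc p) < real q / real d"
    and space: "space_usage p A n m \<le> enat b"
  shows "2 / 3 \<le> 1 / 2 + (\<Sum>i=1..p. sqrt (real i * ((real b + 1) * ln 2) / (2 * real t)))"
proof -
  define T where "T = tree_inputs t p"
  have T: "finite T" "card T > 0" using tree_inputs_nonempty[of t p] t by (auto simp: T_def card_gt_0_iff)
  define out where "out a s = (if answer a s < real q / real d then 1 else 0 :: nat)" for a :: streaming_alg and s
  define good where "good a X \<longleftrightarrow> out a (run_passes (level_update b a) p X p (init_mem a)) = leaf_bit p X" for a X
  have bits: "bits_used p a (stream X) \<le> b" if "a \<in> set_pmf A" "X \<in> T" for a X
  proof -
    have "enat (bits_used p a (stream X)) \<le> space_usage p A n m"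
      unfolding space_usage_def
      using stream_in[of X] that by (intro SUP_upper2[of "(stream X, a)"]) (auto simp: T_def m_def)
    thus ?thesis using space by (meson enat_ord_simps(1) order.trans)
  qed
  have prob: "measure_pmf.prob A {a. good a X} \<ge> 2 / 3" if X: "X \<in> T" for X
  proof -
    define xs where "xs = stream X"
    have xs: "xs \<in> set_cover_streams n m" using stream_in[of X] X by (simp add: T_def xs_def m_def)
    let ?O = "real (opt {..<n} (set xs))"
    have "2 / 3 \<le> measure_pmf.prob A {a. ?O \<le> result p a xs \<and> result p a xs \<le> \<beta> * ?O}"
      using approx xs by (simp add: approximates_set_cover_def)
    also have "\<dots> \<le> measure_pmf.prob A {a. good a X}"
    proof (rule measure_pmf.finite_measure_mono_AE)
      show "AE a in measure_pmf A. a \<in> {a. ?O \<le> result p a xs \<and> result p a xs \<le> \<beta> * ?O} \<longrightarrow> a \<in> {a. good a X}"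
      proof (rule AE_pmfI, rule impI)
        fix a assume a: "a \<in> set_pmf A" and "a \<in> {a. ?O \<le> result p a xs \<and> result p a xs \<le> \<beta> * ?O}"
        hence r: "?O \<le> result p a xs" "result p a xs \<le> \<beta> * ?O" by auto
        have res: "result p a xs = answer a (run_passes (level_update b a) p X p (init_mem a))"
          using run_passes_level_update[OF bits[OF a X]] by (simp add: result_def xs_def)
        have "leaf_bit p X = 0 \<or> leaf_bit p X = 1" using leaf_bit_less_2[of X t p] X by (auto simp: T_def)
        thus "a \<in> {a. good a X}"
        proof
          assume b0: "leaf_bit p X = 0"
          have "real q \<le> ?O * real d"
            using opt_ge[OF X[unfolded T_def] b0] unfolding xs_def by (simp flip: of_nat_mult)
          hence "real q / real d \<le> ?O" using d by (simp add: divide_le_eq)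
          thus ?thesis using b0 r res by (simp add: good_def out_def)
        next
          assume b1: "leaf_bit p X = 1"
          have O: "?O \<le> real (Suc p)" using opt_le[OF X[unfolded T_def] b1] unfolding xs_def by (simp only: of_nat_le_iff)
          have "result p a xs < real q / real d"
          \<comment> \<open>A negative \<beta> is not excluded by the definition of approximation;
            the result is then at most 0.\<close>
          proof (cases "\<beta> \<ge> 0")
            case True
            hence "\<beta> * ?O \<le> \<beta> * real (Suc p)" using O by (intro mult_left_mono)
            thus ?thesis using r \<beta> by linarith
          next
            case False
            have q0: "q > 0" using f_less[of 0 0] by simp
            have "\<beta> * ?O \<le> 0" using False by (intro mult_nonpos_nonneg) auto
            moreover have "real q / real d > 0" using q0 d by simp
            ultimately show ?thesis using r by linarith
          qed
          thus ?thesis using b1 res by (simp add: good_def out_def)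
        qed
      qed
    qed auto
    finally show ?thesis .
  qed
  define S where "S = {s :: bool list. length s \<le> b}"
  have S: "finite S" "card S \<le> 2 ^ Suc b" "card S > 0"
    using card_bool_lists_le[of b] by (auto simp: S_def card_gt_0_iff intro: exI[of _ "[]"])
  define B where "B = 1 / 2 + (\<Sum>i=1..p. sqrt (real i * ((real b + 1) * ln 2) / (2 * real t)))"
  have a_bound: "(\<Sum>X\<in>T. of_bool (good a X)) \<le> real (card T) * B" if a: "a \<in> set_pmf A" for a
  proof -
    have "init_mem a \<in> S"
    proof -
      obtain X where X: "X \<in> T" using T by (metis card_gt_0_iff ex_in_conv)
      have "length (memory a (take 0 (passes p (stream X)))) \<le> bits_used p a (stream X)"
        unfolding bits_used_def by (intro Max_ge finite_imageI image_eqI[where x = 0]) auto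
      thus ?thesis using bits[OF a X] by (simp add: memory_def S_def)
    qed
    hence "(\<Sum>X\<in>T. of_bool (good a X)) \<le> card T * (1 / 2 + (\<Sum>i=1..p. sqrt (real i * ln (card S) / (2 * real t))))"
      unfolding good_def T_def
      by (intro pointer_jumping_bound S) (use t in \<open>auto simp: S_def level_update_def Let_def\<close>)
    also have "\<dots> \<le> real (card T) * B"
    proof -
      have "real (card S) \<le> real (2 ^ Suc b)" using S(2) by (simp only: of_nat_le_iff)
      hence "real (card S) \<le> 2 ^ Suc b" by simp
      hence "ln (card S) \<le> ln (2 ^ Suc b)" using S(3) by (subst ln_le_cancel_iff) auto
      also have "\<dots> = (real b + 1) * ln 2" by (subst ln_realpow) (auto simp: algebra_simps)
      finally show ?thesis unfolding B_def
        by (intro mult_left_mono add_left_mono sum_mono real_sqrt_le_mono divide_right_mono) auto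
    qed
    finally show ?thesis .
  qed
  have int: "integrable (measure_pmf A) (\<lambda>a. of_bool (good a X) :: real)" for X
    by (rule measure_pmf.integrable_const_bound[where B = 1]) auto
  have "real (card T) * (2 / 3) = (\<Sum>X\<in>T. 2 / 3)" by simp
  also have "\<dots> \<le> (\<Sum>X\<in>T. measure_pmf.prob A {a. good a X})" by (intro sum_mono prob)
  also have "\<dots> = (\<Sum>X\<in>T. measure_pmf.expectation A (\<lambda>a. of_bool (good a X)))"
  proof (intro sum.cong refl)
    fix X
    have "(\<lambda>a. of_bool (good a X) :: real) = indicator {a. good a X}" by (auto simp: indicator_def)
    thus "measure_pmf.prob A {a. good a X} = measure_pmf.expectation A (\<lambda>a. of_bool (good a X))" by simp
  qed
  also have "\<dots> = measure_pmf.expectation A (\<lambda>a. \<Sum>X\<in>T. of_bool (good a X))"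
    by (rule Bochner_Integration.integral_sum[symmetric]) (rule int)
  also have "\<dots> \<le> real (card T) * B"
    by (rule measure_pmf.integral_le_const)
       (use a_bound in \<open>auto simp: AE_measure_pmf_iff intro!: Bochner_Integration.integrable_sum int\<close>)
  finally show ?thesis using T by (simp add: B_def)
qed

end

section \<open>The lower bound\<close>

text \<open>The hypothesis on cardinalities is a count of labels: the spare elements have
  \<open>2 ^ (n - q ^ Suc p) - 1\<close> proper subsets, enough for one to each set other than that
  of the root.\<close>

lemma set_cover_reduction_exists:
  assumes "p \<ge> 1" "d \<ge> 1" "t \<ge> 1" "prime q" "t \<le> q ^ Suc d" "q ^ Suc p \<le> n"
    and card: "(\<Sum>j\<le>p. t ^ j) + q ^ Suc p \<le> 2 ^ (n - q ^ Suc p)"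
  shows "\<exists>f enc lab vs. set_cover_reduction p q d t n f enc lab vs"
proof -
  obtain f :: "nat \<Rightarrow> nat \<Rightarrow> nat" where f: "\<And>r x. f r x < q"
    "\<And>r r'. r < t \<Longrightarrow> r' < t \<Longrightarrow> r \<noteq> r' \<Longrightarrow> card {x. x < q \<and> f r x = f r' x} \<le> d"
    using exists_low_agreement_functions[OF assms(4,5)] by blast
  have "card (addr q (Suc p)) = card {..<q ^ Suc p}" by (simp add: card_addr)
  then obtain enc where enc: "bij_betw enc (addr q (Suc p)) {..<q ^ Suc p}"
    using finite_same_card_bij[of "addr q (Suc p)" "{..<q ^ Suc p}"] by auto
  define I where "I = (Inl ` (\<Union>j\<in>{1..p}. addr t j) \<union> Inr ` {..<q ^ Suc p} :: (nat list + nat) set)"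
  define E where "E = {q ^ Suc p..<n}"
  have "card I \<le> (\<Sum>j\<in>{1..p}. t ^ j) + q ^ Suc p"
  proof -
    have "card I \<le> card (Inl ` (\<Union>j\<in>{1..p}. addr t j) :: (nat list + nat) set) + card (Inr ` {..<q ^ Suc p} :: (nat list + nat) set)"
      unfolding I_def by (rule card_Un_le)
    also have "\<dots> = card (\<Union>j\<in>{1..p}. addr t j) + q ^ Suc p" by (simp add: card_image del: power_Suc)
    also have "card (\<Union>j\<in>{1..p}. addr t j) \<le> (\<Sum>j\<in>{1..p}. card (addr t j))"
      by (intro card_UN_le) auto
    finally show ?thesis by (simp add: card_addr)
  qed
  moreover have "(\<Sum>j\<le>p. t ^ j) = 1 + (\<Sum>j\<in>{1..p}. t ^ j)"
  proof -
    have "{..p} = insert 0 {1..p}" by auto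
    thus ?thesis by simp
  qed
  ultimately have "card I \<le> 2 ^ card E - 1" using card unfolding E_def by simp
  also have "\<dots> = card (Pow E - {E})" by (subst card_Diff_singleton) (auto simp: card_Pow E_def)
  finally obtain lab where lab: "lab ` I \<subseteq> Pow E - {E}" "inj_on lab I"
    using card_le_inj[of I "Pow E - {E}"] by (auto simp: I_def E_def)
  have "\<exists>vs. set vs = addr t j \<and> distinct vs" for j
    using finite_distinct_list[of "addr t j"] by auto
  then obtain vs where vs: "\<And>j. set (vs j) = addr t j \<and> distinct (vs j)" by metis
  have "set_cover_reduction p q d t n f enc lab vs"
  proof
    show "lab i \<subset> {q ^ Suc p..<n}" if "i \<in> Inl ` (\<Union>j\<in>{1..p}. addr t j) \<union> Inr ` {..<q ^ Suc p}" for i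
      using lab(1) that unfolding I_def[symmetric] E_def[symmetric] by blast
    show "inj_on lab (Inl ` (\<Union>j\<in>{1..p}. addr t j) \<union> Inr ` {..<q ^ Suc p})"
      using lab(2) unfolding I_def .
  qed (use assms f enc vs in auto)
  thus ?thesis by blast
qed

text \<open>The number \<open>1 / 6\<close> is \<open>2 / 3 - 1 / 2\<close>. Each of the
  \<open>p\<close> summands is at most \<open>sqrt (p * (b + 1) / (2 * t))\<close>, and squaring
  \<open>p\<close> times this root makes the cube of \<open>p\<close>.\<close>

lemma sum_sqrt_bound:
  fixes b t p :: nat
  assumes t: "t > 0" and le: "1 / 6 \<le> (\<Sum>i=1..p. sqrt (real i * ((real b + 1) * ln 2) / (2 * real t)))"
  shows "real t \<le> 18 * real p ^ 3 * (real b + 1)"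
proof -
  define s where "s = sqrt (real p * (real b + 1) / (2 * real t))"
  have "(\<Sum>i=1..p. sqrt (real i * ((real b + 1) * ln 2) / (2 * real t))) \<le> (\<Sum>i=1..p. s)"
  proof (intro sum_mono)
    fix i assume "i \<in> {1..p}"
    have "(real b + 1) * ln 2 \<le> (real b + 1) * 1" using ln2_le_25_over_36 by (intro mult_left_mono) auto
    hence "real i * ((real b + 1) * ln 2) \<le> real p * (real b + 1)"
      using \<open>i \<in> {1..p}\<close> by (intro mult_mono) auto
    thus "sqrt (real i * ((real b + 1) * ln 2) / (2 * real t)) \<le> s"
      unfolding s_def by (intro real_sqrt_le_mono divide_right_mono) auto
  qed
  hence "1 / 6 \<le> real p * s" using le by simp
  hence "(1 / 6)\<^sup>2 \<le> (real p * s)\<^sup>2" by (intro power_mono) auto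
  also have "(real p * s)\<^sup>2 = real p ^ 3 * (real b + 1) / (2 * real t)"
  proof -
    have "s\<^sup>2 = real p * (real b + 1) / (2 * real t)" by (simp add: s_def)
    thus ?thesis by (simp only: power_mult_distrib) (simp add: power2_eq_square power3_eq_cube)
  qed
  finally have "1 / 36 \<le> real p ^ 3 * (real b + 1) / (2 * real t)" by (simp add: power2_eq_square)
  hence "2 * real t \<le> 36 * (real p ^ 3 * (real b + 1))" using t by (simp add: field_simps)
  thus ?thesis by (simp add: algebra_simps)
qed

theorem mainTheorem1:
  fixes c :: real
  assumes "c > 1"
  shows "\<exists>C>0. \<forall>p\<ge>1. \<exists>M :: nat \<Rightarrow> nat.
    (\<lambda>n. real (M n)) \<in> \<Theta>(\<lambda>n. real n powr (c * real p)) \<and>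
    (\<forall>(A :: nat \<Rightarrow> nat \<Rightarrow> streaming_alg pmf) (\<beta> :: nat \<Rightarrow> nat \<Rightarrow> real).
       (\<exists>N. \<forall>n\<ge>N. \<forall>m\<ge>N.
          \<beta> n m < real n powr (1 / (real p + 1)) / (c * (real p + 1)^2) \<and>
          approximates_set_cover p (A n m) n m (\<beta> n m))
       \<longrightarrow> (\<exists>n0. \<forall>n\<ge>n0.
              ereal (C * real n powr c / real p ^ 3)
                \<le> ereal_of_enat (space_usage p (A n (M n)) n (M n))))"
proof (intro exI[of _ "1/100"] conjI allI impI)
  fix p :: nat assume p: "p \<ge> 1"
  define K where "K = c * (real p + 1)"
  \<comment> \<open>The largest integer strictly below \<open>K\<close>: smaller than
    \<open>K\<close> so that \<open>q\<close> can stay below \<open>y n\<close>, and with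
    \<open>d + 1 \<ge> K\<close> so that there are enough polynomials.\<close>
  define d where "d = nat \<lceil>K\<rceil> - 1"
  define y where "y n = real n powr (1 / (real p + 1))" for n
  \<comment> \<open>For \<open>q \<ge> l1 * y n\<close> the first entry gives
    \<open>q / d \<ge> y n / K\<close>, the second
    \<open>q powr K \<ge> n powr c / 2\<close>.\<close>
  define l1 where "l1 = max (real d / K) (2 powr (- 1 / K))"
  \<comment> \<open>The midpoint leaves a gap above \<open>l1\<close> for a prime and a gap below 1
    for the spare elements, whose proportion is at least \<kappa>.\<close>
  define l2 where "l2 = (1 + l1) / 2"
  define q where "q n = (SOME q. prime q \<and> l1 * y n < real q \<and> real q \<le> l2 * y n)" for n
  define t where "t n = nat \<lfloor>real n powr c / 2\<rfloor>" for n
  define M where "M n = (\<Sum>j\<le>p. t n ^ j) + q n ^ Suc p" for n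
  define \<kappa> where "\<kappa> = 1 - l2 ^ Suc p"
  have K: "K > 2"
  proof -
    have "1 * 2 < c * (real p + 1)" using assms p by (intro mult_less_le_imp_less) auto
    thus ?thesis by (simp add: K_def)
  qed
  have d: "d \<ge> 1" "real d < K" "K \<le> real d + 1"
  proof -
    define m where "m = nat \<lceil>K\<rceil>"
    have c3: "\<lceil>K\<rceil> \<ge> 3" using K by linarith
    hence m: "real m = real_of_int \<lceil>K\<rceil>" by (simp add: m_def)
    hence "m \<ge> 3" using c3 by linarith
    hence "real d = real_of_int \<lceil>K\<rceil> - 1" "d \<ge> 2" using m by (auto simp: d_def m_def[symmetric] of_nat_diff)
    thus "d \<ge> 1" "real d < K" "K \<le> real d + 1" by linarith+
  qed
  have l1: "0 < l1" "l1 < 1" "real d / K \<le> l1" "2 powr (- 1 / K) \<le> l1"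
  proof -
    have "2 powr (- 1 / K) < 2 powr (0::real)" using K by (intro powr_less_mono) auto
    thus "l1 < 1" using d K by (simp add: l1_def)
    have "0 < 2 powr (- 1 / K)" by simp
    thus "0 < l1" unfolding l1_def by (meson less_max_iff_disj)
  qed (auto simp: l1_def)
  have l2: "l1 < l2" "0 < l2" "l2 < 1" using l1 by (auto simp: l2_def)
  have \<kappa>: "\<kappa> > 0" unfolding \<kappa>_def using l2 power_less_one_iff[of l2 "Suc p"] by (simp del: power_Suc)
  have cp: "c * real p \<ge> 1" using assms p mult_mono[of 1 c 1 "real p"] by simp
  have y_pow: "y n ^ Suc p = real n" if "n \<ge> 1" for n
  proof -
    have "y n ^ Suc p = y n powr real (Suc p)"
      using that by (intro powr_realpow[symmetric]) (simp add: y_def)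
    also have "\<dots> = real n powr (1 / (real p + 1) * real (Suc p))" by (simp only: y_def powr_powr)
    also have "1 / (real p + 1) * real (Suc p) = 1" by simp
    finally show ?thesis using that by simp
  qed
  obtain x0 where x0: "\<And>x. x \<ge> x0 \<Longrightarrow> \<exists>p. prime p \<and> x < real p \<and> real p \<le> (1 + (l2 / l1 - 1)) * x"
    using prime_in_short_interval[of "l2 / l1 - 1"] l1 l2 by (auto simp: field_simps)
  have "filterlim (\<lambda>n::nat. l1 * real n powr (1 / (real p + 1))) at_top sequentially"
    using l1(1) by real_asymp
  hence "eventually (\<lambda>n. l1 * y n \<ge> x0) sequentially"
    unfolding y_def filterlim_at_top by blast
  moreover have "filterlim (\<lambda>n::nat. real n powr c) at_top sequentially"
    using assms by real_asymp
  hence "eventually (\<lambda>n::nat. real n powr c \<ge> 300 * real p ^ 3) sequentially"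
    unfolding filterlim_at_top by blast
  \<comment> \<open>Polynomially many sets against exponentially many labels.\<close>
  moreover have "eventually (\<lambda>n::nat. (real p + 1) * real n powr (c * real p) + real n \<le> 2 powr (\<kappa> * real n)) sequentially"
    using \<kappa> cp by real_asymp
  moreover have "eventually (\<lambda>n::nat. n \<ge> 1) sequentially" by (rule eventually_ge_at_top)
  ultimately have ev: "eventually (\<lambda>n. n \<ge> 1 \<and> prime (q n) \<and> real d / K * y n \<le> real (q n) \<and>
      real n powr c / 4 \<le> real (t n) \<and> t n \<ge> 1 \<and> real n powr c \<ge> 300 * real p ^ 3 \<and>
      real (t n) \<le> real n powr c \<and> t n \<le> q n ^ Suc d \<and> q n ^ Suc p \<le> n \<and> M n \<le> 2 ^ (n - q n ^ Suc p)) sequentially"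
  proof eventually_elim
    case (elim n)
    have "\<exists>p. prime p \<and> l1 * y n < real p \<and> real p \<le> l2 * y n"
      using x0[OF elim(1)] l1 by simp
    hence q: "prime (q n)" "l1 * y n < real (q n)" "real (q n) \<le> l2 * y n"
      unfolding q_def by (metis (mono_tags, lifting) someI_ex)+
    have y0: "y n \<ge> 0" by (simp add: y_def)
    have p3: "real p ^ 3 \<ge> 1" using p by simp
    hence nc: "real n powr c \<ge> 300" using elim(2) by linarith
    have t: "real n powr c / 4 \<le> real (t n)" "real (t n) \<le> real n powr c / 2" "t n \<ge> 1"
      using nc unfolding t_def by linarith+
    have "real (q n ^ Suc p) \<le> (l2 * y n) ^ Suc p"
      unfolding of_nat_power using q by (intro power_mono) auto
    also have "\<dots> = l2 ^ Suc p * real n" using y_pow[OF elim(4)] by (simp only: power_mult_distrib)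
    finally have Q: "real (q n ^ Suc p) \<le> real n - \<kappa> * real n" by (simp add: \<kappa>_def algebra_simps del: power_Suc)
    moreover have "\<kappa> * real n \<ge> 0" using \<kappa> by simp
    ultimately have "real (q n ^ Suc p) \<le> real n" by linarith
    hence Qn: "q n ^ Suc p \<le> n" by (simp only: of_nat_le_iff)
    have "real n powr c / 2 \<le> real (q n ^ Suc d)"
    proof -
      have "(2 powr (- 1 / K)) powr K \<le> l1 powr K" using l1 K by (intro powr_mono2) auto
      also have "(2 powr (- 1 / K)) powr K = 2 powr (- 1 / K * K)" by (rule powr_powr)
      also have "- 1 / K * K = - 1" using K by simp
      also have "2 powr (- 1 :: real) = 1 / 2" by (simp add: powr_minus)
      finally have "1 / 2 * y n powr K \<le> l1 powr K * y n powr K" by (intro mult_right_mono) auto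
      also have "l1 powr K * y n powr K = (l1 * y n) powr K" using l1 y0 by (simp add: powr_mult)
      also have "\<dots> \<le> real (q n) powr K" using q l1 y0 K by (intro powr_mono2) auto
      also have "\<dots> \<le> real (q n) powr (real (Suc d))"
        using d prime_gt_1_nat[OF q(1)] by (intro powr_mono) auto
      also have "\<dots> = real (q n ^ Suc d)"
        using prime_gt_0_nat[OF q(1)] by (subst powr_realpow) auto
      finally have "1 / 2 * y n powr K \<le> real (q n ^ Suc d)" .
      moreover have "real n powr c = y n powr K" unfolding y_def powr_powr K_def by simp
      ultimately show ?thesis by (simp del: power_Suc)
    qed
    hence "real (t n) \<le> real (q n ^ Suc d)" using t by linarith
    hence tq: "t n \<le> q n ^ Suc d" by (simp only: of_nat_le_iff)
    have "real (M n) \<le> 2 ^ (n - q n ^ Suc p)"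
    proof -
      have "real (M n) = (\<Sum>j\<le>p. real (t n) ^ j) + real (q n ^ Suc p)" by (simp add: M_def)
      also have "(\<Sum>j\<le>p. real (t n) ^ j) \<le> (\<Sum>j\<le>p. real (t n) ^ p)"
        using t(3) by (intro sum_mono power_increasing) auto
      also have "\<dots> \<le> (real p + 1) * (real n powr c) ^ p"
        using t nc by (simp add: add.commute) (intro mult_left_mono power_mono, auto)
      also have "(real n powr c) ^ p = real n powr (c * real p)" using elim(4) by (simp add: powr_power mult.commute)
      also have "real (q n ^ Suc p) \<le> real n" using Qn by (simp only: of_nat_le_iff)
      also have "(real p + 1) * real n powr (c * real p) + real n \<le> 2 powr (\<kappa> * real n)" by (rule elim(3))
      also have "\<dots> \<le> 2 powr (real (n - q n ^ Suc p))" using Q Qn by (intro powr_mono) (auto simp del: power_Suc)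
      also have "\<dots> = 2 ^ (n - q n ^ Suc p)" by (simp add: powr_realpow)
      finally show ?thesis by simp
    qed
    hence "M n \<le> 2 ^ (n - q n ^ Suc p)" by (simp only: of_nat_le_iff[where 'a = real, symmetric] of_nat_power of_nat_numeral)
    moreover have "real d / K * y n \<le> real (q n)"
      using mult_right_mono[OF l1(3) y0] q(2) by linarith
    ultimately show ?case using q t tq Qn elim nc by (auto simp del: power_Suc)
  qed
  have Mge: "real (M n) \<ge> real (t n) ^ p" for n
    unfolding M_def of_nat_add of_nat_sum of_nat_power
    by (intro add_increasing2 member_le_sum[where f = "\<lambda>j. real (t n) ^ j"]) auto
  show "\<exists>M :: nat \<Rightarrow> nat.
    (\<lambda>n. real (M n)) \<in> \<Theta>(\<lambda>n. real n powr (c * real p)) \<and>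
    (\<forall>(A :: nat \<Rightarrow> nat \<Rightarrow> streaming_alg pmf) (\<beta> :: nat \<Rightarrow> nat \<Rightarrow> real).
       (\<exists>N. \<forall>n\<ge>N. \<forall>m\<ge>N.
          \<beta> n m < real n powr (1 / (real p + 1)) / (c * (real p + 1)^2) \<and>
          approximates_set_cover p (A n m) n m (\<beta> n m))
       \<longrightarrow> (\<exists>n0. \<forall>n\<ge>n0.
              ereal (1/100 * real n powr c / real p ^ 3)
                \<le> ereal_of_enat (space_usage p (A n (M n)) n (M n))))"
  proof (intro exI[of _ M] conjI allI impI)
    show "(\<lambda>n. real (M n)) \<in> \<Theta>(\<lambda>n. real n powr (c * real p))"
    proof (rule bigthetaI')
      show "(1 / 4) ^ p > (0::real)" "real p + 2 > 0" by auto
      show "eventually (\<lambda>n. (1 / 4) ^ p * norm (real n powr (c * real p)) \<le> norm (real (M n)) \<and>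
          norm (real (M n)) \<le> (real p + 2) * norm (real n powr (c * real p))) at_top"
        using ev
      proof eventually_elim
        case (elim n)
        have pw: "(real n powr c) ^ p = real n powr (c * real p)" using elim by (simp add: powr_power mult.commute)
        have "(1 / 4) ^ p * real n powr (c * real p) = (real n powr c / 4) ^ p"
          by (simp add: pw[symmetric] power_divide)
        also have "\<dots> \<le> real (t n) ^ p" using elim by (intro power_mono) auto
        also note Mge[of n]
        finally have 1: "(1 / 4) ^ p * real n powr (c * real p) \<le> real (M n)" .
        have "(\<Sum>j\<le>p. real (t n) ^ j) \<le> (\<Sum>j\<le>p. real (t n) ^ p)"
          using elim by (intro sum_mono power_increasing) auto
        also have "\<dots> = (real p + 1) * real (t n) ^ p" by (simp add: add.commute)
        also have "\<dots> \<le> (real p + 1) * (real n powr c) ^ p"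
          using elim by (intro mult_left_mono power_mono) auto
        finally have "(\<Sum>j\<le>p. real (t n) ^ j) \<le> (real p + 1) * real n powr (c * real p)" unfolding pw .
        moreover have "real (q n ^ Suc p) \<le> real n" using elim by (simp only: of_nat_le_iff)
        moreover have "real n \<le> real n powr (c * real p)"
          using powr_mono[OF cp, of "real n"] elim by simp
        moreover have "real (M n) = (\<Sum>j\<le>p. real (t n) ^ j) + real (q n ^ Suc p)" by (simp add: M_def)
        ultimately have "real (M n) \<le> (real p + 1) * real n powr (c * real p) + real n powr (c * real p)"
          by linarith
        hence "real (M n) \<le> (real p + 2) * real n powr (c * real p)" by (simp add: algebra_simps)
        thus ?case using 1 by simp
      qed
    qed
  next
    fix A :: "nat \<Rightarrow> nat \<Rightarrow> streaming_alg pmf" and \<beta> :: "nat \<Rightarrow> nat \<Rightarrow> real"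
    assume "\<exists>N. \<forall>n\<ge>N. \<forall>m\<ge>N.
          \<beta> n m < real n powr (1 / (real p + 1)) / (c * (real p + 1)^2) \<and>
          approximates_set_cover p (A n m) n m (\<beta> n m)"
    then obtain N where N: "\<And>n m. n \<ge> N \<Longrightarrow> m \<ge> N \<Longrightarrow> \<beta> n m < y n / (c * (real p + 1)^2)"
       "\<And>n m. n \<ge> N \<Longrightarrow> m \<ge> N \<Longrightarrow> approximates_set_cover p (A n m) n m (\<beta> n m)"
      unfolding y_def by blast
    have "filterlim (\<lambda>n::nat. real n powr c / 4) at_top sequentially"
      using assms by real_asymp
    hence "eventually (\<lambda>n::nat. real n powr c / 4 \<ge> real N) sequentially"
      unfolding filterlim_at_top by blast
    with ev eventually_ge_at_top[of N]
    have "eventually (\<lambda>n. ereal (1/100 * real n powr c / real p ^ 3)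
                \<le> ereal_of_enat (space_usage p (A n (M n)) n (M n))) sequentially"
    proof eventually_elim
      case (elim n)
      \<comment> \<open>The hypothesis on \<open>A\<close> only concerns \<open>m \<ge> N\<close>,
        so \<open>M n\<close> has to reach \<open>N\<close>.\<close>
      have "real (t n) ^ 1 \<le> real (t n) ^ p" using elim p by (intro power_increasing) auto
      moreover have "real n powr c / 4 \<le> real (t n)" using elim by blast
      ultimately have "real N \<le> real (M n)" using elim(3) Mge[of n] by simp
      hence MN: "M n \<ge> N" by simp
      have \<beta>: "\<beta> n (M n) * real (Suc p) < real (q n) / real d"
      proof -
        have "\<beta> n (M n) * real (Suc p) < y n / (c * (real p + 1)^2) * real (Suc p)"
          using N(1)[OF elim(2) MN] by (intro mult_strict_right_mono) auto
        also have "\<dots> = y n / K"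
          using assms by (simp add: K_def power2_eq_square add.commute)
        also have "\<dots> \<le> real (q n) / real d" using elim d K by (simp add: field_simps)
        finally show ?thesis .
      qed
      show ?case
      proof (cases "space_usage p (A n (M n)) n (M n)")
        case (enat b)
        obtain f enc lab vs where "set_cover_reduction p (q n) d (t n) n f enc lab vs"
          using set_cover_reduction_exists[of p d "t n" "q n" n] p d elim unfolding M_def by blast
        then interpret set_cover_reduction p "q n" d "t n" n f enc lab vs .
        have "1 / 6 \<le> (\<Sum>i=1..p. sqrt (real i * ((real b + 1) * ln 2) / (2 * real (t n))))"
          using space_lower_bound[of "A n (M n)" "\<beta> n (M n)" b] N(2)[OF elim(2) MN] \<beta> enat
          unfolding M_def by simp
        hence "real (t n) \<le> 18 * real p ^ 3 * (real b + 1)"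
          using elim by (intro sum_sqrt_bound) auto
        hence "real n powr c / 4 \<le> 18 * real p ^ 3 * (real b + 1)" using elim by linarith
        \<comment> \<open>Here \<open>n powr c \<ge> 300 * p ^ 3\<close> absorbs the summand 1 of
          \<open>b + 1\<close>: the constant 72 becomes \<open>72 / (1 - 72 / 300)\<close>, which is
          below 100.\<close>
        hence "real n powr c \<le> 100 * (real b * real p ^ 3)" using elim by (simp add: algebra_simps)
        hence "1/100 * real n powr c / real p ^ 3 \<le> real b"
          using p by (simp add: field_simps)
        thus ?thesis unfolding enat by simp
      qed simp
    qed
    thus "\<exists>n0. \<forall>n\<ge>n0. ereal (1/100 * real n powr c / real p ^ 3)
                \<le> ereal_of_enat (space_usage p (A n (M n)) n (M n))"
      unfolding eventually_sequentially .
  qed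
qed simp

end
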